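(* Let $X$ be a compact metrizable space and $T:X\to X$ a continuous map. For any metric $D$ on $\mathcal{M}(X)$ compatible with the weak-$*$ topology, $$h_{top}(T)>0\iff \mathrm{mdim}(\mathcal{M}(X),D,T_* )>0\iff \mathrm{mdim}(\mathcal{M}(X),D,T_* )=\infty.$$
   Context: $\mathcal{M}(X)$ is the space of Borel probability measures on $X$ with the weak-$*$ topology, and $T_*\mu=\mu\circ T^{-1}$. $h_{top}$ denotes topological entropy. For a compact metric space $(Y,\rho)$ and continuous $S:Y\to Y$, let $\rho_n(x,y)=\max_{0\le i\le n-1}\rho(S^ix,S^iy)$, let $s_n(\rho,S,Y,\epsilon)$ be the largest cardinality of a set $E\subset Y$ with $\rho_n(x,y)>\epsilon$ for all distinct $x,y\in E$, and $h_\rho(S,\epsilon)=\limsup_{n\to\infty}\frac1n\log s_n(\rho,S,Y,\epsilon)$. The upper and lower metric mean dimensions are $\overline{\mathrm{mdim}}(Y,\rho,S)=\limsup_{\epsilon\to0}\frac{h_\rho(S,\epsilon)}{\log(1/\epsilon)}$ and $\underline{\mathrm{mdim}}(Y,\rho,S)=\liminf_{\epsilon\to0}\frac{h_\rho(S,\epsilon)}{\log(1/\epsilon)}$. If they coincide, the common value in $[0,\infty]$ is the metric mean dimension $\mathrm{mdim}(Y,\rho,S)$. The assertion $\mathrm{mdim}(\mathcal{M}(X),D,T_* )>0$ (resp. $=\infty$) means that the upper and lower metric mean dimensions coincide and their common value is $>0$ (resp. $=\infty$). *)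

theory Defs
  imports "HOL-Probability.Probability"
begin

section \<open>Borel probability measures with the weak-* topology\<close>

definition borel_of :: "'a topology \<Rightarrow> 'a measure" where
  "borel_of X = sigma (topspace X) {U. openin X U}"

definition prob_measures :: "'a topology \<Rightarrow> 'a measure set" where
  "prob_measures X = {\<mu>. sets \<mu> = sets (borel_of X) \<and> prob_space \<mu>}"

text \<open>The coarsest topology on \<^term>\<open>prob_measures X\<close> for which integration against every
  continuous real function is continuous.\<close>

definition weak_star_topology :: "'a topology \<Rightarrow> 'a measure topology" where
  "weak_star_topology X = topology_generated_by
     {{\<mu> \<in> prob_measures X. (\<integral>x. f x \<partial>\<mu>) \<in> U} | f U.
        continuous_map X euclideanreal f \<and> open (U :: real set)}"

lemma topspace_weak_star_topology: "topspace (weak_star_topology X) = prob_measures X"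
proof
  have "continuous_map X euclideanreal (\<lambda>x. 0) \<and> open (UNIV :: real set)"
    by simp
  then have "{\<mu> \<in> prob_measures X. (\<integral>x. 0 \<partial>\<mu>) \<in> (UNIV :: real set)} \<in>
      {{\<mu> \<in> prob_measures X. (\<integral>x. f x \<partial>\<mu>) \<in> U} | f U.
        continuous_map X euclideanreal f \<and> open (U :: real set)}"
    by blast
  then show "prob_measures X \<subseteq> topspace (weak_star_topology X)"
    by (auto simp: weak_star_topology_def)
qed (auto simp: weak_star_topology_def)

definition push_forward :: "'a topology \<Rightarrow> ('a \<Rightarrow> 'a) \<Rightarrow> 'a measure \<Rightarrow> 'a measure" where
  "push_forward X T \<mu> = distr \<mu> (borel_of X) T"


section \<open>Topological entropy\<close>

text \<open>The Adler--Konheim--McAndrew definition by open covers, which needs no metric.\<close>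

definition open_cover :: "'a topology \<Rightarrow> 'a set set \<Rightarrow> bool" where
  "open_cover X \<U> \<longleftrightarrow> (\<forall>U\<in>\<U>. openin X U) \<and> \<Union>\<U> = topspace X"

text \<open>The smallest cardinality of a finite subcover, which exists for the open covers of a
  compact space.\<close>

definition cover_number :: "'a topology \<Rightarrow> 'a set set \<Rightarrow> nat" where
  "cover_number X \<U> = (LEAST k. \<exists>\<V>\<subseteq>\<U>. finite \<V> \<and> \<Union>\<V> = topspace X \<and> card \<V> = k)"

text \<open>The common refinement of the covers \<open>\<U>, T\<^sup>-\<^sup>1\<U>, \<dots>, T\<^sup>-\<^sup>(\<^sup>n\<^sup>-\<^sup>1\<^sup>)\<U>\<close>.\<close>

definition iterated_join :: "'a topology \<Rightarrow> ('a \<Rightarrow> 'a) \<Rightarrow> 'a set set \<Rightarrow> nat \<Rightarrow> 'a set set" where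
  "iterated_join X T \<U> n =
     {{x \<in> topspace X. \<forall>i<n. (T ^^ i) x \<in> A i} | A. \<forall>i<n. A i \<in> \<U>}"

text \<open>The limit superior is a limit, by subadditivity.\<close>

definition cover_entropy :: "'a topology \<Rightarrow> ('a \<Rightarrow> 'a) \<Rightarrow> 'a set set \<Rightarrow> ereal" where
  "cover_entropy X T \<U> =
     limsup (\<lambda>n. ereal (ln (real (cover_number X (iterated_join X T \<U> n))) / real n))"

definition topological_entropy :: "'a topology \<Rightarrow> ('a \<Rightarrow> 'a) \<Rightarrow> ereal" where
  "topological_entropy X T = (SUP \<U>\<in>{\<U>. open_cover X \<U>}. cover_entropy X T \<U>)"


section \<open>Metric mean dimension\<close>

text \<open>At \<open>n = 0\<close> the maximum is over the empty set and has no meaning; only large \<open>n\<close> matter.\<close>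

definition bowen_dist :: "('b \<Rightarrow> 'b \<Rightarrow> real) \<Rightarrow> ('b \<Rightarrow> 'b) \<Rightarrow> nat \<Rightarrow> 'b \<Rightarrow> 'b \<Rightarrow> real" where
  "bowen_dist d S n x y = Max ((\<lambda>i. d ((S ^^ i) x) ((S ^^ i) y)) ` {..<n})"

text \<open>For \<open>n \<ge> 1\<close>, \<open>\<epsilon> > 0\<close>, a compact metric space \<open>(Y, d)\<close> and a continuous \<open>S\<close>, every
  separated set is finite and the cardinalities are bounded, so the maximum is attained.\<close>

definition sep_number ::
    "'b set \<Rightarrow> ('b \<Rightarrow> 'b \<Rightarrow> real) \<Rightarrow> ('b \<Rightarrow> 'b) \<Rightarrow> nat \<Rightarrow> real \<Rightarrow> nat" where
  "sep_number Y d S n \<epsilon> =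
     Max {card E | E. E \<subseteq> Y \<and> finite E \<and> (\<forall>x\<in>E. \<forall>y\<in>E. x \<noteq> y \<longrightarrow> bowen_dist d S n x y > \<epsilon>)}"

definition entropy_at_scale ::
    "'b set \<Rightarrow> ('b \<Rightarrow> 'b \<Rightarrow> real) \<Rightarrow> ('b \<Rightarrow> 'b) \<Rightarrow> real \<Rightarrow> ereal" where
  "entropy_at_scale Y d S \<epsilon> = limsup (\<lambda>n. ereal (ln (real (sep_number Y d S n \<epsilon>)) / real n))"

definition upper_mdim :: "'b set \<Rightarrow> ('b \<Rightarrow> 'b \<Rightarrow> real) \<Rightarrow> ('b \<Rightarrow> 'b) \<Rightarrow> ereal" where
  "upper_mdim Y d S =
     Limsup (at_right 0) (\<lambda>\<epsilon>. entropy_at_scale Y d S \<epsilon> / ereal (ln (1 / \<epsilon>)))"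

definition lower_mdim :: "'b set \<Rightarrow> ('b \<Rightarrow> 'b \<Rightarrow> real) \<Rightarrow> ('b \<Rightarrow> 'b) \<Rightarrow> ereal" where
  "lower_mdim Y d S =
     Liminf (at_right 0) (\<lambda>\<epsilon>. entropy_at_scale Y d S \<epsilon> / ereal (ln (1 / \<epsilon>)))"

text \<open>The metric mean dimension exists and equals \<open>v\<close>.\<close>

definition has_mdim :: "'b set \<Rightarrow> ('b \<Rightarrow> 'b \<Rightarrow> real) \<Rightarrow> ('b \<Rightarrow> 'b) \<Rightarrow> ereal \<Rightarrow> bool" where
  "has_mdim Y d S v \<longleftrightarrow> upper_mdim Y d S = v \<and> lower_mdim Y d S = v"

end

theory Submission
  imports Defs
begin

text \<open>Zero entropy: in the spirit of Glasner and Weiss, an iterated cover of \<open>X\<close> with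
  \<open>exp (o n)\<close> elements is used to describe a measure by an empirical measure with a bounded number of
  atoms, which approximates all but few of its integrals along the orbit; the exceptional integrals
  are recorded separately. There are thus \<open>exp (o n)\<close> measures up to \<open>\<epsilon>\<close> in the Bowen metric, so
  \<open>T\<^sub>*\<close> has zero entropy at every scale.

  Positive entropy: a pair of disjoint closed sets has independence sets of positive density. Mixing
  point masses that realize prescribed words along such a set gives cubes in the space of measures
  whose dimension exceeds any multiple of \<open>n\<close> and whose opposite faces are a fixed distance apart in
  the Bowen metric. By Poincare--Miranda such a cube of dimension \<open>K n\<close> contains about
  \<open>\<epsilon> ^ (- K n)\<close> points that are \<open>\<epsilon>\<close>-separated, for whatever metric compatible with the
  topology.\<close>


text \<open>An arbitrary compatible metric gives no rate: integrals of continuous functions are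
  uniformly continuous for \<open>D\<close>, but with an unknown modulus. A grid of values of
  integrals therefore does not produce measures separated at scale \<epsilon>, and the count has to
  come from functions that are Lipschitz for whatever \<open>D\<close>, the distances to sets of
  measures. These are not affine in the parameters of the cube, so their values cannot be prescribed
  by solving equations; a topological argument has to do it. Independence of positive density yields
  only a number of binary choices proportional to \<open>n\<close>. Measures allow more: a window
  with \<open>m\<close> free times has \<open>2 ^ m - 1\<close> nonempty words, and their
  probabilities can all be varied separately. The resulting gap depends on \<open>m\<close>, but
  neither on \<open>n\<close> nor on \<epsilon>, so it disappears in the limit. In the opposite
  direction the number of atoms has to be fixed before \<open>n\<close>, because the subexponential
  number of cells is raised to that power.\<close>

section \<open>Combinatorial lemmas\<close>

text \<open>Each function is weighted by \<open>\<theta>\<close> to the number of its nonzero values: the total weight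
  \<open>(1 + Q \<theta>) ^ card N\<close> bounds the number of functions with few nonzero values.\<close>

lemma card_sparse_functions:
  fixes \<eta> :: real and Q :: nat
  assumes "\<eta> > 0"
  obtains \<delta> :: real where "\<delta> > 0"
    "\<And>N :: 'i set. finite N \<Longrightarrow>
       real (card {c \<in> N \<rightarrow>\<^sub>E {..Q}. real (card {j\<in>N. c j \<noteq> 0}) \<le> \<delta> * card N}) \<le> exp (\<eta> * card N)"
proof -
  \<comment> \<open>\<open>\<eta>\<close> is spent in two halves: \<open>\<theta>\<close> is so
    small that the total weight of one coordinate is
    \<open>1 + Q * \<theta> \<le> exp (\<eta> / 2)\<close>, and \<open>\<delta>\<close> below is
    such that each function counted has weight at least
    \<open>exp (- (\<eta> / 2 * card N))\<close>.\<close>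
  define \<theta> where "\<theta> = min (1/2) (\<eta> / (2 * (Q + 1)))"
  have \<theta>: "0 < \<theta>" "\<theta> < 1" using assms by (auto simp: \<theta>_def)
  have "\<theta> \<le> \<eta> / 2 / (Q + 1)" by (auto simp: \<theta>_def)
  then have "\<theta> * (Q + 1) \<le> \<eta> / 2" by (simp only: pos_le_divide_eq of_nat_0_less_iff)
  then have Q\<theta>: "Q * \<theta> \<le> \<eta> / 2" using \<theta> by (simp add: algebra_simps)
  define \<delta> where "\<delta> = \<eta> / (2 * ln (1 / \<theta>))"
  have ln: "ln (1 / \<theta>) > 0" using \<theta> by simp
  have "\<delta> > 0" using assms ln by (simp add: \<delta>_def)
  have \<delta>: "\<delta> * ln (1 / \<theta>) = \<eta> / 2" using ln by (simp add: \<delta>_def)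
  show thesis
  proof (rule that[OF \<open>\<delta> > 0\<close>])
    fix N :: "'i set" assume N: "finite N"
    define C where "C = {c \<in> N \<rightarrow>\<^sub>E {..Q}. real (card {j\<in>N. c j \<noteq> 0}) \<le> \<delta> * card N}"
    define w where "w v = (if v = 0 then 1 else \<theta>)" for v :: nat
    have fin: "finite (N \<rightarrow>\<^sub>E {..Q})" by (intro finite_PiE N) auto
    have wt: "exp (- (\<eta> / 2 * card N)) \<le> (\<Prod>j\<in>N. w (c j))" if "c \<in> C" for c
    proof -
      have "(\<Prod>j\<in>N. w (c j)) = (\<Prod>j\<in>{j\<in>N. c j \<noteq> 0}. \<theta>)"
        unfolding w_def using N by (intro prod.mono_neutral_cong_right) auto
      also have "\<dots> = exp (- (real (card {j\<in>N. c j \<noteq> 0}) * ln (1 / \<theta>)))"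
        using \<theta> by (simp add: ln_div powr_realpow[symmetric] powr_def)
      also have "\<dots> \<ge> exp (- (\<delta> * card N * ln (1 / \<theta>)))"
        using that ln by (auto simp: C_def intro!: mult_right_mono)
      also have "\<delta> * card N * ln (1 / \<theta>) = \<eta> / 2 * card N"
        using \<delta> by (simp add: algebra_simps)
      finally show ?thesis by simp
    qed
    have "card C * exp (- (\<eta> / 2 * card N)) = (\<Sum>c\<in>C. exp (- (\<eta> / 2 * card N)))" by simp
    also have "\<dots> \<le> (\<Sum>c\<in>C. \<Prod>j\<in>N. w (c j))" by (intro sum_mono wt)
    also have "\<dots> \<le> (\<Sum>c\<in>N \<rightarrow>\<^sub>E {..Q}. \<Prod>j\<in>N. w (c j))"
      using \<theta> by (intro sum_mono2 fin) (auto simp: C_def w_def intro!: prod_nonneg)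
    also have "\<dots> = (\<Prod>j\<in>N. \<Sum>v\<le>Q. w v)"
      by (rule prod_sum_PiE[symmetric]) (use N in auto)
    also have "(\<Sum>v\<le>Q. w v) = 1 + Q * \<theta>"
      by (simp add: sum.atMost_shift w_def)
    also have "(\<Prod>j\<in>N. 1 + Q * \<theta>) \<le> exp (\<eta> / 2 * card N)"
    proof -
      have "1 + Q * \<theta> \<le> exp (\<eta> / 2)" using exp_ge_add_one_self[of "Q * \<theta>"] Q\<theta>
        by (smt (verit) exp_le_cancel_iff)
      then have "(1 + Q * \<theta>) ^ card N \<le> exp (\<eta> / 2) ^ card N"
        using \<theta> by (intro power_mono) auto
      then show ?thesis by (simp add: exp_of_nat_mult[symmetric] mult.commute)
    qed
    finally have "card C \<le> exp (\<eta> / 2 * card N) * exp (\<eta> / 2 * card N)"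
      by (simp add: exp_minus field_simps)
    also have "\<dots> = exp (\<eta> * card N)" by (simp add: exp_add[symmetric])
    finally show "real (card {c \<in> N \<rightarrow>\<^sub>E {..Q}. real (card {j\<in>N. c j \<noteq> 0}) \<le> \<delta> * card N}) \<le> exp (\<eta> * card N)"
      by (simp add: C_def)
  qed
qed

text \<open>Partial words: \<open>None\<close> stands for an undetermined letter.\<close>

definition clash :: "('i \<Rightarrow> bool option) \<Rightarrow> ('i \<Rightarrow> bool option) \<Rightarrow> 'i set" where
  "clash w v = {j. \<exists>b. w j = Some b \<and> v j = Some (\<not> b)}"

definition shatters :: "('i \<Rightarrow> bool option) set \<Rightarrow> 'i set \<Rightarrow> bool" where
  "shatters S J \<longleftrightarrow> (\<forall>\<sigma>. \<exists>w\<in>S. \<forall>j\<in>J. w j = Some (\<sigma> j))"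

text \<open>Averaging over pairs, some coordinate splits off two subfamilies, each a proportion at least
  \<open>\<delta> / 4\<close> of \<open>S\<close>. Their shattered sets add up as in Pajor's proof of the Sauer--Shelah lemma.\<close>

lemma card_shattered_ge:
  fixes \<delta> \<alpha> :: real and S :: "('i \<Rightarrow> bool option) set"
  assumes I: "finite I" "I \<noteq> {}" and \<delta>: "0 < \<delta>" and \<alpha>: "0 \<le> \<alpha>" "1 \<le> 2 * (\<delta> / 4) powr \<alpha>"
    and S: "finite S" "S \<noteq> {}"
    and sep: "\<And>w v. w \<in> S \<Longrightarrow> v \<in> S \<Longrightarrow> w \<noteq> v \<Longrightarrow> \<delta> * card I \<le> card (I \<inter> clash w v)"
  shows "card S powr \<alpha> \<le> card {J. J \<subseteq> I \<and> shatters S J}"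
  using S sep
proof (induction S rule: finite_psubset_induct)
  case (psubset S)
  have finP: "finite {J. J \<subseteq> I \<and> shatters S J}" for S using I by simp
  define s where "s = card S"
  show ?case
  proof (cases "s \<le> 1")
    case True
    then have "card S = 1" using psubset by (simp add: s_def card_gt_0_iff le_Suc_eq)
    moreover have "{} \<in> {J. J \<subseteq> I \<and> shatters S J}"
      using psubset.prems by (auto simp: shatters_def)
    then have "card {J. J \<subseteq> I \<and> shatters S J} > 0" using finP by (auto simp: card_gt_0_iff)
    ultimately show ?thesis by simp
  next
    case False
    define part where "part b z = {w\<in>S. w z = Some b}" for b z
    have finpart: "finite (part b z)" for b z using psubset by (simp add: part_def)
    \<comment> \<open>Triples of two words and a coordinate at which they clash are counted twice:
      by pairs of words here, by coordinates below.\<close>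
    have "s * (s - 1) * (\<delta> * card I) \<le> (\<Sum>(w,v)\<in>S\<times>S. real (card (I \<inter> clash w v)))"
    proof -
      have "card (S \<times> S - Id_on S) = s * (s - 1)"
      proof -
        have "Id_on S = (\<lambda>x. (x,x)) ` S" by (auto simp: Id_on_def)
        then have "card (Id_on S) = s" by (simp add: s_def card_image inj_on_def)
        then show ?thesis using psubset.hyps
          by (subst card_Diff_subset) (auto simp: s_def card_cartesian_product algebra_simps \<open>Id_on S = _\<close>)
      qed
      then have "s * (s - 1) * (\<delta> * card I) = (\<Sum>(w,v)\<in>S\<times>S - Id_on S. \<delta> * card I)"
        by (simp add: case_prod_unfold)
      also have "\<dots> \<le> (\<Sum>(w,v)\<in>S\<times>S - Id_on S. real (card (I \<inter> clash w v)))"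
        using psubset.prems by (intro sum_mono) (auto simp: Id_on_def)
      also have "\<dots> \<le> (\<Sum>(w,v)\<in>S\<times>S. real (card (I \<inter> clash w v)))"
        using psubset.hyps by (intro sum_mono2) auto
      finally show ?thesis .
    qed
    also have "\<dots> = (\<Sum>p\<in>S\<times>S. \<Sum>z\<in>I. if z \<in> clash (fst p) (snd p) then 1 else 0)"
      using I by (intro sum.cong) (auto simp: sum.If_cases)
    also have "\<dots> = (\<Sum>z\<in>I. \<Sum>p\<in>S\<times>S. if z \<in> clash (fst p) (snd p) then 1 else 0)"
      by (rule sum.swap)
    also have "\<dots> = (\<Sum>z\<in>I. 2 * real (card (part False z)) * card (part True z))"
    proof (intro sum.cong refl)
      fix z
      have eq: "{p \<in> S \<times> S. z \<in> clash (fst p) (snd p)}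
          = part False z \<times> part True z \<union> part True z \<times> part False z"
        by (auto simp: clash_def part_def ex_bool_eq)
      have "(\<Sum>p\<in>S\<times>S. if z \<in> clash (fst p) (snd p) then 1 else 0)
          = real (card {p \<in> S \<times> S. z \<in> clash (fst p) (snd p)})"
        using psubset.hyps by (simp add: sum.If_cases Int_def)
      also have "\<dots> = 2 * real (card (part False z)) * card (part True z)"
        unfolding eq using finpart
        by (subst card_Un_disjoint) (auto simp: part_def card_cartesian_product)
      finally show "(\<Sum>p\<in>S\<times>S. if z \<in> clash (fst p) (snd p) then 1 else 0)
          = 2 * real (card (part False z)) * card (part True z)" .
    qed
    finally have sum_ge: "s * (s - 1) * (\<delta> * card I)
        \<le> (\<Sum>z\<in>I. 2 * real (card (part False z)) * card (part True z))" .
    \<comment> \<open>Otherwise the sum falls short, as \<open>s - 1 \<ge> s / 2\<close>. Since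
      neither part exceeds \<open>s\<close>, a product this large forces both parts to have at least
      \<open>\<delta> / 4 * s\<close> words.\<close>
    have "\<exists>z\<in>I. \<delta> * s * s / 4 \<le> real (card (part False z)) * card (part True z)"
    proof (rule ccontr)
      assume "\<not> ?thesis"
      then have "(\<Sum>z\<in>I. 2 * real (card (part False z)) * card (part True z)) < (\<Sum>z\<in>I. \<delta> * s * s / 2)"
        using I by (intro sum_strict_mono) (auto simp: not_le)
      also have "\<dots> = s * (s / 2) * (\<delta> * card I)" by simp
      also have "\<dots> \<le> s * (s - 1) * (\<delta> * card I)"
        using False \<delta> by (intro mult_right_mono mult_left_mono) auto
      finally show False using sum_ge by simp
    qed
    then obtain z where z: "z \<in> I"
      and prod: "\<delta> * s * s / 4 \<le> real (card (part False z)) * card (part True z)" by blast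
    have le_s: "card (part b z) \<le> s" for b
      unfolding s_def part_def using psubset.hyps by (intro card_mono) auto
    have s0: "real s > 0" using False by simp
    have big: "\<delta> / 4 * s \<le> card (part b z)" for b
    proof -
      have "real (card (part False z)) * card (part True z) = real (card (part b z)) * card (part (\<not> b) z)"
        by (cases b) auto
      also have "\<dots> \<le> real (card (part b z)) * s" using le_s by (intro mult_left_mono) auto
      finally have "\<delta> / 4 * s * s \<le> real (card (part b z)) * s" using prod by simp
      then show ?thesis using s0 by (simp only: mult_le_cancel_right_pos)
    qed
    have ne: "part b z \<noteq> {}" for b
    proof -
      have "\<delta> / 4 * s > 0" using \<delta> s0 by simp
      then have "real (card (part b z)) > 0" using big[of b] by linarith
      then show ?thesis by auto
    qed
    define A where "A b = {J. J \<subseteq> I \<and> shatters (part b z) J}" for b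
    have IH: "(\<delta> / 4 * s) powr \<alpha> \<le> card (A b)" for b
    proof -
      obtain x where "x \<in> S" "x \<notin> part b z" using ne[of "\<not> b"] by (auto simp: part_def)
      then have "part b z \<subset> S" by (auto simp: part_def)
      then have "card (part b z) powr \<alpha> \<le> card (A b)"
        unfolding A_def using psubset.prems by (intro psubset.IH ne) (auto simp: part_def)
      moreover have "(\<delta> / 4 * s) powr \<alpha> \<le> card (part b z) powr \<alpha>"
        using big \<delta> s0 \<alpha> by (intro powr_mono2) auto
      ultimately show ?thesis by linarith
    qed
    \<comment> \<open>All words of \<open>part b z\<close> carry the letter \<open>b\<close> at
      \<open>z\<close>, so neither part shatters a set containing \<open>z\<close>. A set
      \<open>J\<close> shattered by both parts thus yields the further set
      \<open>insert z J\<close>, and \<open>S\<close> shatters at least as many sets as the two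
      parts together.\<close>
    have notin: "z \<notin> J" if "J \<in> A b" for J b
    proof
      assume "z \<in> J"
      moreover from that obtain w where "w \<in> part b z" "\<forall>j\<in>J. w j = Some (\<not> b)"
        unfolding A_def shatters_def by (auto dest: spec[where x = "\<lambda>_. \<not> b"])
      ultimately show False by (auto simp: part_def)
    qed
    have sub: "A False \<union> A True \<union> insert z ` (A False \<inter> A True) \<subseteq> {J. J \<subseteq> I \<and> shatters S J}"
    proof -
      have "shatters S J" if "J \<in> A b" for J b
        using that by (force simp: A_def shatters_def part_def)
      moreover have "shatters S (insert z J)" if J: "J \<in> A False \<inter> A True" for J
        unfolding shatters_def
      proof
        fix \<sigma>
        have "J \<in> A (\<sigma> z)" using J by (cases "\<sigma> z") auto
        then have "shatters (part (\<sigma> z) z) J" by (simp add: A_def)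
        then obtain w where "w \<in> part (\<sigma> z) z" "\<forall>j\<in>J. w j = Some (\<sigma> j)"
          unfolding shatters_def by blast
        then show "\<exists>w\<in>S. \<forall>j\<in>insert z J. w j = Some (\<sigma> j)" by (auto simp: part_def)
      qed
      ultimately show ?thesis using z by (auto simp: A_def)
    qed
    have finA: "finite (A b)" for b unfolding A_def by (rule finP)
    have "real (card (A False)) + card (A True)
        = card (A False \<union> A True) + card (A False \<inter> A True)"
      using card_Un_Int[OF finA[of False] finA[of True]] by simp
    also have "card (A False \<inter> A True) = card (insert z ` (A False \<inter> A True))"
      using notin by (intro card_image[symmetric] inj_onI) (metis Int_iff insert_ident)
    also have "card (A False \<union> A True) + \<dots> = card (A False \<union> A True \<union> insert z ` (A False \<inter> A True))"
      using finA notin by (subst card_Un_disjoint) auto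
    also have "\<dots> \<le> card {J. J \<subseteq> I \<and> shatters S J}"
      by (intro card_mono sub finP)
    finally have "real (card (A False)) + card (A True) \<le> card {J. J \<subseteq> I \<and> shatters S J}"
      by simp
    \<comment> \<open>The assumption on \<alpha> says that two parts of proportion
      \<open>\<delta> / 4\<close> make up for the whole.\<close>
    moreover have "s powr \<alpha> \<le> 2 * (\<delta> / 4 * s) powr \<alpha>"
    proof -
      have "1 * s powr \<alpha> \<le> 2 * (\<delta> / 4) powr \<alpha> * s powr \<alpha>"
        by (intro mult_right_mono \<alpha>) simp
      also have "\<dots> = 2 * (\<delta> / 4 * s) powr \<alpha>"
        using \<delta> s0 by (subst powr_mult) auto
      finally show ?thesis by simp
    qed
    ultimately show ?thesis using IH[of False] IH[of True] unfolding s_def by linarith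
  qed
qed

text \<open>Kuhn's combinatorial lemma replaces a fixed point theorem: it finds a small grid cube on
  which every label \<open>g i > y i\<close> takes both values, so that by uniform continuity all
  \<open>g i\<close> are within \<open>e\<close> of \<open>y i\<close> at its corner. Hitting the
  target up to \<open>e\<close> is enough later, so no limit is taken.\<close>

lemma poincare_miranda_approx:
  fixes g :: "'i \<Rightarrow> ('i \<Rightarrow> real) \<Rightarrow> real"
  assumes I: "finite I"
    and lo: "\<And>t i. (\<forall>j\<in>I. t j \<in> {0..1}) \<Longrightarrow> i \<in> I \<Longrightarrow> t i = 0 \<Longrightarrow> g i t \<le> 0"
    and hi: "\<And>t i. (\<forall>j\<in>I. t j \<in> {0..1}) \<Longrightarrow> i \<in> I \<Longrightarrow> t i = 1 \<Longrightarrow> \<delta> \<le> g i t"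
    and uc: "\<And>e. e > 0 \<Longrightarrow> \<exists>\<tau>>0. \<forall>t t'. (\<forall>j\<in>I. t j \<in> {0..1}) \<longrightarrow> (\<forall>j\<in>I. t' j \<in> {0..1}) \<longrightarrow>
               (\<forall>j\<in>I. \<bar>t j - t' j\<bar> \<le> \<tau>) \<longrightarrow> (\<forall>i\<in>I. \<bar>g i t - g i t'\<bar> < e)"
    and y: "\<And>i. i \<in> I \<Longrightarrow> 0 \<le> y i \<and> y i < \<delta>" and e: "e > 0"
  obtains t where "\<forall>j\<in>I. t j \<in> {0..1}" "\<forall>i\<in>I. \<bar>g i t - y i\<bar> < e"
proof -
  obtain \<tau> where \<tau>: "\<tau> > 0"
    "\<And>t t' i. (\<forall>j\<in>I. t j \<in> {0..1}) \<Longrightarrow> (\<forall>j\<in>I. t' j \<in> {0..1}) \<Longrightarrow>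
               (\<forall>j\<in>I. \<bar>t j - t' j\<bar> \<le> \<tau>) \<Longrightarrow> i\<in>I \<Longrightarrow> \<bar>g i t - g i t'\<bar> < e"
    using uc[OF e] by blast
  obtain p :: nat where p: "p > 0" "1 / p \<le> \<tau>"
    using real_arch_inverse[of \<tau>] \<tau>(1) by (auto simp: inverse_eq_divide intro: less_imp_le)
  define n where "n = card I"
  obtain h where h: "bij_betw h {0..<n} I" using ex_bij_betw_nat_finite[OF I] n_def by blast
  define k where "k = the_inv_into {0..<n} h"
  have k: "k i < n" "h (k i) = i" if "i \<in> I" for i
    using that h the_inv_into_into[of h "{0..<n}" i "{0..<n}"] f_the_inv_into_f[of h "{0..<n}" i]
    by (auto simp: k_def bij_betw_def)
  have hk: "k (h j) = j" "h j \<in> I" if "j < n" for j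
    using that h by (auto simp: k_def bij_betw_def the_inv_into_f_f)
  define pt where "pt x = (\<lambda>i. real (x (k i)) / p)" for x :: "nat \<Rightarrow> nat"
  have pt: "\<forall>j\<in>I. pt x j \<in> {0..1}" if "\<forall>i<n. x i \<le> p" for x
    using that k p by (auto simp: pt_def)
  \<comment> \<open>The face conditions \<open>g i t \<le> 0 \<le> y i\<close> and
    \<open>y i < \<delta> \<le> g i t\<close> become the boundary labels 0 and 1 that Kuhn's lemma
    asks for.\<close>
  define label where "label x i = (if g (h i) (pt x) > y (h i) then 1 else 0 :: nat)" for x i
  obtain q where q: "\<forall>i<n. q i < p"
    and rs: "\<forall>i<n. \<exists>r s. (\<forall>j<n. q j \<le> r j \<and> r j \<le> q j + 1) \<and> (\<forall>j<n. q j \<le> s j \<and> s j \<le> q j + 1)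
        \<and> label r i \<noteq> label s i"
  proof (rule kuhn_lemma[of p n label])
    show "\<forall>x. (\<forall>i<n. x i \<le> p) \<longrightarrow> (\<forall>i<n. x i = 0 \<longrightarrow> label x i = 0)"
    proof (intro allI impI)
      fix x i assume x: "\<forall>i<n. x i \<le> p" and i: "i < n" "x i = 0"
      then have "g (h i) (pt x) \<le> 0" using hk by (intro lo pt) (auto simp: pt_def)
      then show "label x i = 0" using y[of "h i"] hk i by (auto simp: label_def)
    qed
    show "\<forall>x. (\<forall>i<n. x i \<le> p) \<longrightarrow> (\<forall>i<n. x i = p \<longrightarrow> label x i = 1)"
    proof (intro allI impI)
      fix x i assume x: "\<forall>i<n. x i \<le> p" and i: "i < n" "x i = p"
      then have "\<delta> \<le> g (h i) (pt x)" using hk p by (intro hi pt) (auto simp: pt_def)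
      then show "label x i = 1" using y[of "h i"] hk i by (auto simp: label_def)
    qed
  qed (use p in \<open>auto simp: label_def\<close>)
  have near: "\<forall>j\<in>I. pt r j \<in> {0..1}" "\<forall>j\<in>I. \<bar>pt r j - pt q j\<bar> \<le> \<tau>"
    if r: "\<forall>j<n. q j \<le> r j \<and> r j \<le> q j + 1" for r
  proof -
    show "\<forall>j\<in>I. pt r j \<in> {0..1}" using r q by (intro pt) (fastforce simp: Suc_le_eq)
    have "\<bar>pt r j - pt q j\<bar> \<le> 1 / p" if "j \<in> I" for j
    proof -
      have "\<bar>real (r (k j)) - real (q (k j))\<bar> \<le> 1" using r k[OF that] by force
      then show ?thesis using p by (simp add: pt_def diff_divide_distrib[symmetric] divide_right_mono)
    qed
    then show "\<forall>j\<in>I. \<bar>pt r j - pt q j\<bar> \<le> \<tau>" using p by force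
  qed
  have q1: "\<forall>j\<in>I. pt q j \<in> {0..1}" using q by (intro pt) auto
  show thesis
  proof (rule that[OF q1], intro ballI)
    fix i assume i: "i \<in> I"
    obtain r s where r: "\<forall>j<n. q j \<le> r j \<and> r j \<le> q j + 1" and s: "\<forall>j<n. q j \<le> s j \<and> s j \<le> q j + 1"
      and ne: "label r (k i) \<noteq> label s (k i)"
      using rs k[OF i] by blast
    have "\<bar>g i (pt r) - g i (pt q)\<bar> < e" "\<bar>g i (pt s) - g i (pt q)\<bar> < e"
      using near[OF r] near[OF s] q1 i by (auto intro!: \<tau>(2))
    then show "\<bar>g i (pt q) - y i\<bar> < e"
      using ne k[OF i] by (auto simp: label_def split: if_splits)
  qed
qed


section \<open>Borel measures on a compact metrizable space\<close>

lemma space_borel_of [simp]: "space (borel_of X) = topspace X"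
  by (simp add: borel_of_def space_measure_of_conv)

lemma sets_borel_of_open: "openin X U \<Longrightarrow> U \<in> sets (borel_of X)"
  by (subst borel_of_def, subst sets_measure_of) (auto dest: openin_subset)

lemma measurable_borel_of_continuous:
  assumes "continuous_map X Y f"
  shows "f \<in> borel_of X \<rightarrow>\<^sub>M borel_of Y"
proof -
  have "f \<in> borel_of X \<rightarrow>\<^sub>M sigma (topspace Y) {U. openin Y U}"
  proof (rule measurable_measure_of)
    fix U assume "U \<in> {U. openin Y U}"
    then have "openin X {x \<in> topspace X. f x \<in> U}"
      using openin_continuous_map_preimage[OF assms] by simp
    also have "{x \<in> topspace X. f x \<in> U} = f -` U \<inter> space (borel_of X)" by auto
    finally show "f -` U \<inter> space (borel_of X) \<in> sets (borel_of X)" by (rule sets_borel_of_open)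
  qed (use assms in \<open>auto dest: openin_subset continuous_map_image_subset_topspace\<close>)
  then show ?thesis by (simp add: borel_of_def)
qed

lemma borel_measurable_continuous_map:
  fixes f :: "'a \<Rightarrow> real"
  assumes "continuous_map X euclidean f"
  shows "f \<in> borel_measurable (borel_of X)"
proof (rule borel_measurableI)
  fix S :: "real set" assume "open S"
  then have "openin X {x \<in> topspace X. f x \<in> S}"
    by (intro openin_continuous_map_preimage[OF assms]) simp
  also have "{x \<in> topspace X. f x \<in> S} = f -` S \<inter> space (borel_of X)" by auto
  finally show "f -` S \<inter> space (borel_of X) \<in> sets (borel_of X)" by (rule sets_borel_of_open)
qed

lemma prob_measuresD:
  assumes "\<mu> \<in> prob_measures X"
  shows "prob_space \<mu>" "sets \<mu> = sets (borel_of X)" "space \<mu> = topspace X"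
  using assms sets_eq_imp_space_eq[of \<mu> "borel_of X"] by (auto simp: prob_measures_def)

lemma prob_measures_measurable:
  "\<mu> \<in> prob_measures X \<Longrightarrow> measurable \<mu> N = measurable (borel_of X) N"
  by (intro measurable_cong_sets) (auto dest: prob_measuresD)

lemma continuous_map_compact_bounded:
  fixes f :: "'a \<Rightarrow> real"
  assumes "compact_space X" "continuous_map X euclidean f"
  obtains B where "B > 0" "\<And>x. x \<in> topspace X \<Longrightarrow> \<bar>f x\<bar> \<le> B"
proof -
  have "compact (f ` topspace X)"
    using image_compactin[of X "topspace X" euclidean f] assms by (simp add: compact_space_def)
  then show thesis using that by (auto simp: bounded_pos dest!: compact_imp_bounded)
qed

lemma integrable_continuous_map:
  fixes f :: "'a \<Rightarrow> real"
  assumes "compact_space X" "continuous_map X euclidean f" "\<mu> \<in> prob_measures X"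
  shows "integrable \<mu> f"
proof -
  obtain B where B: "\<And>x. x \<in> topspace X \<Longrightarrow> \<bar>f x\<bar> \<le> B"
    using continuous_map_compact_bounded assms by metis
  interpret prob_space \<mu> using assms prob_measuresD by blast
  show ?thesis
    using assms B borel_measurable_continuous_map[OF assms(2)]
    by (intro integrable_const_bound[of _ B]) (auto simp: prob_measuresD prob_measures_measurable)
qed

lemma distr_prob_measures:
  assumes "prob_space \<mu>" "g \<in> \<mu> \<rightarrow>\<^sub>M borel_of X"
  shows "distr \<mu> (borel_of X) g \<in> prob_measures X"
  using prob_space.prob_space_distr[OF assms] by (simp add: prob_measures_def)

section \<open>Neighbourhoods and limits in the weak-* topology\<close>

lemma weak_star_nbhd:
  assumes "openin (weak_star_topology X) U" "\<mu> \<in> U"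
  obtains \<Phi> \<gamma> where "finite \<Phi>" "\<gamma> > 0" "\<And>f. f \<in> \<Phi> \<Longrightarrow> continuous_map X euclideanreal f"
    "\<And>\<nu>. \<nu> \<in> prob_measures X \<Longrightarrow> (\<forall>f\<in>\<Phi>. \<bar>(\<integral>x. f x \<partial>\<nu>) - (\<integral>x. f x \<partial>\<mu>)\<bar> < \<gamma>) \<Longrightarrow> \<nu> \<in> U"
proof -
  define P where "P U \<Phi> \<gamma> \<longleftrightarrow> finite \<Phi> \<and> \<gamma> > 0 \<and> (\<forall>f\<in>\<Phi>. continuous_map X euclideanreal f) \<and>
    (\<forall>\<nu>\<in>prob_measures X. (\<forall>f\<in>\<Phi>. \<bar>(\<integral>x. f x \<partial>\<nu>) - (\<integral>x. f x \<partial>\<mu>)\<bar> < \<gamma>) \<longrightarrow> \<nu> \<in> U)" for U \<Phi> and \<gamma> :: real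
  have "generate_topology_on {{\<mu> \<in> prob_measures X. (\<integral>x. f x \<partial>\<mu>) \<in> U} | f U.
        continuous_map X euclideanreal f \<and> open (U :: real set)} U"
    using assms(1) by (simp add: weak_star_topology_def openin_topology_generated_by_iff)
  then have "\<exists>\<Phi> \<gamma>. P U \<Phi> \<gamma>" using assms(2)
  proof (induction U rule: generate_topology_on.induct)
    case (Int a b)
    then obtain \<Phi> \<gamma> \<Phi>' \<gamma>' where "P a \<Phi> \<gamma>" "P b \<Phi>' \<gamma>'" by auto
    then have "P (a \<inter> b) (\<Phi> \<union> \<Phi>') (min \<gamma> \<gamma>')" by (auto simp: P_def)
    then show ?case by blast
  next
    case (UN K)
    then obtain k \<Phi> \<gamma> where "k \<in> K" "P k \<Phi> \<gamma>" by blast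
    then have "P (\<Union>K) \<Phi> \<gamma>" by (auto simp: P_def)
    then show ?case by blast
  next
    case (Basis s)
    then obtain f V where s: "s = {\<mu> \<in> prob_measures X. (\<integral>x. f x \<partial>\<mu>) \<in> V}"
      "continuous_map X euclideanreal f" "open V" by auto
    then obtain e where "e > 0" "\<And>y. \<bar>y - (\<integral>x. f x \<partial>\<mu>)\<bar> < e \<Longrightarrow> y \<in> V"
      using Basis by (auto simp: open_dist dist_real_def)
    then have "P s {f} e" using s by (auto simp: P_def)
    then show ?case by blast
  qed simp
  then show thesis using that by (auto simp: P_def)
qed

lemma weak_star_continuous_integral:
  assumes "continuous_map X euclideanreal f"
  shows "continuous_map (weak_star_topology X) euclideanreal (\<lambda>\<mu>. \<integral>x. f x \<partial>\<mu>)"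
  unfolding continuous_map_def topspace_weak_star_topology
proof (intro conjI allI impI)
  fix U :: "real set" assume "openin euclidean U"
  then show "openin (weak_star_topology X) {\<mu> \<in> prob_measures X. (\<integral>x. f x \<partial>\<mu>) \<in> U}"
    unfolding weak_star_topology_def using assms by (intro topology_generated_by_Basis) auto
qed auto

lemma weak_star_limitin:
  assumes "\<nu> \<in> prob_measures X" "\<And>k. \<mu> k \<in> prob_measures X"
    and "\<And>f. continuous_map X euclideanreal f \<Longrightarrow> (\<lambda>k. \<integral>x. f x \<partial>\<mu> k) \<longlonglongrightarrow> (\<integral>x. f x \<partial>\<nu>)"
  shows "limitin (weak_star_topology X) \<mu> \<nu> sequentially"
  unfolding limitin_def topspace_weak_star_topology
proof (intro conjI allI impI)
  fix U assume "openin (weak_star_topology X) U \<and> \<nu> \<in> U"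
  then obtain \<Phi> \<gamma> where \<Phi>: "finite \<Phi>" "\<gamma> > 0" "\<And>f. f \<in> \<Phi> \<Longrightarrow> continuous_map X euclideanreal f"
    "\<And>\<nu>'. \<nu>' \<in> prob_measures X \<Longrightarrow> (\<forall>f\<in>\<Phi>. \<bar>(\<integral>x. f x \<partial>\<nu>') - (\<integral>x. f x \<partial>\<nu>)\<bar> < \<gamma>) \<Longrightarrow> \<nu>' \<in> U"
    using weak_star_nbhd[of X U \<nu>] by metis
  have "\<forall>\<^sub>F k in sequentially. \<forall>f\<in>\<Phi>. \<bar>(\<integral>x. f x \<partial>\<mu> k) - (\<integral>x. f x \<partial>\<nu>)\<bar> < \<gamma>"
    using \<Phi> assms(3) by (intro eventually_ball_finite) (auto simp: tendsto_iff dist_real_def)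
  then show "\<forall>\<^sub>F k in sequentially. \<mu> k \<in> U"
    by (rule eventually_mono) (use \<Phi>(4) assms(2) in auto)
qed (use assms in auto)

section \<open>Sequential compactness of the space of measures\<close>

lemma ternary_expansions_agree:
  fixes P Q :: "nat \<Rightarrow> bool"
  defines "c \<equiv> \<lambda>P. \<Sum>n. of_bool (P n) * (1/3 :: real) ^ n"
  assumes "\<bar>c P - c Q\<bar> < (1/3) ^ N / 2" "n \<le> N"
  shows "P n = Q n"
proof (rule ccontr)
  assume "P n \<noteq> Q n"
  define m where "m = (LEAST n. P n \<noteq> Q n)"
  have m: "P m \<noteq> Q m" "\<And>i. i < m \<Longrightarrow> P i = Q i" "m \<le> n"
    using \<open>P n \<noteq> Q n\<close> LeastI[of "\<lambda>n. P n \<noteq> Q n" n] Least_le[of "\<lambda>n. P n \<noteq> Q n" n]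
    unfolding m_def by (blast dest: not_less_Least)+
  define z where "z i = (of_bool (P i) - of_bool (Q i)) * (1/3 :: real) ^ i" for i
  have sg: "summable (\<lambda>i. (1/3 :: real) ^ i)" by (rule summable_geometric) simp
  have sb: "summable (\<lambda>i. of_bool (R i) * (1/3 :: real) ^ i)" for R
    by (rule summable_comparison_test'[OF sg, of 0]) auto
  have sz: "summable z" unfolding z_def left_diff_distrib by (intro summable_diff sb)
  have "c P - c Q = suminf z"
    unfolding c_def z_def left_diff_distrib by (intro suminf_diff sb)
  also have "\<dots> = (\<Sum>i. z (i + Suc m)) + (\<Sum>i<Suc m. z i)"
    using suminf_split_initial_segment[OF sz, of "Suc m"] by simp
  also have "(\<Sum>i<Suc m. z i) = z m" using m(2) by (simp add: z_def)
  finally have eq: "c P - c Q = (\<Sum>i. z (i + Suc m)) + z m" .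
  \<comment> \<open>With digits 0 and 1 in base 3, the tail after the first disagreement is at most
    half of the term there and cannot cancel it, as it could in base 2.\<close>
  have "\<bar>\<Sum>i. z (i + Suc m)\<bar> \<le> (\<Sum>i. (1/3) ^ Suc m * (1/3) ^ i)"
  proof -
    have b: "norm (z (i + Suc m)) \<le> (1/3) ^ Suc m * (1/3) ^ i" for i
      by (auto simp: z_def power_add abs_mult of_bool_def)
    have "norm (\<Sum>i. z (i + Suc m)) \<le> (\<Sum>i. (1/3) ^ Suc m * (1/3) ^ i)"
      by (rule norm_suminf_le[OF b]) (intro summable_mult sg)
    then show ?thesis by simp
  qed
  also have "\<dots> = (1/3) ^ m / 2"
    using suminf_mult[OF sg, of "(1/3) ^ Suc m"] by (simp add: suminf_geometric)
  finally have "\<bar>\<Sum>i. z (i + Suc m)\<bar> \<le> (1/3) ^ m / 2" .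
  moreover have "\<bar>z m\<bar> = (1/3) ^ m" using m(1) by (auto simp: z_def)
  moreover have "(1/3 :: real) ^ N \<le> (1/3) ^ m"
    using m(3) assms(3) by (intro power_decreasing) auto
  ultimately show False using assms(2) eq by linarith
qed

text \<open>Every point of the space is coded by a real number, through the indicators of countably many
  small balls, in such a way that decoding is continuous.\<close>

lemma borel_code:
  assumes "compact_space X" "metrizable_space X" "topspace X \<noteq> {}"
  obtains s :: "'a \<Rightarrow> real" and g :: "real \<Rightarrow> 'a" and C where "s \<in> borel_measurable (borel_of X)"
    "s ` topspace X \<subseteq> C" "closed C" "C \<subseteq> {0..2}"
    "continuous_map (top_of_set C) X g" "\<And>x. x \<in> topspace X \<Longrightarrow> g (s x) = x"
proof -
  obtain M d where Md: "Metric_space M d" and X: "X = Metric_space.mtopology M d"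
    using assms(2) unfolding metrizable_space_def by blast
  interpret Metric_space M d by (rule Md)
  have M: "topspace X = M" by (simp add: X)
  have tb: "mtotally_bounded M"
    using assms(1) compactin_imp_mtotally_bounded unfolding X compact_space_def by simp
  have "\<exists>K. finite K \<and> K \<subseteq> M \<and> M \<subseteq> (\<Union>x\<in>K. mball x (1 / Suc k))" for k
    using tb unfolding mtotally_bounded_def by simp
  then obtain K where K: "\<And>k. finite (K k)" "\<And>k. K k \<subseteq> M" "\<And>k. M \<subseteq> (\<Union>x\<in>K k. mball x (1 / Suc k))"
    by metis
  define \<B> where "\<B> = (\<Union>k. (\<lambda>x. mball x (1 / Suc k)) ` K k)"
  have \<B>: "countable \<B>" "\<B> \<noteq> {}"
    using K assms(3) M by (auto simp: \<B>_def countable_finite)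
  define B where "B = from_nat_into \<B>"
  have rB: "range B = \<B>" using \<B> by (simp add: B_def range_from_nat_into)
  \<comment> \<open>The balls of one radius come from a finite net and occur among finitely many
    \<open>B n\<close>, so finitely many membership bits locate a point up to \<epsilon>.\<close>
  have small: "\<exists>N. \<forall>x\<in>M. \<forall>y\<in>M. (\<forall>n\<le>N. x \<in> B n \<longleftrightarrow> y \<in> B n) \<longrightarrow> d x y < \<epsilon>" if "\<epsilon> > 0" for \<epsilon>
  proof -
    obtain k where k: "1 / Suc k < \<epsilon> / 2"
      using reals_Archimedean[of "\<epsilon> / 2"] \<open>\<epsilon> > 0\<close> by (auto simp: inverse_eq_divide)
    have "(\<lambda>x. mball x (1 / Suc k)) ` K k \<subseteq> B ` UNIV" unfolding rB by (auto simp: \<B>_def)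
    then obtain F where F: "finite F" "(\<lambda>x. mball x (1 / Suc k)) ` K k = B ` F"
      by (metis K(1) finite_imageI finite_subset_image)
    obtain N where N: "\<And>n. n \<in> F \<Longrightarrow> n \<le> N" using F(1) by (auto simp: finite_nat_set_iff_bounded_le)
    have "d x y < \<epsilon>" if "x \<in> M" "y \<in> M" "\<forall>n\<le>N. x \<in> B n \<longleftrightarrow> y \<in> B n" for x y
    proof -
      obtain p where p: "p \<in> K k" "x \<in> mball p (1 / Suc k)" using K(3)[of k] \<open>x \<in> M\<close> by blast
      then obtain n where n: "n \<in> F" "mball p (1 / Suc k) = B n" using F(2) by blast
      then have "y \<in> mball p (1 / Suc k)" using p that N by auto
      then have "d x y < 1 / Suc k + 1 / Suc k"
        using p(2) triangle''[of x p y] commute[of p] by (auto simp: mball_def)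
      then show ?thesis using k by simp
    qed
    then show ?thesis by blast
  qed
  define s where "s x = (\<Sum>n. of_bool (x \<in> B n) * (1/3 :: real) ^ n)" for x
  have Bopen: "openin X (B n)" for n
  proof -
    have "B n \<in> \<B>" using rB by blast
    then show ?thesis by (auto simp: \<B>_def X)
  qed
  have s_meas: "s \<in> borel_measurable (borel_of X)"
  proof -
    have eq: "s = (\<lambda>x. \<Sum>n. indicator (B n) x * (1/3 :: real) ^ n)"
      by (auto simp: s_def indicator_def)
    show ?thesis unfolding eq
      by (intro borel_measurable_suminf borel_measurable_times borel_measurable_const
           borel_measurable_indicator sets_borel_of_open Bopen)
  qed
  have s_bd: "s x \<in> {0..2}" for x
  proof -
    have sg: "summable (\<lambda>i. (1/3 :: real) ^ i)" by (rule summable_geometric) simp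
    have sb: "summable (\<lambda>i. of_bool (x \<in> B i) * (1/3 :: real) ^ i)"
      by (rule summable_comparison_test'[OF sg, of 0]) auto
    have "s x \<le> (\<Sum>i. (1/3 :: real) ^ i)" unfolding s_def by (intro suminf_le sb sg) auto
    also have "\<dots> \<le> 2" by (simp add: suminf_geometric)
    finally show ?thesis using suminf_nonneg[OF sb] by (auto simp: s_def)
  qed
  \<comment> \<open>The code \<open>s\<close> may well be discontinuous, like the indicators, but
    its inverse is uniformly continuous: close codes share their first bits.\<close>
  have uc: "\<exists>\<delta>>0. \<forall>x\<in>M. \<forall>y\<in>M. \<bar>s x - s y\<bar> < \<delta> \<longrightarrow> d x y < \<epsilon>" if "\<epsilon> > 0" for \<epsilon>
  proof -
    obtain N where N: "\<forall>x\<in>M. \<forall>y\<in>M. (\<forall>n\<le>N. x \<in> B n \<longleftrightarrow> y \<in> B n) \<longrightarrow> d x y < \<epsilon>"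
      using small[OF \<open>\<epsilon> > 0\<close>] by blast
    have "x \<in> B n \<longleftrightarrow> y \<in> B n" if "\<bar>s x - s y\<bar> < (1/3) ^ N / 2" "n \<le> N" for x y n
      using ternary_expansions_agree[of "\<lambda>n. x \<in> B n" "\<lambda>n. y \<in> B n" N n] that by (simp add: s_def)
    then show ?thesis using N by (intro exI[of _ "(1/3) ^ N / 2"]) auto
  qed
  have inj: "inj_on s M"
  proof (rule inj_onI, rule ccontr)
    fix x y assume xy: "x \<in> M" "y \<in> M" "s x = s y" "x \<noteq> y"
    then have "d x y > 0" by (simp add: mdist_pos_less)
    from uc[OF this] obtain \<delta> where "\<delta> > 0" "\<forall>x'\<in>M. \<forall>y'\<in>M. \<bar>s x' - s y'\<bar> < \<delta> \<longrightarrow> d x' y' < d x y" by blast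
    then have "d x y < d x y" using xy(1-3) by (metis abs_zero diff_self)
    then show False by simp
  qed
  define e where "e = inv_into M s"
  have e: "e (s x) = x" if "x \<in> M" for x using inj that by (simp add: e_def)
  have mm: "mspace (metric (M, d)) = M" "mdist (metric (M, d)) = d"
    by (simp_all add: mspace_metric mdist_metric)
  have unif: "uniformly_continuous_map (submetric euclidean_metric (s ` M)) (metric (M, d)) e"
    unfolding uniformly_continuous_map_def
  proof (intro conjI allI impI)
    fix \<epsilon> :: real assume "\<epsilon> > 0"
    from uc[OF this] obtain \<delta> where "\<delta> > 0" "\<forall>x\<in>M. \<forall>y\<in>M. \<bar>s x - s y\<bar> < \<delta> \<longrightarrow> d x y < \<epsilon>" by blast
    then show "\<exists>\<delta>>0. \<forall>x\<in>mspace (submetric euclidean_metric (s ` M)).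
        \<forall>y\<in>mspace (submetric euclidean_metric (s ` M)).
          mdist (submetric euclidean_metric (s ` M)) y x < \<delta> \<longrightarrow> mdist (metric (M, d)) (e y) (e x) < \<epsilon>"
      by (intro exI[of _ \<delta>]) (auto simp: mm e dist_real_def)
  qed (auto simp: mm e)
  \<comment> \<open>Completeness extends the decoding to the closure of the set of codes, which is
    where a limit of measures on the codes may sit.\<close>
  have "mcomplete_of (metric (M, d))"
    using assms(1) compact_space_imp_mcomplete by (simp add: mcomplete_of_def mm X)
  then obtain g where g: "uniformly_continuous_map (submetric euclidean_metric
      (mtopology_of euclidean_metric closure_of (s ` M))) (metric (M, d)) g"
    and ge: "\<And>x. x \<in> s ` M \<Longrightarrow> g x = e x"
    using uniformly_continuous_map_extends_to_closure_of[OF _ unif] by blast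
  define C where "C = closure (s ` M)"
  have "mtopology_of (submetric euclidean_metric S) = top_of_set S" for S :: "real set"
    by (simp add: mtopology_of_submetric)
  moreover have "mtopology_of (metric (M, d)) = X" by (simp add: mtopology_of_def mm X)
  ultimately have "continuous_map (top_of_set C) X g"
    using uniformly_continuous_imp_continuous_map[OF g] by (simp add: C_def)
  moreover have "C \<subseteq> {0..2}" unfolding C_def by (intro closure_minimal) (use s_bd in auto)
  ultimately show thesis
    using s_meas e ge closure_subset[of "s ` M"]
    by (intro that[of s C g]) (auto simp: C_def M)
qed

text \<open>The codes carry the measures to distributions on a bounded interval, where tightness is
  automatic and Helly selection gives a weakly convergent subsequence. Its limit is carried by
  \<open>C\<close> and is brought back by decoding.\<close>

lemma prob_measures_sequentially_compact:
  assumes "compact_space X" "metrizable_space X" and \<mu>: "\<And>k. \<mu> k \<in> prob_measures X"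
  obtains r :: "nat \<Rightarrow> nat" and \<nu> where "strict_mono r" "\<nu> \<in> prob_measures X"
    "\<And>f. continuous_map X euclideanreal f \<Longrightarrow> (\<lambda>k. \<integral>x. f x \<partial>\<mu> (r k)) \<longlonglongrightarrow> (\<integral>x. f x \<partial>\<nu>)"
proof -
  have ne: "topspace X \<noteq> {}"
    using prob_measuresD[OF \<mu>[of 0]] prob_space.not_empty by metis
  obtain s :: "'a \<Rightarrow> real" and g C where s: "s \<in> borel_measurable (borel_of X)" "s ` topspace X \<subseteq> C"
    and C: "closed C" "C \<subseteq> {0..2}"
    and g: "continuous_map (top_of_set C) X g" and gs: "\<And>x. x \<in> topspace X \<Longrightarrow> g (s x) = x"
    using borel_code[OF assms(1,2) ne] by metis
  have sm: "s \<in> borel_measurable (\<mu> k)" for k using s(1) by (simp add: prob_measures_measurable[OF \<mu>])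
  define M where "M k = distr (\<mu> k) borel s" for k
  have Mrd: "real_distribution (M k)" for k
    unfolding M_def real_distribution_def real_distribution_axioms_def
    using prob_space.prob_space_distr[OF prob_measuresD(1)[OF \<mu>] sm] by simp
  have "tight M"
    unfolding tight_def
  proof (intro conjI allI impI Mrd)
    fix \<epsilon> :: real assume "\<epsilon> > 0"
    have "measure (M k) {-1<..2} = 1" for k
    proof -
      interpret prob_space "\<mu> k" using prob_measuresD[OF \<mu>] by blast
      have "s -` {-1<..2} \<inter> space (\<mu> k) = space (\<mu> k)"
        using s(2) C(2) prob_measuresD(3)[OF \<mu>] by fastforce
      then show ?thesis unfolding M_def using sm prob_space by (subst measure_distr) auto
    qed
    then show "\<exists>a b. a < b \<and> (\<forall>n. measure (M n) {a<..b} > 1 - \<epsilon>)"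
      using \<open>\<epsilon> > 0\<close> by (intro exI[of _ "-1"] exI[of _ 2]) auto
  qed
  from tight_imp_convergent_subsubsequence[OF this strict_mono_id] obtain r N
    where r: "strict_mono r" and N: "real_distribution N" and wc: "weak_conv_m (M \<circ> id \<circ> r) N" by blast
  interpret N: real_distribution N by (rule N)
  have conv: "(\<lambda>k. \<integral>x. F (s x) \<partial>\<mu> (r k)) \<longlonglongrightarrow> (\<integral>x. F x \<partial>N)"
    if F: "continuous_on UNIV F" and B: "\<And>x. \<bar>F x\<bar> \<le> B" for F :: "real \<Rightarrow> real" and B
  proof -
    have Fm: "F \<in> borel_measurable borel" using F by (rule borel_measurable_continuous_onI)
    have "(\<lambda>k. integral\<^sup>L ((M \<circ> id \<circ> r) k) F) \<longlonglongrightarrow> integral\<^sup>L N F"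
      using F B N Mrd wc by (intro weak_conv_imp_integral_bdd_continuous_conv[where B = B])
        (auto simp: continuous_on_eq_continuous_at o_def)
    moreover have "integral\<^sup>L ((M \<circ> id \<circ> r) k) F = (\<integral>x. F (s x) \<partial>\<mu> (r k))" for k
      using integral_distr[OF sm Fm] by (simp add: M_def)
    ultimately show ?thesis by simp
  qed
  have Cne: "C \<noteq> {}" using ne s(2) by blast
  \<comment> \<open>A bounded continuous function that vanishes exactly on the closed set
    \<open>C\<close> has integral 0 under every coded measure, hence under the limit.\<close>
  have AEC: "AE x in N. x \<in> C"
  proof -
    define F where "F x = min 1 (infdist x C)" for x
    have F: "continuous_on UNIV F" "\<And>x. \<bar>F x\<bar> \<le> 1"
      unfolding F_def by (auto intro!: continuous_intros simp: infdist_nonneg)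
    have "(\<integral>x. F (s x) \<partial>\<mu> (r k)) = 0" for k
    proof -
      have "(\<integral>x. F (s x) \<partial>\<mu> (r k)) = (\<integral>x. 0 \<partial>\<mu> (r k))"
        using s(2) prob_measuresD(3)[OF \<mu>] by (intro Bochner_Integration.integral_cong) (auto simp: F_def)
      then show ?thesis by simp
    qed
    then have "(\<integral>x. F x \<partial>N) = 0" using conv[OF F] by (simp add: LIMSEQ_const_iff)
    moreover have "integrable N F"
      using F borel_measurable_continuous_onI[OF F(1)] by (intro N.integrable_const_bound[of _ 1]) auto
    ultimately have "AE x in N. F x = 0"
      by (subst (asm) integral_nonneg_eq_0_iff_AE) (auto simp: F_def infdist_nonneg)
    then show ?thesis
      by (rule AE_mp) (use C(1) Cne in \<open>auto simp: F_def in_closed_iff_infdist_zero min_def split: if_splits\<close>)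
  qed
  obtain x0 where x0: "x0 \<in> topspace X" using ne by blast
  \<comment> \<open>The value \<open>x0\<close> off \<open>C\<close> makes \<open>h\<close> total;
    \<open>N\<close> does not charge the complement of \<open>C\<close>.\<close>
  define h where "h x = (if x \<in> C then g x else x0)" for x
  have gX: "g x \<in> topspace X" if "x \<in> C" for x
    using continuous_map_image_subset_topspace[OF g] that by auto
  have h: "h \<in> N \<rightarrow>\<^sub>M borel_of X"
  proof -
    have "h \<in> borel \<rightarrow>\<^sub>M sigma (topspace X) {U. openin X U}"
    proof (rule measurable_measure_of)
      show "h \<in> space borel \<rightarrow> topspace X" using gX x0 by (auto simp: h_def)
      fix U assume "U \<in> {U. openin X U}"
      then have "openin (top_of_set C) {x \<in> topspace (top_of_set C). g x \<in> U}"
        using openin_continuous_map_preimage[OF g] by simp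
      then have "{x \<in> C. g x \<in> U} \<in> sets borel" using C(1)
        by (auto simp: openin_open Int_commute dest!: borel_open)
      moreover have "h -` U \<inter> space borel = {x \<in> C. g x \<in> U} \<union> (if x0 \<in> U then - C else {})"
        by (auto simp: h_def split: if_splits)
      ultimately show "h -` U \<inter> space borel \<in> sets borel" using C(1) by auto
    qed (auto dest: openin_subset)
    then have "h \<in> borel \<rightarrow>\<^sub>M borel_of X" by (simp add: borel_of_def)
    then show ?thesis by (simp cong: measurable_cong_sets)
  qed
  show thesis
  proof (rule that[OF r, of "distr N (borel_of X) h"])
    show "distr N (borel_of X) h \<in> prob_measures X" by (intro distr_prob_measures h) unfold_locales
    fix f assume f: "continuous_map X euclideanreal f"
    obtain B where B: "B > 0" "\<And>x. x \<in> topspace X \<Longrightarrow> \<bar>f x\<bar> \<le> B"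
      using continuous_map_compact_bounded assms(1) f by metis
    \<comment> \<open>Weak convergence tests functions that are continuous on the whole line, hence
      the Tietze extension of \<open>f \<circ> g\<close> with the same bound.\<close>
    have "continuous_map (top_of_set C) euclideanreal (f \<circ> g)"
      by (rule continuous_map_compose[OF g f])
    then have "continuous_on C (\<lambda>x. f (g x))" by (simp add: o_def)
    then obtain F where F: "continuous_on UNIV F" "\<And>x. x \<in> C \<Longrightarrow> F x = f (g x)" "\<And>x. norm (F x) \<le> B"
      using Tietze[of C "\<lambda>x. f (g x)" UNIV B] C(1) B gX by auto
    have "(\<integral>x. F (s x) \<partial>\<mu> (r k)) = (\<integral>x. f x \<partial>\<mu> (r k))" for k
      using prob_measuresD(3)[OF \<mu>] s(2) F(2) gs
      by (intro Bochner_Integration.integral_cong) auto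
    moreover have "(\<integral>x. F x \<partial>N) = (\<integral>x. f x \<partial>distr N (borel_of X) h)"
    proof -
      have fm: "f \<in> borel_measurable (borel_of X)" by (rule borel_measurable_continuous_map[OF f])
      have "(\<integral>x. F x \<partial>N) = (\<integral>x. f (h x) \<partial>N)"
        using AEC F(2) borel_measurable_continuous_onI[OF F(1)] measurable_compose[OF h fm]
        by (intro integral_cong_AE) (auto simp: h_def)
      then show ?thesis using integral_distr[OF h fm] by simp
    qed
    ultimately show "(\<lambda>k. \<integral>x. f x \<partial>\<mu> (r k)) \<longlonglongrightarrow> (\<integral>x. f x \<partial>distr N (borel_of X) h)"
      using conv[OF F(1), of B] F(3) by simp
  qed
qed


section \<open>The induced system on measures\<close>

locale induced_system = Metric_space "prob_measures X" D
  for X :: "'a topology" and D :: "'a measure \<Rightarrow> 'a measure \<Rightarrow> real" +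
  fixes T :: "'a \<Rightarrow> 'a"
  assumes compact: "compact_space X" and metrizable: "metrizable_space X"
    and contT: "continuous_map X X T"
    and weak_star: "mtopology = weak_star_topology X"
begin

lemma compact_prob_measures: "compact_space mtopology"
  unfolding compact_space_sequentially
proof (intro allI impI)
  fix \<sigma> :: "nat \<Rightarrow> 'a measure" assume "range \<sigma> \<subseteq> prob_measures X"
  then have \<sigma>: "\<And>k. \<sigma> k \<in> prob_measures X" by auto
  obtain r \<nu> where "strict_mono r" "\<nu> \<in> prob_measures X"
    "\<And>f. continuous_map X euclideanreal f \<Longrightarrow> (\<lambda>k. \<integral>x. f x \<partial>\<sigma> (r k)) \<longlonglongrightarrow> (\<integral>x. f x \<partial>\<nu>)"
    by (rule prob_measures_sequentially_compact[OF compact metrizable \<sigma>]) (rule that; assumption)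
  then show "\<exists>l r. l \<in> prob_measures X \<and> strict_mono r \<and> limitin mtopology (\<sigma> \<circ> r) l sequentially"
    unfolding weak_star using \<sigma> by (intro exI[of _ \<nu>] exI[of _ r]) (auto intro!: weak_star_limitin)
qed

section \<open>Comparison of the metric with integrals\<close>

lemma integral_uniformly_continuous:
  assumes "continuous_map X euclideanreal f" "\<gamma> > 0"
  obtains \<delta> where "\<delta> > 0" "\<And>\<mu> \<nu>. \<mu> \<in> prob_measures X \<Longrightarrow> \<nu> \<in> prob_measures X \<Longrightarrow> D \<mu> \<nu> < \<delta> \<Longrightarrow>
    \<bar>(\<integral>x. f x \<partial>\<mu>) - (\<integral>x. f x \<partial>\<nu>)\<bar> < \<gamma>"
proof -
  let ?m = "metric (prob_measures X, D)"
  have m: "mspace ?m = prob_measures X" "mdist ?m = D" by (simp_all add: mspace_metric mdist_metric)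
  have "uniformly_continuous_map ?m euclidean_metric (\<lambda>\<mu>. \<integral>x. f x \<partial>\<mu>)"
    using weak_star_continuous_integral[OF assms(1)] compact_prob_measures weak_star
    by (intro continuous_imp_uniformly_continuous_map) (auto simp: mtopology_of_def m)
  then obtain \<delta> where "\<delta> > 0" "\<forall>\<mu>\<in>prob_measures X. \<forall>\<nu>\<in>prob_measures X. D \<nu> \<mu> < \<delta> \<longrightarrow>
      dist (\<integral>x. f x \<partial>\<nu>) (\<integral>x. f x \<partial>\<mu>) < \<gamma>"
    using assms(2) unfolding uniformly_continuous_map_def m mdist_euclidean_metric by blast
  then show thesis using that[of \<delta>] unfolding dist_real_def by blast
qed

text \<open>A Lebesgue number argument: halved tolerances leave room to pass from
  \<open>\<mu>\<close> to \<open>\<nu>\<close> inside the full neighbourhood of a centre, and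
  compactness leaves finitely many centres, hence finitely many functions and one tolerance.\<close>

lemma dist_small_if_integrals_close:
  assumes "\<eta> > 0"
  obtains \<Phi> \<gamma> where "finite \<Phi>" "\<gamma> > 0" "\<And>f. f \<in> \<Phi> \<Longrightarrow> continuous_map X euclideanreal f"
    "\<And>\<mu> \<nu>. \<mu> \<in> prob_measures X \<Longrightarrow> \<nu> \<in> prob_measures X \<Longrightarrow>
       (\<forall>f\<in>\<Phi>. \<bar>(\<integral>x. f x \<partial>\<mu>) - (\<integral>x. f x \<partial>\<nu>)\<bar> < \<gamma>) \<Longrightarrow> D \<mu> \<nu> < \<eta>"
proof -
  have "\<forall>\<mu>\<in>prob_measures X. \<exists>\<Phi> \<gamma>. finite \<Phi> \<and> \<gamma> > 0 \<and> (\<forall>f\<in>\<Phi>. continuous_map X euclideanreal f) \<and>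
      (\<forall>\<nu>\<in>prob_measures X. (\<forall>f\<in>\<Phi>. \<bar>(\<integral>x. f x \<partial>\<nu>) - (\<integral>x. f x \<partial>\<mu>)\<bar> < \<gamma>) \<longrightarrow> \<nu> \<in> mball \<mu> (\<eta> / 2))"
  proof
    fix \<mu> assume "\<mu> \<in> prob_measures X"
    then have "openin (weak_star_topology X) (mball \<mu> (\<eta> / 2))" "\<mu> \<in> mball \<mu> (\<eta> / 2)"
      using openin_mball[of \<mu> "\<eta> / 2"] assms weak_star by auto
    then show "\<exists>\<Phi> \<gamma>. finite \<Phi> \<and> \<gamma> > 0 \<and> (\<forall>f\<in>\<Phi>. continuous_map X euclideanreal f) \<and>
      (\<forall>\<nu>\<in>prob_measures X. (\<forall>f\<in>\<Phi>. \<bar>(\<integral>x. f x \<partial>\<nu>) - (\<integral>x. f x \<partial>\<mu>)\<bar> < \<gamma>) \<longrightarrow> \<nu> \<in> mball \<mu> (\<eta> / 2))"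
      using weak_star_nbhd[of X "mball \<mu> (\<eta> / 2)" \<mu>] by metis
  qed
  then obtain \<Phi> \<gamma> where \<Phi>: "\<And>\<mu>. \<mu> \<in> prob_measures X \<Longrightarrow> finite (\<Phi> \<mu>)"
    "\<And>\<mu>. \<mu> \<in> prob_measures X \<Longrightarrow> \<gamma> \<mu> > 0"
    "\<And>\<mu> f. \<mu> \<in> prob_measures X \<Longrightarrow> f \<in> \<Phi> \<mu> \<Longrightarrow> continuous_map X euclideanreal f"
    "\<And>\<mu> \<nu>. \<mu> \<in> prob_measures X \<Longrightarrow> \<nu> \<in> prob_measures X \<Longrightarrow>
       (\<forall>f\<in>\<Phi> \<mu>. \<bar>(\<integral>x. f x \<partial>\<nu>) - (\<integral>x. f x \<partial>\<mu>)\<bar> < \<gamma> \<mu>) \<Longrightarrow> \<nu> \<in> mball \<mu> (\<eta> / 2)"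
    by metis
  define V where "V \<mu> = {\<nu> \<in> prob_measures X. \<forall>f\<in>\<Phi> \<mu>. \<bar>(\<integral>x. f x \<partial>\<nu>) - (\<integral>x. f x \<partial>\<mu>)\<bar> < \<gamma> \<mu> / 2}" for \<mu>
  have Vopen: "openin mtopology (V \<mu>)" if "\<mu> \<in> prob_measures X" for \<mu>
  proof -
    have "openin mtopology {\<nu> \<in> prob_measures X. \<bar>(\<integral>x. f x \<partial>\<nu>) - (\<integral>x. f x \<partial>\<mu>)\<bar> < \<gamma> \<mu> / 2}"
      if "f \<in> \<Phi> \<mu>" for f
    proof -
      have "openin mtopology {\<nu> \<in> topspace mtopology. (\<integral>x. f x \<partial>\<nu>) \<in> ball (\<integral>x. f x \<partial>\<mu>) (\<gamma> \<mu> / 2)}"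
        unfolding weak_star using \<Phi>(3)[OF \<open>\<mu> \<in> _\<close> that]
        by (intro openin_continuous_map_preimage[OF weak_star_continuous_integral]) auto
      then show ?thesis by (simp add: dist_real_def abs_minus_commute)
    qed
    then have "openin mtopology (topspace mtopology \<inter> (\<Inter>f\<in>\<Phi> \<mu>.
        {\<nu> \<in> prob_measures X. \<bar>(\<integral>x. f x \<partial>\<nu>) - (\<integral>x. f x \<partial>\<mu>)\<bar> < \<gamma> \<mu> / 2}))"
      using \<Phi>(1)[OF that] by (intro openin_Int_Inter) auto
    moreover have "V \<mu> = topspace mtopology \<inter> (\<Inter>f\<in>\<Phi> \<mu>.
        {\<nu> \<in> prob_measures X. \<bar>(\<integral>x. f x \<partial>\<nu>) - (\<integral>x. f x \<partial>\<mu>)\<bar> < \<gamma> \<mu> / 2})"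
      by (auto simp: V_def)
    ultimately show ?thesis by simp
  qed
  have "\<And>U. U \<in> V ` prob_measures X \<Longrightarrow> openin mtopology U" using Vopen by blast
  moreover have "prob_measures X \<subseteq> \<Union>(V ` prob_measures X)" using \<Phi>(2) by (auto simp: V_def)
  ultimately obtain \<V> where "finite \<V>" "\<V> \<subseteq> V ` prob_measures X" "prob_measures X \<subseteq> \<Union>\<V>"
    using compact_prob_measures unfolding compact_space_def compactin_def
    by (metis topspace_mtopology)
  then obtain F where F: "finite F" "F \<subseteq> prob_measures X" "prob_measures X \<subseteq> (\<Union>\<mu>\<in>F. V \<mu>)"
    by (metis finite_subset_image)
  define g where "g = Min (insert 1 ((\<lambda>\<mu>. \<gamma> \<mu> / 2) ` F))"
  have g: "g > 0" "\<And>\<mu>. \<mu> \<in> F \<Longrightarrow> g \<le> \<gamma> \<mu> / 2" using F \<Phi>(2)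
    by (auto simp: g_def simp del: le_divide_eq_numeral1 intro!: Min_le)
  show thesis
  proof (rule that[of "\<Union>(\<Phi> ` F)" g])
    show "finite (\<Union>(\<Phi> ` F))" using F \<Phi>(1) by auto
    show "continuous_map X euclideanreal f" if "f \<in> \<Union>(\<Phi> ` F)" for f using that F \<Phi>(3) by auto
    fix \<mu> \<nu> assume P: "\<mu> \<in> prob_measures X" "\<nu> \<in> prob_measures X"
      and close: "\<forall>f\<in>\<Union>(\<Phi> ` F). \<bar>(\<integral>x. f x \<partial>\<mu>) - (\<integral>x. f x \<partial>\<nu>)\<bar> < g"
    obtain \<rho> where \<rho>: "\<rho> \<in> F" "\<mu> \<in> V \<rho>" using F P by blast
    have \<rho>P: "\<rho> \<in> prob_measures X" using \<rho> F by blast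
    have "\<bar>(\<integral>x. f x \<partial>\<mu>) - (\<integral>x. f x \<partial>\<rho>)\<bar> < \<gamma> \<rho> \<and> \<bar>(\<integral>x. f x \<partial>\<nu>) - (\<integral>x. f x \<partial>\<rho>)\<bar> < \<gamma> \<rho>"
      if "f \<in> \<Phi> \<rho>" for f
    proof -
      have "\<bar>(\<integral>x. f x \<partial>\<mu>) - (\<integral>x. f x \<partial>\<rho>)\<bar> < \<gamma> \<rho> / 2" using \<rho>(2) that by (auto simp: V_def)
      moreover have "\<bar>(\<integral>x. f x \<partial>\<mu>) - (\<integral>x. f x \<partial>\<nu>)\<bar> < \<gamma> \<rho> / 2" using close \<rho>(1) that g(2)[OF \<rho>(1)] by fastforce
      ultimately show ?thesis using \<Phi>(2)[OF \<rho>P] by linarith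
    qed
    then have "\<mu> \<in> mball \<rho> (\<eta> / 2)" "\<nu> \<in> mball \<rho> (\<eta> / 2)" using \<Phi>(4) \<rho>P P by blast+
    then show "D \<mu> \<nu> < \<eta>" using triangle[of \<mu> \<rho> \<nu>] commute[of \<mu> \<rho>] by auto
  qed (use g in auto)
qed

section \<open>Iterates of the induced map\<close>

lemma funpow_continuous: "continuous_map X X (T ^^ i)"
proof (induction i)
  case (Suc i)
  then have "continuous_map X X (T \<circ> T ^^ i)" by (rule continuous_map_compose[OF _ contT])
  then show ?case by (simp only: funpow.simps)
qed (simp add: id_def)

lemma funpow_in: "x \<in> topspace X \<Longrightarrow> (T ^^ i) x \<in> topspace X"
  using continuous_map_image_subset_topspace[OF funpow_continuous] by blast

lemma compose_funpow_continuous: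
  "continuous_map X euclideanreal f \<Longrightarrow> continuous_map X euclideanreal (\<lambda>x. f ((T ^^ i) x))"
  using continuous_map_compose[OF funpow_continuous] by (simp add: o_def)

lemma push_forward_prob_measures: "\<mu> \<in> prob_measures X \<Longrightarrow> push_forward X T \<mu> \<in> prob_measures X"
  unfolding push_forward_def using measurable_borel_of_continuous[OF contT]
  by (intro distr_prob_measures) (auto simp: prob_measures_measurable dest: prob_measuresD)

lemma funpow_push_forward_prob_measures:
  "\<mu> \<in> prob_measures X \<Longrightarrow> (push_forward X T ^^ i) \<mu> \<in> prob_measures X"
  by (induction i) (auto intro: push_forward_prob_measures)

lemma integral_funpow_push_forward:
  assumes "\<mu> \<in> prob_measures X" "continuous_map X euclideanreal f"
  shows "(\<integral>x. f x \<partial>(push_forward X T ^^ i) \<mu>) = (\<integral>x. f ((T ^^ i) x) \<partial>\<mu>)"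
  using assms(2)
proof (induction i arbitrary: f)
  case (Suc i)
  have "(\<integral>x. f x \<partial>(push_forward X T ^^ Suc i) \<mu>) = (\<integral>x. f (T x) \<partial>(push_forward X T ^^ i) \<mu>)"
    using measurable_borel_of_continuous[OF contT] borel_measurable_continuous_map[OF Suc.prems]
      funpow_push_forward_prob_measures[OF assms(1), of i]
    by (simp add: push_forward_def integral_distr prob_measures_measurable)
  also have "\<dots> = (\<integral>x. f (T ((T ^^ i) x)) \<partial>\<mu>)"
    using compose_funpow_continuous[OF Suc.prems, of 1] by (intro Suc.IH) simp
  finally show ?case by simp
qed simp

end


section \<open>Cover numbers and separated sets\<close>

lemma cover_number_le:
  assumes "\<V> \<subseteq> \<C>" "finite \<V>" "\<Union>\<V> = topspace X"
  shows "cover_number X \<C> \<le> card \<V>"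
  unfolding cover_number_def by (rule Least_le) (use assms in blast)

lemma cover_number_attained:
  assumes "\<V> \<subseteq> \<C>" "finite \<V>" "\<Union>\<V> = topspace X"
  obtains \<W> where "\<W> \<subseteq> \<C>" "finite \<W>" "\<Union>\<W> = topspace X" "card \<W> = cover_number X \<C>"
proof -
  have "\<exists>\<W>\<subseteq>\<C>. finite \<W> \<and> \<Union>\<W> = topspace X \<and> card \<W> = cover_number X \<C>"
    unfolding cover_number_def by (rule LeastI[of _ "card \<V>"]) (use assms in blast)
  then show thesis using that by blast
qed

text \<open>The \<open>LEAST\<close> in \<open>cover_number\<close> is meaningful only if some
  finite subcover exists; this is the one handed to \<open>cover_number_attained\<close>.\<close>

lemma iterated_join_finite_subcover:
  assumes "compact_space X" "open_cover X \<U>" "\<And>x i. x \<in> topspace X \<Longrightarrow> (T ^^ i) x \<in> topspace X"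
  obtains \<V> where "\<V> \<subseteq> iterated_join X T \<U> n" "finite \<V>" "\<Union>\<V> = topspace X"
proof -
  obtain \<U>' where U': "finite \<U>'" "\<U>' \<subseteq> \<U>" "topspace X \<subseteq> \<Union>\<U>'"
    using assms(1,2) unfolding compact_space_alt open_cover_def
    by (metis order_refl)
  define cell where "cell A = {x \<in> topspace X. \<forall>i<n. (T ^^ i) x \<in> A i}" for A
  show thesis
  proof (rule that[of "cell ` ({..<n} \<rightarrow>\<^sub>E \<U>')"])
    show "cell ` ({..<n} \<rightarrow>\<^sub>E \<U>') \<subseteq> iterated_join X T \<U> n"
    proof
      fix V assume "V \<in> cell ` ({..<n} \<rightarrow>\<^sub>E \<U>')"
      then obtain A where "A \<in> {..<n} \<rightarrow>\<^sub>E \<U>'" "V = cell A" by blast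
      then show "V \<in> iterated_join X T \<U> n"
        using U' unfolding iterated_join_def cell_def PiE_def Pi_def by blast
    qed
    show "\<Union>(cell ` ({..<n} \<rightarrow>\<^sub>E \<U>')) = topspace X"
    proof (intro equalityI subsetI)
      fix x assume x: "x \<in> topspace X"
      then have "\<exists>U\<in>\<U>'. (T ^^ i) x \<in> U" for i using assms(3) U'(3) by blast
      then obtain A where A: "\<And>i. A i \<in> \<U>'" "\<And>i. (T ^^ i) x \<in> A i" by metis
      then have "x \<in> cell (restrict A {..<n})" using x by (auto simp: cell_def)
      moreover have "restrict A {..<n} \<in> {..<n} \<rightarrow>\<^sub>E \<U>'" using A by auto
      ultimately show "x \<in> \<Union>(cell ` ({..<n} \<rightarrow>\<^sub>E \<U>'))" by blast
    qed (auto simp: cell_def)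
    show "finite (cell ` ({..<n} \<rightarrow>\<^sub>E \<U>'))" using U' by (intro finite_imageI finite_PiE) auto
  qed
qed

section \<open>Separated sets and their codes\<close>

lemma bowen_dist_gr_iff:
  assumes "n > 0"
  shows "bowen_dist d S n x y > \<epsilon> \<longleftrightarrow> (\<exists>i<n. d ((S ^^ i) x) ((S ^^ i) y) > \<epsilon>)"
proof -
  have "{..<n} \<noteq> {}" using assms by auto
  then show ?thesis unfolding bowen_dist_def by (subst Max_gr_iff) auto
qed

definition separated :: "'b set \<Rightarrow> ('b \<Rightarrow> 'b \<Rightarrow> real) \<Rightarrow> ('b \<Rightarrow> 'b) \<Rightarrow> nat \<Rightarrow> real \<Rightarrow> 'b set \<Rightarrow> bool" where
  "separated Y d S n \<epsilon> E \<longleftrightarrow>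
     E \<subseteq> Y \<and> finite E \<and> (\<forall>x\<in>E. \<forall>y\<in>E. x \<noteq> y \<longrightarrow> bowen_dist d S n x y > \<epsilon>)"

text \<open>\<open>Max\<close> carries information only for a finite nonempty set of cardinalities,
  so even a lower bound for \<open>sep_number\<close> first needs some bound on all separated sets.
  The empty set provides the nonemptiness.\<close>

lemma sep_number_bounds:
  assumes "\<And>E. separated Y d S n \<epsilon> E \<Longrightarrow> card E \<le> N"
  shows "sep_number Y d S n \<epsilon> \<le> N" "separated Y d S n \<epsilon> E \<Longrightarrow> card E \<le> sep_number Y d S n \<epsilon>"
proof -
  let ?C = "{card E | E. separated Y d S n \<epsilon> E}"
  have eq: "sep_number Y d S n \<epsilon> = Max ?C" by (simp add: sep_number_def separated_def)
  have fin: "finite ?C" by (rule finite_subset[of _ "{..N}"]) (use assms in auto)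
  have "0 \<in> ?C" by (auto simp: separated_def intro!: exI[of _ "{}"])
  then show "sep_number Y d S n \<epsilon> \<le> N" unfolding eq using assms by (subst Max_le_iff[OF fin]) auto
  show "separated Y d S n \<epsilon> E \<Longrightarrow> card E \<le> sep_number Y d S n \<epsilon>"
    unfolding eq using fin by (intro Max_ge) auto
qed

text \<open>A code that determines points up to \<epsilon> along the orbit is injective on separated
  sets; both upper bounds below have this form.\<close>

lemma separated_card_le_codes:
  assumes "n > 0" "finite C" "\<And>x. x \<in> Y \<Longrightarrow> c x \<in> C"
    and "\<And>x y i. x \<in> Y \<Longrightarrow> y \<in> Y \<Longrightarrow> c x = c y \<Longrightarrow> i < n \<Longrightarrow> d ((S ^^ i) x) ((S ^^ i) y) \<le> \<epsilon>"
    and E: "separated Y d S n \<epsilon> E"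
  shows "card E \<le> card C"
proof -
  have "inj_on c E"
  proof (rule inj_onI, rule ccontr)
    fix x y assume xy: "x \<in> E" "y \<in> E" "c x = c y" "x \<noteq> y"
    then obtain i where "i < n" "d ((S ^^ i) x) ((S ^^ i) y) > \<epsilon>"
      using E bowen_dist_gr_iff[OF assms(1)] unfolding separated_def by metis
    then show False using assms(4)[of x y i] xy E by (auto simp: separated_def)
  qed
  moreover have "c ` E \<subseteq> C" using assms(3) E by (auto simp: separated_def)
  ultimately show ?thesis using card_inj_on_le assms(2) by blast
qed

text \<open>Maurey's empirical method, derandomized: each new point is chosen so that its deviation from
  the mean has a nonpositive inner product with the sum of the earlier deviations.\<close>

lemma (in prob_space) empirical_approximation:
  fixes g :: "'j \<Rightarrow> 'a \<Rightarrow> real" and B :: real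
  assumes J: "finite J" and g: "\<And>j. j \<in> J \<Longrightarrow> g j \<in> borel_measurable M"
    and B: "\<And>j x. j \<in> J \<Longrightarrow> x \<in> space M \<Longrightarrow> \<bar>g j x\<bar> \<le> B"
  shows "\<exists>xs. (\<forall>s<k. xs s \<in> space M) \<and>
    (\<Sum>j\<in>J. (\<Sum>s<k. g j (xs s) - expectation (g j))\<^sup>2) \<le> k * card J * (2 * B)\<^sup>2"
proof (induction k)
  case (Suc k)
  then obtain xs where xs: "\<forall>s<k. xs s \<in> space M"
    "(\<Sum>j\<in>J. (\<Sum>s<k. g j (xs s) - expectation (g j))\<^sup>2) \<le> k * card J * (2 * B)\<^sup>2" by blast
  define c where "c j = expectation (g j)" for j
  define S where "S j = (\<Sum>s<k. g j (xs s) - c j)" for j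
  define h where "h x = (\<Sum>j\<in>J. S j * (g j x - c j))" for x
  have int: "integrable M (g j)" if "j \<in> J" for j
    using g B that by (intro integrable_const_bound[of _ B]) auto
  have c: "\<bar>c j\<bar> \<le> B" if "j \<in> J" for j
  proof -
    have "\<bar>c j\<bar> \<le> expectation (\<lambda>x. \<bar>g j x\<bar>)" unfolding c_def by (rule integral_abs_bound)
    also have "\<dots> \<le> expectation (\<lambda>x. B)" using int[OF that] B[OF that] by (intro integral_mono) auto
    finally show ?thesis by (simp add: prob_space)
  qed
  have hint: "integrable M h" unfolding h_def
    by (intro Bochner_Integration.integrable_sum integrable_mult_right Bochner_Integration.integrable_diff int) auto
  have h0: "expectation h = 0"
  proof -
    have "expectation h = (\<Sum>j\<in>J. S j * (expectation (g j) - c j))"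
      unfolding h_def using int by (simp add: Bochner_Integration.integral_sum prob_space)
    then show ?thesis by (simp add: c_def)
  qed
  have "\<exists>x\<in>space M. h x \<le> 0"
  proof (rule ccontr)
    assume "\<not> ?thesis"
    then have "expectation (\<lambda>x. 0) < expectation h"
      using hint by (intro integral_less_AE_space) (auto simp: emeasure_space_1 not_le)
    then show False using h0 by simp
  qed
  then obtain x where x: "x \<in> space M" "h x \<le> 0" by blast
  have "(\<Sum>j\<in>J. (\<Sum>s<Suc k. g j ((xs(k := x)) s) - c j)\<^sup>2) = (\<Sum>j\<in>J. (S j + (g j x - c j))\<^sup>2)"
    unfolding S_def by (intro sum.cong refl arg_cong[of _ _ "\<lambda>u. u\<^sup>2"]) simp
  also have "\<dots> = (\<Sum>j\<in>J. (S j)\<^sup>2) + 2 * h x + (\<Sum>j\<in>J. (g j x - c j)\<^sup>2)"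
    unfolding h_def sum_distrib_left by (simp only: power2_sum sum.distrib mult.assoc add_ac)
  also have "\<dots> \<le> k * card J * (2 * B)\<^sup>2 + (\<Sum>j\<in>J. (2 * B)\<^sup>2)"
  proof -
    have "(g j x - c j)\<^sup>2 \<le> (2 * B)\<^sup>2" if "j \<in> J" for j
      using B[OF that x(1)] c[OF that] by (intro abs_le_square_iff[THEN iffD1]) linarith
    then have "(\<Sum>j\<in>J. (g j x - c j)\<^sup>2) \<le> (\<Sum>j\<in>J. (2 * B)\<^sup>2)" by (rule sum_mono)
    then show ?thesis using xs(2) x(2) by (simp add: S_def c_def)
  qed
  also have "\<dots> = Suc k * card J * (2 * B)\<^sup>2" by (simp add: algebra_simps)
  finally have "(\<Sum>j\<in>J. (\<Sum>s<Suc k. g j ((xs(k := x)) s) - c j)\<^sup>2) \<le> Suc k * card J * (2 * B)\<^sup>2" .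
  moreover have "\<forall>s<Suc k. (xs(k := x)) s \<in> space M" using xs(1) x(1) by (auto simp: less_Suc_eq)
  ultimately show ?case unfolding c_def by blast
qed simp

lemma floor_eq_imp_close:
  fixes v w :: real
  assumes "\<gamma> > 0" "\<lfloor>v / \<gamma>\<rfloor> = \<lfloor>w / \<gamma>\<rfloor>"
  shows "\<bar>v - w\<bar> < \<gamma>"
proof -
  have "\<bar>v / \<gamma> - w / \<gamma>\<bar> < 1" using assms(2) by linarith
  then have "\<bar>(v - w) / \<gamma>\<bar> < 1" by (simp add: diff_divide_distrib)
  then show ?thesis using assms(1) by (simp add: abs_divide)
qed

context induced_system
begin

lemma uniform_bound:
  assumes "finite \<Phi>" "\<And>f. f \<in> \<Phi> \<Longrightarrow> continuous_map X euclideanreal f"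
  obtains B where "B > 0" "\<And>f x. f \<in> \<Phi> \<Longrightarrow> x \<in> topspace X \<Longrightarrow> \<bar>f x\<bar> \<le> B"
proof -
  have "\<forall>f\<in>\<Phi>. \<exists>B>0. \<forall>x\<in>topspace X. \<bar>f x\<bar> \<le> B"
    using continuous_map_compact_bounded[OF compact] assms(2) by metis
  then obtain b where b: "\<And>f. f \<in> \<Phi> \<Longrightarrow> b f > 0"
    "\<And>f x. f \<in> \<Phi> \<Longrightarrow> x \<in> topspace X \<Longrightarrow> \<bar>f x\<bar> \<le> b f" by metis
  have "\<bar>f x\<bar> \<le> 1 + sum b \<Phi>" if "f \<in> \<Phi>" "x \<in> topspace X" for f x
  proof -
    have "b f \<le> sum b \<Phi>" using b(1) assms(1) that by (intro member_le_sum) (auto intro: less_imp_le)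
    then show ?thesis using b(2)[OF that] by linarith
  qed
  moreover have "sum b \<Phi> \<ge> 0" using b(1) by (intro sum_nonneg) (auto intro: less_imp_le)
  ultimately show thesis using that[of "1 + sum b \<Phi>"] by auto
qed

lemma integral_bound:
  assumes "\<mu> \<in> prob_measures X" "continuous_map X euclideanreal f" "\<And>x. x \<in> topspace X \<Longrightarrow> \<bar>f x\<bar> \<le> B"
  shows "\<bar>\<integral>x. f x \<partial>\<mu>\<bar> \<le> B"
proof -
  interpret prob_space \<mu> using assms prob_measuresD by blast
  have "\<bar>\<integral>x. f x \<partial>\<mu>\<bar> \<le> (\<integral>x. \<bar>f x\<bar> \<partial>\<mu>)" by (rule integral_abs_bound)
  also have "\<dots> \<le> (\<integral>x. B \<partial>\<mu>)"
    using integrable_continuous_map[OF compact assms(2,1)] assms(3) prob_measuresD(3)[OF assms(1)]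
    by (intro integral_mono) auto
  finally show ?thesis by (simp add: prob_space)
qed

text \<open>Rounding all integrals at all \<open>n\<close> times gives a crude bound, exponential in
  \<open>n\<close>. Its purpose is to make the maximum in \<open>sep_number\<close> meaningful for
  the lower bounds.\<close>

lemma separated_card_bounded:
  assumes "n > 0" "\<epsilon> > 0"
  obtains N where "\<And>E. separated (prob_measures X) D (push_forward X T) n \<epsilon> E \<Longrightarrow> card E \<le> N"
proof -
  obtain \<Phi> \<gamma> where \<Phi>: "finite \<Phi>" "\<gamma> > 0" "\<And>f. f \<in> \<Phi> \<Longrightarrow> continuous_map X euclideanreal f"
    "\<And>\<mu> \<nu>. \<mu> \<in> prob_measures X \<Longrightarrow> \<nu> \<in> prob_measures X \<Longrightarrow>
       (\<forall>f\<in>\<Phi>. \<bar>(\<integral>x. f x \<partial>\<mu>) - (\<integral>x. f x \<partial>\<nu>)\<bar> < \<gamma>) \<Longrightarrow> D \<mu> \<nu> < \<epsilon>"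
    using dist_small_if_integrals_close[OF assms(2)] by metis
  obtain B where B: "B > 0" "\<And>f x. f \<in> \<Phi> \<Longrightarrow> x \<in> topspace X \<Longrightarrow> \<bar>f x\<bar> \<le> B"
    using uniform_bound[of \<Phi>] \<Phi> by metis
  define C where "C = ({..<n} \<times> \<Phi>) \<rightarrow>\<^sub>E {\<lfloor>- B / \<gamma>\<rfloor>..\<lfloor>B / \<gamma>\<rfloor>}"
  define c where "c \<mu> = restrict (\<lambda>(i, f). \<lfloor>(\<integral>x. f x \<partial>(push_forward X T ^^ i) \<mu>) / \<gamma>\<rfloor>) ({..<n} \<times> \<Phi>)" for \<mu>
  show thesis
  proof (rule that)
    fix E assume "separated (prob_measures X) D (push_forward X T) n \<epsilon> E"
    then show "card E \<le> card C"
    proof (rule separated_card_le_codes[where c = c, rotated -1])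
      show "finite C" unfolding C_def using \<Phi>(1) by (intro finite_PiE) auto
      show "c \<mu> \<in> C" if "\<mu> \<in> prob_measures X" for \<mu>
        unfolding c_def C_def
      proof (rule restrict_PiE_iff[THEN iffD2], clarsimp)
        fix i f assume "f \<in> \<Phi>"
        then have "\<bar>\<integral>x. f x \<partial>(push_forward X T ^^ i) \<mu>\<bar> \<le> B"
          using that \<Phi> B by (intro integral_bound funpow_push_forward_prob_measures) auto
        then show "\<lfloor>- (B / \<gamma>)\<rfloor> \<le> \<lfloor>(\<integral>x. f x \<partial>(push_forward X T ^^ i) \<mu>) / \<gamma>\<rfloor> \<and>
          \<lfloor>(\<integral>x. f x \<partial>(push_forward X T ^^ i) \<mu>) / \<gamma>\<rfloor> \<le> \<lfloor>B / \<gamma>\<rfloor>"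
          using \<Phi>(2) by (auto intro!: floor_mono divide_right_mono simp: minus_divide_left simp del: minus_divide_left[symmetric])
      qed
      fix \<mu> \<nu> i assume *: "\<mu> \<in> prob_measures X" "\<nu> \<in> prob_measures X" "c \<mu> = c \<nu>" "i < n"
      have "\<bar>(\<integral>x. f x \<partial>(push_forward X T ^^ i) \<mu>) - (\<integral>x. f x \<partial>(push_forward X T ^^ i) \<nu>)\<bar> < \<gamma>"
        if "f \<in> \<Phi>" for f
        using fun_cong[OF *(3), of "(i, f)"] *(4) that
        by (intro floor_eq_imp_close \<Phi>(2)) (simp add: c_def)
      then show "D ((push_forward X T ^^ i) \<mu>) ((push_forward X T ^^ i) \<nu>) \<le> \<epsilon>"
        using * by (intro less_imp_le \<Phi>(4) funpow_push_forward_prob_measures) auto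
    qed (use assms in auto)
  qed
qed

end


section \<open>Zero entropy\<close>

context induced_system
begin

lemma oscillation_cover:
  assumes "finite \<Phi>" "\<And>f. f \<in> \<Phi> \<Longrightarrow> continuous_map X euclideanreal f" "\<gamma> > 0"
  shows "open_cover X {U. openin X U \<and> (\<forall>f\<in>\<Phi>. \<forall>x\<in>U. \<forall>y\<in>U. \<bar>f x - f y\<bar> < \<gamma>)}" (is "open_cover X ?\<U>")
  unfolding open_cover_def
proof (intro conjI equalityI subsetI)
  fix p assume p: "p \<in> topspace X"
  define U where "U = topspace X \<inter> (\<Inter>f\<in>\<Phi>. {x \<in> topspace X. f x \<in> ball (f p) (\<gamma> / 2)})"
  have "openin X U"
    unfolding U_def using assms
    by (intro openin_Int_Inter) (auto intro!: openin_continuous_map_preimage simp del: mem_ball)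
  moreover have "\<bar>f x - f y\<bar> < \<gamma>" if "f \<in> \<Phi>" "x \<in> U" "y \<in> U" for f x y
  proof -
    have "dist (f p) (f x) < \<gamma> / 2" "dist (f p) (f y) < \<gamma> / 2" using that by (auto simp: U_def)
    then show ?thesis unfolding dist_real_def by linarith
  qed
  moreover have "p \<in> U" using p assms(3) by (auto simp: U_def)
  ultimately show "p \<in> \<Union>?\<U>" by blast
qed (auto dest: openin_subset)

text \<open>Off a small proportion of the coordinates a measure is approximated by an empirical measure
  with boundedly many atoms; those atoms, up to an element of the iterated cover, and the values at
  the remaining coordinates determine the measure up to \<open>\<epsilon>\<close> in the Bowen metric.\<close>

lemma sep_number_zero_entropy:
  fixes \<epsilon> b :: real
  assumes h: "\<not> 0 < topological_entropy X T" and "\<epsilon> > 0" "b > 0"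
  shows "\<forall>\<^sub>F n in sequentially.
    real (sep_number (prob_measures X) D (push_forward X T) n \<epsilon>) \<le> exp (b * n)"
proof -
  obtain \<Phi> \<gamma> where \<Phi>: "finite \<Phi>" "\<gamma> > 0" "\<And>f. f \<in> \<Phi> \<Longrightarrow> continuous_map X euclideanreal f"
    "\<And>\<mu> \<nu>. \<mu> \<in> prob_measures X \<Longrightarrow> \<nu> \<in> prob_measures X \<Longrightarrow>
       (\<forall>f\<in>\<Phi>. \<bar>(\<integral>x. f x \<partial>\<mu>) - (\<integral>x. f x \<partial>\<nu>)\<bar> < \<gamma>) \<Longrightarrow> D \<mu> \<nu> < \<epsilon>"
    using dist_small_if_integrals_close[OF assms(2)] by metis
  obtain B where B: "B > 0" "\<And>f x. f \<in> \<Phi> \<Longrightarrow> x \<in> topspace X \<Longrightarrow> \<bar>f x\<bar> \<le> B"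
    using uniform_bound[of \<Phi>] \<Phi> by metis
  define L where "L = card \<Phi>"
  \<comment> \<open>The symbol 0 will mark a coordinate that the empirical measure approximates
    well. At the others the integral, shifted by \<open>B\<close> and rounded to multiples of
    \<open>\<gamma>\<close>, is stored plus one, so symbols reach at most \<open>Q\<close>.\<close>
  define Q where "Q = Suc (nat \<lfloor>2 * B / \<gamma>\<rfloor>)"
  \<comment> \<open>There are \<open>n * L\<close> coordinates, so the exceptional values cost at
    most \<open>exp (b / 2 * n)\<close>; \<open>Suc L\<close> covers the case
    \<open>L = 0\<close>.\<close>
  define \<eta> where "\<eta> = b / (2 * Suc L)"
  have "\<eta> > 0" using assms by (simp add: \<eta>_def)
  have "L / Suc L \<le> 1" by simp
  then have \<eta>L: "\<eta> * L \<le> b / 2" using assms(3) by (simp add: \<eta>_def field_simps)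
  obtain \<delta> :: real where \<delta>: "\<delta> > 0" "\<And>N :: (nat \<times> ('a \<Rightarrow> real)) set. finite N \<Longrightarrow>
       real (card {c \<in> N \<rightarrow>\<^sub>E {..Q}. real (card {j\<in>N. c j \<noteq> 0}) \<le> \<delta> * card N}) \<le> exp (\<eta> * card N)"
    by (rule card_sparse_functions[OF \<open>\<eta> > 0\<close>]) (rule that; assumption)
  \<comment> \<open>Chebyshev: the squared deviations add up to at most
    \<open>k * card N * (2 * B)\<^sup>2\<close>, and a bad coordinate deviates by at least
    \<open>k * (\<gamma> / 8)\<close>, so the proportion of bad coordinates is at most
    \<open>256 * B\<^sup>2 / (k * \<gamma>\<^sup>2) \<le> \<delta>\<close>.\<close>
  define k where "k = Suc (nat \<lceil>256 * B\<^sup>2 / (\<delta> * \<gamma>\<^sup>2)\<rceil>)"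
  have "k \<ge> 256 * B\<^sup>2 / (\<delta> * \<gamma>\<^sup>2)" "k > 0" unfolding k_def by linarith+
  then have k: "256 * B\<^sup>2 \<le> k * (\<delta> * \<gamma>\<^sup>2)" "k > 0"
    using \<delta>(1) \<Phi>(2) by (simp_all add: pos_divide_le_eq)
  define \<U> where "\<U> = {U. openin X U \<and> (\<forall>f\<in>\<Phi>. \<forall>x\<in>U. \<forall>y\<in>U. \<bar>f x - f y\<bar> < \<gamma> / 8)}"
  have \<U>: "open_cover X \<U>" unfolding \<U>_def using \<Phi> by (intro oscillation_cover) auto
  have "cover_entropy X T \<U> \<le> topological_entropy X T"
    unfolding topological_entropy_def using \<U> by (intro SUP_upper) auto
  \<comment> \<open>Entropy 0 leaves room for a \<open>k\<close>-th power: the cells of the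
    \<open>k\<close> atoms can be chosen in at most \<open>exp (b / 2 * n)\<close> ways.\<close>
  then have "cover_entropy X T \<U> < ereal (b / (2 * k))"
    using h assms(3) k(2) by (metis divide_pos_pos ereal_less(2) le_less_trans mult_pos_pos not_less of_nat_0_less_iff zero_less_numeral)
  then have "\<forall>\<^sub>F n in sequentially.
      ereal (ln (real (cover_number X (iterated_join X T \<U> n))) / real n) < ereal (b / (2 * k))"
    unfolding cover_entropy_def by (rule Limsup_lessD)
  then show ?thesis using eventually_gt_at_top[of 0]
  proof eventually_elim
    case (elim n)
    define m where "m = cover_number X (iterated_join X T \<U> n)"
    have m_le: "real m ^ k \<le> exp (b / 2 * n)"
    proof (cases "m = 0")
      case False
      then have "ln (real m) \<le> b / (2 * k) * n"
        using elim by (simp add: m_def pos_divide_less_eq)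
      then have "exp (ln (real m)) \<le> exp (b / (2 * k) * n)" by (simp only: exp_le_cancel_iff)
      then have "real m \<le> exp (b / (2 * k) * n)" using False by simp
      then have "real m ^ k \<le> exp (b / (2 * k) * n) ^ k" by (intro power_mono) auto
      also have "\<dots> = exp (b / 2 * n)" using k(2) by (simp add: exp_of_nat_mult[symmetric])
      finally show ?thesis .
    qed (use k in \<open>simp add: zero_power\<close>)
    obtain \<V> where \<V>: "\<V> \<subseteq> iterated_join X T \<U> n" "finite \<V>" "\<Union>\<V> = topspace X" "card \<V> = m"
    proof -
      obtain \<V>' where "\<V>' \<subseteq> iterated_join X T \<U> n" "finite \<V>'" "\<Union>\<V>' = topspace X"
        using iterated_join_finite_subcover[OF compact \<U> funpow_in] by metis
      then show thesis using cover_number_attained[of \<V>' "iterated_join X T \<U> n" X] that m_def by metis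
    qed
    define cell where "cell x = (SOME V. V \<in> \<V> \<and> x \<in> V)" for x
    have cell: "cell x \<in> \<V>" "x \<in> cell x" if "x \<in> topspace X" for x
      using someI_ex[of "\<lambda>V. V \<in> \<V> \<and> x \<in> V"] that \<V>(3) by (auto simp: cell_def)
    have same_cell: "\<bar>f ((T ^^ i) x) - f ((T ^^ i) y)\<bar> < \<gamma> / 8"
      if xy: "x \<in> topspace X" "y \<in> topspace X" "cell x = cell y" "f \<in> \<Phi>" "i < n" for x y f i
    proof -
      obtain A where "\<forall>i<n. A i \<in> \<U>" "cell x = {z \<in> topspace X. \<forall>i<n. (T ^^ i) z \<in> A i}"
        using cell(1)[OF xy(1)] \<V>(1) unfolding iterated_join_def by blast
      then have "A i \<in> \<U>" "(T ^^ i) x \<in> A i" "(T ^^ i) y \<in> A i"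
        using cell(2)[OF xy(1)] cell(2)[OF xy(2)] xy by auto
      then show ?thesis using xy(4) by (auto simp: \<U>_def)
    qed
    define N where "N = {..<n} \<times> \<Phi>"
    have N: "finite N" "card N = n * L" using \<Phi>(1) by (simp_all add: N_def L_def)
    define e where "e \<mu> j = (\<integral>x. snd j ((T ^^ fst j) x) \<partial>\<mu>)" for \<mu> :: "'a measure" and j :: "nat \<times> ('a \<Rightarrow> real)"
    define good where "good \<mu> xs \<longleftrightarrow> (\<forall>s<k. xs s \<in> topspace X) \<and>
        (\<Sum>j\<in>N. (\<Sum>s<k. snd j ((T ^^ fst j) (xs s)) - e \<mu> j)\<^sup>2) \<le> k * card N * (2 * B)\<^sup>2" for \<mu> xs
    have "\<exists>xs. good \<mu> xs"
      if \<mu>: "\<mu> \<in> prob_measures X" for \<mu>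
    proof -
      interpret prob_space \<mu> by (rule prob_measuresD[OF \<mu>])
      show ?thesis
        unfolding good_def e_def prob_measuresD(3)[OF \<mu>, symmetric]
      proof (rule empirical_approximation[OF N(1)])
        fix j assume "j \<in> N"
        then have "snd j \<in> \<Phi>" by (auto simp: N_def)
        then show "(\<lambda>x. snd j ((T ^^ fst j) x)) \<in> borel_measurable \<mu>"
          unfolding prob_measures_measurable[OF \<mu>]
          by (intro borel_measurable_continuous_map compose_funpow_continuous \<Phi>)
        show "\<bar>snd j ((T ^^ fst j) x)\<bar> \<le> B" if "x \<in> space \<mu>" for x
          using that \<open>snd j \<in> \<Phi>\<close> prob_measuresD(3)[OF \<mu>] by (intro B funpow_in) auto
      qed
    qed
    then obtain xs where "\<And>\<mu>. \<mu> \<in> prob_measures X \<Longrightarrow> good \<mu> (xs \<mu>)" by metis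
    then have xs: "\<And>\<mu> s. \<mu> \<in> prob_measures X \<Longrightarrow> s < k \<Longrightarrow> xs \<mu> s \<in> topspace X"
      "\<And>\<mu>. \<mu> \<in> prob_measures X \<Longrightarrow> (\<Sum>j\<in>N. (\<Sum>s<k. snd j ((T ^^ fst j) (xs \<mu> s)) - e \<mu> j)\<^sup>2)
          \<le> k * card N * (2 * B)\<^sup>2"
      unfolding good_def by blast+
    define a where "a \<mu> j = (\<Sum>s<k. snd j ((T ^^ fst j) (xs \<mu> s)) - e \<mu> j)" for \<mu> j
    define c where "c \<mu> = restrict (\<lambda>j. if \<bar>a \<mu> j\<bar> < k * (\<gamma> / 8) then 0
        else Suc (nat \<lfloor>(e \<mu> j + B) / \<gamma>\<rfloor>)) N" for \<mu>
    define code where "code \<mu> = (restrict (\<lambda>s. cell (xs \<mu> s)) {..<k}, c \<mu>)" for \<mu>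
    define C where "C = {c \<in> N \<rightarrow>\<^sub>E {..Q}. real (card {j\<in>N. c j \<noteq> 0}) \<le> \<delta> * card N}"
    have e_bound: "\<bar>e \<mu> j\<bar> \<le> B" if "\<mu> \<in> prob_measures X" "j \<in> N" for \<mu> j
    proof -
      have "snd j \<in> \<Phi>" using that(2) by (auto simp: N_def)
      then show ?thesis unfolding e_def
        by (intro integral_bound[OF that(1)] compose_funpow_continuous \<Phi> B funpow_in)
    qed
    have c_in: "c \<mu> \<in> C" if \<mu>: "\<mu> \<in> prob_measures X" for \<mu>
      unfolding C_def
    proof (intro CollectI conjI)
      have "Suc (nat \<lfloor>(e \<mu> j + B) / \<gamma>\<rfloor>) \<le> Q" if "j \<in> N" for j
        unfolding Q_def using e_bound[OF \<mu> that] \<Phi>(2)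
        by (auto intro!: nat_mono floor_mono divide_right_mono)
      then show "c \<mu> \<in> N \<rightarrow>\<^sub>E {..Q}" by (auto simp: c_def)
      define bad where "bad = {j\<in>N. c \<mu> j \<noteq> 0}"
      have fb: "finite bad" using N by (simp add: bad_def)
      have "card bad * (k * (\<gamma> / 8))\<^sup>2 = (\<Sum>j\<in>bad. (k * (\<gamma> / 8))\<^sup>2)" by simp
      also have "\<dots> \<le> (\<Sum>j\<in>bad. (a \<mu> j)\<^sup>2)"
      proof (rule sum_mono)
        fix j assume "j \<in> bad"
        then have "k * (\<gamma> / 8) \<le> \<bar>a \<mu> j\<bar>" by (auto simp: bad_def c_def split: if_splits)
        then show "(k * (\<gamma> / 8))\<^sup>2 \<le> (a \<mu> j)\<^sup>2" using \<Phi>(2) by (intro abs_le_square_iff[THEN iffD1]) auto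
      qed
      also have "\<dots> \<le> (\<Sum>j\<in>N. (a \<mu> j)\<^sup>2)" using N by (intro sum_mono2) (auto simp: bad_def)
      also have "\<dots> \<le> k * card N * (2 * B)\<^sup>2" unfolding a_def by (rule xs(2)[OF \<mu>])
      finally have "k * (card bad * (k * \<gamma>\<^sup>2)) \<le> k * (card N * (256 * B\<^sup>2))"
        by (simp add: power2_eq_square field_simps)
      then have "card bad * (k * \<gamma>\<^sup>2) \<le> card N * (256 * B\<^sup>2)" using k(2) by simp
      also have "\<dots> \<le> card N * (k * (\<delta> * \<gamma>\<^sup>2))" by (intro mult_left_mono k) auto
      finally have "card bad * (k * \<gamma>\<^sup>2) \<le> \<delta> * card N * (k * \<gamma>\<^sup>2)" by (simp add: algebra_simps)
      then show "real (card {j\<in>N. c \<mu> j \<noteq> 0}) \<le> \<delta> * card N"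
        using k(2) \<Phi>(2) unfolding bad_def by (subst (asm) mult_le_cancel_right_pos) auto
    qed
    have same_code: "\<bar>e \<mu> j - e \<nu> j\<bar> < \<gamma>"
      if P: "\<mu> \<in> prob_measures X" "\<nu> \<in> prob_measures X" and eq: "code \<mu> = code \<nu>" and j: "j \<in> N" for \<mu> \<nu> j
    proof -
      have cells: "cell (xs \<mu> s) = cell (xs \<nu> s)" if "s < k" for s
      proof -
        have "restrict (\<lambda>s. cell (xs \<mu> s)) {..<k} s = restrict (\<lambda>s. cell (xs \<nu> s)) {..<k} s"
          using eq by (simp add: code_def)
        then show ?thesis using that by simp
      qed
      have cj: "c \<mu> j = c \<nu> j" using eq by (simp add: code_def)
      show ?thesis
      proof (cases "c \<mu> j = 0")
        case True
        \<comment> \<open>Three errors of \<open>k * (\<gamma> / 8)\<close> add up: the deviations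
          of the two empirical sums and the oscillation over the common cells.\<close>
        then have "\<bar>a \<mu> j\<bar> < k * (\<gamma> / 8)" "\<bar>a \<nu> j\<bar> < k * (\<gamma> / 8)"
          using cj j by (auto simp: c_def split: if_splits)
        moreover have "\<bar>\<Sum>s<k. snd j ((T ^^ fst j) (xs \<mu> s)) - snd j ((T ^^ fst j) (xs \<nu> s))\<bar> \<le> (\<Sum>s<k. \<gamma> / 8)"
          using cells xs(1) P j by (intro order.trans[OF sum_abs] sum_mono less_imp_le same_cell) (auto simp: N_def)
        moreover have "(\<Sum>s<k. snd j ((T ^^ fst j) (xs \<mu> s)) - snd j ((T ^^ fst j) (xs \<nu> s)))
            = a \<mu> j - a \<nu> j + k * (e \<mu> j - e \<nu> j)"
          by (simp add: a_def sum_subtractf algebra_simps)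
        ultimately have "\<bar>k * (e \<mu> j - e \<nu> j)\<bar> < k * (\<gamma> / 8) * 3" by (simp add: abs_if split: if_splits)
        then have "k * \<bar>e \<mu> j - e \<nu> j\<bar> < k * (3 * \<gamma> / 8)" by (simp add: abs_mult)
        then have "\<bar>e \<mu> j - e \<nu> j\<bar> < 3 * \<gamma> / 8" using k(2) by simp
        then show ?thesis using \<Phi>(2) by simp
      next
        case False
        have "nat \<lfloor>(e \<mu> j + B) / \<gamma>\<rfloor> = nat \<lfloor>(e \<nu> j + B) / \<gamma>\<rfloor>"
          using False cj j by (auto simp: c_def split: if_splits)
        moreover have "0 \<le> (e \<mu> j + B) / \<gamma>" "0 \<le> (e \<nu> j + B) / \<gamma>"
          using e_bound[OF P(1) j] e_bound[OF P(2) j] \<Phi>(2) by auto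
        ultimately have "\<lfloor>(e \<mu> j + B) / \<gamma>\<rfloor> = \<lfloor>(e \<nu> j + B) / \<gamma>\<rfloor>"
          by (metis eq_nat_nat_iff zero_le_floor)
        from floor_eq_imp_close[OF \<Phi>(2) this] show ?thesis by simp
      qed
    qed
    have finC: "finite C" unfolding C_def using N finite_PiE[of N "\<lambda>_. {..Q}"] by simp
    have card_le: "card E \<le> card (({..<k} \<rightarrow>\<^sub>E \<V>) \<times> C)"
      if "separated (prob_measures X) D (push_forward X T) n \<epsilon> E" for E
      using that
    proof (rule separated_card_le_codes[where c = code, rotated -1])
      show "finite (({..<k} \<rightarrow>\<^sub>E \<V>) \<times> C)" using \<V>(2) finC by (intro finite_cartesian_product finite_PiE) auto
      show "code \<mu> \<in> ({..<k} \<rightarrow>\<^sub>E \<V>) \<times> C" if "\<mu> \<in> prob_measures X" for \<mu>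
        using that c_in cell xs(1) by (auto simp: code_def)
      fix \<mu> \<nu> i assume *: "\<mu> \<in> prob_measures X" "\<nu> \<in> prob_measures X" "code \<mu> = code \<nu>" "i < n"
      have "\<bar>(\<integral>x. f x \<partial>(push_forward X T ^^ i) \<mu>) - (\<integral>x. f x \<partial>(push_forward X T ^^ i) \<nu>)\<bar> < \<gamma>"
        if "f \<in> \<Phi>" for f
        using same_code[OF *(1-3), of "(i, f)"] *(4) that
        by (simp add: e_def N_def integral_funpow_push_forward * \<Phi>(3))
      then show "D ((push_forward X T ^^ i) \<mu>) ((push_forward X T ^^ i) \<nu>) \<le> \<epsilon>"
        using * by (intro less_imp_le \<Phi>(4) funpow_push_forward_prob_measures) auto
    qed (use elim in auto)
    have "real (sep_number (prob_measures X) D (push_forward X T) n \<epsilon>)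
        \<le> real (card (({..<k} \<rightarrow>\<^sub>E \<V>) \<times> C))"
      using sep_number_bounds(1)[OF card_le] by (simp only: of_nat_le_iff)
    also have "\<dots> = real m ^ k * card C" by (simp add: card_cartesian_product card_PiE \<V>(4))
    also have "\<dots> \<le> exp (b / 2 * n) * exp (\<eta> * card N)"
      unfolding C_def by (intro mult_mono m_le \<delta> N) auto
    also have "\<dots> \<le> exp (b / 2 * n) * exp (b / 2 * n)"
      using mult_right_mono[OF \<eta>L, of n] by (simp add: N(2) algebra_simps)
    also have "\<dots> = exp (b * n)" by (simp add: exp_add[symmetric])
    finally show ?case .
  qed
qed

text \<open>Every fixed scale already has entropy at most 0, so no rate in \<epsilon>
  enters.\<close>

lemma upper_mdim_zero_entropy:
  assumes "\<not> 0 < topological_entropy X T"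
  shows "upper_mdim (prob_measures X) D (push_forward X T) \<le> 0"
proof -
  have scale: "entropy_at_scale (prob_measures X) D (push_forward X T) \<epsilon> \<le> 0" if "\<epsilon> > 0" for \<epsilon>
  proof -
    have "entropy_at_scale (prob_measures X) D (push_forward X T) \<epsilon> \<le> 0 + ereal b" if "b > 0" for b
      unfolding entropy_at_scale_def
    proof (rule Limsup_bounded)
      show "\<forall>\<^sub>F n in sequentially. ereal (ln (real (sep_number (prob_measures X) D (push_forward X T) n \<epsilon>)) / real n)
          \<le> 0 + ereal b"
        using sep_number_zero_entropy[OF assms \<open>\<epsilon> > 0\<close> \<open>b > 0\<close>] eventually_gt_at_top[of 0]
      proof eventually_elim
        case (elim n)
        define q where "q = sep_number (prob_measures X) D (push_forward X T) n \<epsilon>"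
        have "ln (real q) \<le> b * n"
        proof (cases "q = 0")
          case False
          then have "ln (real q) \<le> ln (exp (b * n))"
            using elim by (subst ln_le_cancel_iff) (auto simp: q_def)
          then show ?thesis by simp
        qed (use \<open>b > 0\<close> in simp)
        then show ?case using elim by (simp add: q_def pos_divide_le_eq)
      qed
    qed
    then show ?thesis by (rule ereal_le_epsilon2)
  qed
  show ?thesis unfolding upper_mdim_def
  proof (rule Limsup_bounded)
    have "\<forall>\<^sub>F \<epsilon> in at_right (0::real). 0 < \<epsilon> \<and> \<epsilon> < 1"
      using eventually_at_right[of 0 "1::real"] by (auto intro: exI[of _ 1])
    then show "\<forall>\<^sub>F \<epsilon> in at_right 0. entropy_at_scale (prob_measures X) D (push_forward X T) \<epsilon> / ereal (ln (1 / \<epsilon>)) \<le> 0"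
    proof eventually_elim
      case (elim \<epsilon>)
      then have "ln (1 / \<epsilon>) > 0" by simp
      then show ?case using scale[of \<epsilon>] elim by (subst ereal_divide_le_pos) auto
    qed
  qed
qed

end


section \<open>Independence from positive entropy\<close>

context induced_system
begin

text \<open>Regularity puts a closed neighbourhood of each point inside an element of the cover. The
  resulting \<open>A l\<close> and complement of \<open>U l\<close> are disjoint closed sets, the
  candidates for the pair with independence.\<close>

lemma closed_shrinking:
  assumes "open_cover X \<U>"
  obtains F :: "'a set" and A U where "finite F" "\<And>l. l \<in> F \<Longrightarrow> closedin X (A l)"
    "\<And>l. l \<in> F \<Longrightarrow> U l \<in> \<U>" "\<And>l. l \<in> F \<Longrightarrow> A l \<subseteq> U l" "topspace X \<subseteq> (\<Union>l\<in>F. A l)"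
proof -
  have reg: "regular_space X" by (rule metrizable_imp_regular_space[OF metrizable])
  define good where "good p U W A \<longleftrightarrow>
    U \<in> \<U> \<and> openin X W \<and> p \<in> W \<and> W \<subseteq> A \<and> closedin X A \<and> A \<subseteq> U" for p U W A
  have "\<exists>U W A. good p U W A" if p: "p \<in> topspace X" for p
  proof -
    obtain U where U: "U \<in> \<U>" "p \<in> U" "openin X U" using assms p unfolding open_cover_def by blast
    then have "closedin X (topspace X - U)" "p \<in> topspace X - (topspace X - U)" using p by auto
    then obtain W V where WV: "openin X W" "openin X V" "p \<in> W" "topspace X - U \<subseteq> V" "disjnt W V"
      using reg unfolding regular_space_def by metis
    have "W \<subseteq> topspace X - V" using WV openin_subset[OF WV(1)] by (auto simp: disjnt_def)
    moreover have "closedin X (topspace X - V)" using WV by auto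
    moreover have "topspace X - V \<subseteq> U" using WV by auto
    ultimately show ?thesis using U WV unfolding good_def by blast
  qed
  then obtain U W A where "\<And>p. p \<in> topspace X \<Longrightarrow> good p (U p) (W p) (A p)" by metis
  then have *: "\<And>p. p \<in> topspace X \<Longrightarrow> U p \<in> \<U>"
      "\<And>p. p \<in> topspace X \<Longrightarrow> openin X (W p)" "\<And>p. p \<in> topspace X \<Longrightarrow> p \<in> W p"
      "\<And>p. p \<in> topspace X \<Longrightarrow> W p \<subseteq> A p" "\<And>p. p \<in> topspace X \<Longrightarrow> closedin X (A p)"
      "\<And>p. p \<in> topspace X \<Longrightarrow> A p \<subseteq> U p"
    unfolding good_def by blast+
  have "\<And>V. V \<in> W ` topspace X \<Longrightarrow> openin X V" "topspace X \<subseteq> \<Union>(W ` topspace X)" using * by blast+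
  then obtain \<F> where "finite \<F>" "\<F> \<subseteq> W ` topspace X" "topspace X \<subseteq> \<Union>\<F>"
    using compact unfolding compact_space_alt by metis
  then obtain F where F: "finite F" "F \<subseteq> topspace X" "topspace X \<subseteq> (\<Union>l\<in>F. W l)"
    by (metis finite_subset_image)
  show thesis
  proof (rule that[OF F(1)])
    fix l assume "l \<in> F"
    then have "l \<in> topspace X" using F(2) by blast
    then show "closedin X (A l)" "U l \<in> \<U>" "A l \<subseteq> U l" by (fact *)+
  next
    have "W l \<subseteq> A l" if "l \<in> F" for l using that F(2) *(4) by blast
    then show "topspace X \<subseteq> (\<Union>l\<in>F. A l)" using F(3) by blast
  qed
qed

text \<open>Words record, at each time \<open>i < n\<close> and for each \<open>l\<close>, on which side of the gap between \<open>A l\<close>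
  and the complement of \<open>U l\<close> the orbit lies, if on any. A point whose word seldom clashes with
  that of \<open>y\<close> follows the elements \<open>U l\<close> visited by \<open>y\<close> except at few times, so a maximal family
  of frequently clashing words is exponentially large.\<close>

lemma positive_entropy_shatters:
  fixes A U :: "'b \<Rightarrow> 'a set" and \<delta> s :: real
  assumes F: "finite F" and AU: "\<And>l. l \<in> F \<Longrightarrow> A l \<subseteq> U l" "topspace X \<subseteq> (\<Union>l\<in>F. A l)"
    and \<U>: "\<And>l. l \<in> F \<Longrightarrow> U l \<in> \<U>" and n: "n > 0"
    and \<delta>: "\<delta> > 0" and sparse: "real (card {c \<in> {..<n} \<rightarrow>\<^sub>E {..card F}. real (card {j\<in>{..<n}. c j \<noteq> 0}) \<le> \<delta> * n}) \<le> s"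
  obtains S where "finite S" "\<And>w v. w \<in> S \<Longrightarrow> v \<in> S \<Longrightarrow> w \<noteq> v \<Longrightarrow> \<delta> * n \<le> card (({..<n} \<times> F) \<inter> clash w v)"
    "\<And>w. w \<in> S \<Longrightarrow> \<exists>x\<in>topspace X. \<forall>i<n. \<forall>l\<in>F. (w (i, l) = Some False \<longrightarrow> (T ^^ i) x \<in> A l) \<and>
       (w (i, l) = Some True \<longrightarrow> (T ^^ i) x \<notin> U l)"
    "real (cover_number X (iterated_join X T \<U> n)) \<le> card S * s"
proof -
  define I where "I = {..<n} \<times> F"
  have finI: "finite I" using F by (simp add: I_def)
  define word where "word x = (\<lambda>(i, l). if i < n \<and> l \<in> F then
      (if (T ^^ i) x \<in> A l then Some False else if (T ^^ i) x \<notin> U l then Some True else None) else None)" for x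
  define W where "W = word ` topspace X"
  have "W \<subseteq> {w. \<forall>j. (j \<in> I \<longrightarrow> w j \<in> UNIV) \<and> (j \<notin> I \<longrightarrow> w j = None)}"
    by (auto simp: W_def word_def I_def)
  then have finW: "finite W" by (rule finite_subset) (intro finite_set_of_finite_funs finI finite)
  define sep where "sep S \<longleftrightarrow> (\<forall>w\<in>S. \<forall>v\<in>S. w \<noteq> v \<longrightarrow> \<delta> * n \<le> card (I \<inter> clash w v))" for S
  define \<S> where "\<S> = {S. S \<subseteq> W \<and> sep S}"
  have "finite \<S>" "{} \<in> \<S>" using finW by (auto simp: \<S>_def sep_def)
  then obtain S where "S \<in> \<S>" and max': "\<forall>S'\<in>\<S>. S \<subseteq> S' \<longrightarrow> S = S'"
    using finite_has_maximal[of \<S>] by blast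
  then have S: "S \<subseteq> W" "sep S" by (auto simp: \<S>_def)
  have max: "S' = S" if "S' \<subseteq> W" "sep S'" "S \<subseteq> S'" for S'
    using max' that by (auto simp: \<S>_def)
  have clash_sym: "clash w v = clash v w" for w v :: "nat \<times> 'b \<Rightarrow> bool option"
    by (auto simp: clash_def ex_bool_eq)
  have clash_self: "clash w w = {}" for w :: "nat \<times> 'b \<Rightarrow> bool option"
    by (auto simp: clash_def)
  have near: "\<exists>v\<in>S. card (I \<inter> clash v w) < \<delta> * n" if w: "w \<in> W" for w
  proof (rule ccontr)
    assume *: "\<not> ?thesis"
    then have "sep (insert w S)" using S(2) clash_sym by (auto simp: sep_def not_less)
    then have "w \<in> S" using max[of "insert w S"] S(1) w by auto
    moreover have "real (card (I \<inter> clash w w)) < \<delta> * n" using \<delta> n by (simp add: clash_self)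
    ultimately show False using * by blast
  qed
  have finS: "finite S" using S(1) finW by (rule finite_subset)
  define y where "y = inv_into (topspace X) word"
  have y: "y v \<in> topspace X" "word (y v) = v" if "v \<in> S" for v
    using that S(1) inv_into_into[of v word "topspace X"] f_inv_into_f[of v word "topspace X"]
    by (auto simp: W_def y_def)
  define L where "L z = (SOME l. l \<in> F \<and> z \<in> A l)" for z
  have L: "L z \<in> F" "z \<in> A (L z)" if "z \<in> topspace X" for z
    using someI_ex[of "\<lambda>l. l \<in> F \<and> z \<in> A l"] AU(2) that by (auto simp: L_def)
  \<comment> \<open>Numbering from 1 reserves 0 for the times at which the element visited by the
    orbit of \<open>y\<close> is followed.\<close>
  obtain e where e: "bij_betw e {1..card F} F" using ex_bij_betw_nat_finite_1[OF F] by blast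
  define e' where "e' = the_inv_into {1..card F} e"
  have e': "e' l \<in> {1..card F}" "e (e' l) = l" if "l \<in> F" for l
    using that e the_inv_into_into[of e "{1..card F}" l "{1..card F}"] f_the_inv_into_f[of e "{1..card F}" l]
    by (auto simp: e'_def bij_betw_def)
  define C where "C = {c \<in> {..<n} \<rightarrow>\<^sub>E {..card F}. real (card {j\<in>{..<n}. c j \<noteq> 0}) \<le> \<delta> * n}"
  have finC: "finite C" unfolding C_def using finite_PiE[of "{..<n}" "\<lambda>_. {..card F}"] by simp
  define cell where "cell p = {x \<in> topspace X. \<forall>i<n. (T ^^ i) x \<in>
      (if snd p i = 0 then U (L ((T ^^ i) (y (fst p)))) else U (e (snd p i)))}" for p
  have "cover_number X (iterated_join X T \<U> n) \<le> card (cell ` (S \<times> C))"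
  proof (rule cover_number_le)
    show "cell ` (S \<times> C) \<subseteq> iterated_join X T \<U> n"
    proof
      fix V assume "V \<in> cell ` (S \<times> C)"
      then obtain v c where vc: "v \<in> S" "c \<in> C" "V = cell (v, c)" by auto
      define B where "B i = (if c i = 0 then U (L ((T ^^ i) (y v))) else U (e (c i)))" for i
      have "B i \<in> \<U>" if "i < n" for i
      proof (cases "c i = 0")
        case True
        then show ?thesis using \<U> L(1) funpow_in y(1)[OF vc(1)] by (simp add: B_def)
      next
        case False
        then have "c i \<in> {1..card F}" using vc(2) that by (auto simp: C_def)
        then have "e (c i) \<in> F" using e by (auto simp: bij_betw_def)
        then show ?thesis using False \<U> by (simp add: B_def)
      qed
      moreover have "V = {x \<in> topspace X. \<forall>i<n. (T ^^ i) x \<in> B i}"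
        by (simp add: vc(3) cell_def B_def)
      ultimately show "V \<in> iterated_join X T \<U> n" unfolding iterated_join_def by blast
    qed
    show "\<Union>(cell ` (S \<times> C)) = topspace X"
    proof (intro equalityI subsetI)
      fix x assume x: "x \<in> topspace X"
      then obtain v where v: "v \<in> S" "card (I \<inter> clash v (word x)) < \<delta> * n"
        using near[of "word x"] by (auto simp: W_def)
      define c where "c = restrict (\<lambda>i. if \<exists>l\<in>F. (i, l) \<in> clash v (word x)
          then e' (L ((T ^^ i) x)) else 0) {..<n}"
      have LF: "L ((T ^^ i) x) \<in> F" for i using L(1) funpow_in x by blast
      have "{i\<in>{..<n}. c i \<noteq> 0} \<subseteq> fst ` (I \<inter> clash v (word x))"
        by (force simp: c_def I_def split: if_splits)
      then have "card {i\<in>{..<n}. c i \<noteq> 0} \<le> card (I \<inter> clash v (word x))"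
        using finI by (meson card_image_le card_mono finite_Int finite_imageI le_trans)
      then have "c \<in> C" using v(2) e'(1)[OF LF] unfolding C_def by (auto simp: c_def)
      moreover have "x \<in> cell (v, c)"
      proof -
        have "(T ^^ i) x \<in> (if c i = 0 then U (L ((T ^^ i) (y v))) else U (e (c i)))" if i: "i < n" for i
        proof (cases "c i = 0")
          case False
          then have "c i = e' (L ((T ^^ i) x))" using i by (auto simp: c_def split: if_splits)
          then have "U (e (c i)) = U (L ((T ^^ i) x))" using e'(2)[OF LF] by simp
          moreover have "(T ^^ i) x \<in> U (L ((T ^^ i) x))" using AU(1)[OF LF] L(2) funpow_in x by blast
          ultimately show ?thesis using False by simp
        next
          case True
          \<comment> \<open>At time \<open>i\<close> the orbit of \<open>y v\<close> is in
            \<open>A l\<close>, so \<open>v\<close> reads \<open>False\<close> there. Without a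
            clash \<open>x\<close> does not read \<open>True\<close>: its orbit is in
            \<open>A l\<close> or in the gap, in either case in \<open>U l\<close>.\<close>
          define l where "l = L ((T ^^ i) (y v))"
          have l: "l \<in> F" "(T ^^ i) (y v) \<in> A l" using L funpow_in y(1)[OF v(1)] by (auto simp: l_def)
          have "e' (L ((T ^^ i) x)) \<noteq> 0" using e'(1)[OF LF, of i] by auto
          then have "(i, l) \<notin> clash v (word x)" using True i l(1) by (auto simp: c_def split: if_splits)
          moreover have "v (i, l) = Some False"
          proof -
            have "word (y v) (i, l) = Some False" using l i by (simp add: word_def)
            then show ?thesis using y(2)[OF v(1)] by simp
          qed
          ultimately have "word x (i, l) \<noteq> Some True" by (auto simp: clash_def)
          then have "(T ^^ i) x \<in> U l" using AU(1)[OF l(1)] l i by (auto simp: word_def split: if_splits)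
          then show ?thesis using True by (simp add: l_def)
        qed
        then have "\<forall>i<n. (T ^^ i) x \<in> (if c i = 0 then U (L ((T ^^ i) (y v))) else U (e (c i)))" by blast
        with x show ?thesis unfolding cell_def mem_Collect_eq fst_conv snd_conv by (rule conjI)
      qed
      ultimately show "x \<in> \<Union>(cell ` (S \<times> C))" using v(1) by blast
    qed (auto simp: cell_def)
  qed (use finS finC in auto)
  also have "\<dots> \<le> card S * card C"
    using card_image_le[of "S \<times> C" cell] finS finC by (simp add: card_cartesian_product)
  finally have "real (cover_number X (iterated_join X T \<U> n)) \<le> real (card S * card C)"
    by (simp only: of_nat_le_iff)
  also have "\<dots> \<le> card S * s"
    using mult_left_mono[OF sparse, of "card S"] by (simp add: C_def)
  finally have N: "real (cover_number X (iterated_join X T \<U> n)) \<le> card S * s" .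
  show thesis
  proof (rule that[of S])
    fix w assume "w \<in> S"
    then show "\<exists>x\<in>topspace X. \<forall>i<n. \<forall>l\<in>F. (w (i, l) = Some False \<longrightarrow> (T ^^ i) x \<in> A l) \<and>
       (w (i, l) = Some True \<longrightarrow> (T ^^ i) x \<notin> U l)"
    proof (intro bexI[of _ "y w"] allI ballI impI)
      fix i l assume "i < n" "l \<in> F"
      then have "word (y w) (i, l) = (if (T ^^ i) (y w) \<in> A l then Some False
          else if (T ^^ i) (y w) \<notin> U l then Some True else None)"
        by (simp add: word_def)
      then have "w (i, l) = (if (T ^^ i) (y w) \<in> A l then Some False
          else if (T ^^ i) (y w) \<notin> U l then Some True else None)"
        using y(2)[OF \<open>w \<in> S\<close>] by simp
      then show "(w (i, l) = Some False \<longrightarrow> (T ^^ i) (y w) \<in> A l) \<and>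
        (w (i, l) = Some True \<longrightarrow> (T ^^ i) (y w) \<notin> U l)" by auto
    qed (use y(1) in blast)
  next
    fix w v assume "w \<in> S" "v \<in> S" "w \<noteq> v"
    then show "\<delta> * n \<le> card (({..<n} \<times> F) \<inter> clash w v)"
      using S(2) unfolding sep_def I_def by blast
  qed (rule finS N)+
qed

text \<open>These are the independence sets of Kerr and Li for a pair of sets.\<close>

definition independent_times :: "'a set \<Rightarrow> 'a set \<Rightarrow> nat set \<Rightarrow> bool" where
  "independent_times A\<^sub>0 A\<^sub>1 J \<longleftrightarrow>
     (\<forall>\<sigma>. \<exists>x\<in>topspace X. \<forall>j\<in>J. (T ^^ j) x \<in> (if \<sigma> j then A\<^sub>1 else A\<^sub>0))"

text \<open>A subcover needs more than \<open>exp (b * n)\<close> elements while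
  \<open>card S * exp (b / 2 * n)\<close> suffice, so \<open>S\<close> is exponentially large and
  shatters exponentially many sets. Sets with at most a proportion \<open>c\<close> of the
  coordinates are too few to account for them; a pigeonhole over \<open>F\<close> in a larger one
  then singles out the pair.\<close>

lemma positive_entropy_independence:
  assumes "topological_entropy X T > 0"
  obtains A\<^sub>0 A\<^sub>1 and c :: real where "closedin X A\<^sub>0" "closedin X A\<^sub>1" "A\<^sub>0 \<inter> A\<^sub>1 = {}" "c > 0"
    "\<exists>\<^sub>F n in sequentially. \<exists>J\<subseteq>{..<n}. c * n \<le> card J \<and> independent_times A\<^sub>0 A\<^sub>1 J"
proof -
  obtain \<U> where \<U>: "open_cover X \<U>" "cover_entropy X T \<U> > 0"
    using assms unfolding topological_entropy_def less_SUP_iff by auto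
  then obtain b :: real where b: "b > 0" "ereal b < cover_entropy X T \<U>"
    using ereal_dense2[of 0 "cover_entropy X T \<U>"] by auto
  have freq: "\<exists>\<^sub>F n in sequentially. b < ln (real (cover_number X (iterated_join X T \<U> n))) / real n"
  proof (rule ccontr)
    assume "\<not> ?thesis"
    then have "\<forall>\<^sub>F n in sequentially. ereal (ln (real (cover_number X (iterated_join X T \<U> n))) / real n) \<le> ereal b"
      by (simp add: not_frequently not_less)
    then have "cover_entropy X T \<U> \<le> ereal b" unfolding cover_entropy_def by (rule Limsup_bounded)
    then show False using b(2) by simp
  qed
  obtain F :: "'a set" and A U where F: "finite F" "\<And>l. l \<in> F \<Longrightarrow> closedin X (A l)"
    "\<And>l. l \<in> F \<Longrightarrow> U l \<in> \<U>" "\<And>l. l \<in> F \<Longrightarrow> A l \<subseteq> U l" "topspace X \<subseteq> (\<Union>l\<in>F. A l)"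
    by (rule closed_shrinking[OF \<U>(1)]) (rule that; assumption)
  define K where "K = card F"
  \<comment> \<open>\<open>F\<close> can be empty only over the empty space, where the cover number
    is 0 and \<open>ln 0 = 0\<close> contradicts \<open>b > 0\<close>.\<close>
  have "F \<noteq> {}"
  proof
    assume "F = {}"
    then have "cover_number X (iterated_join X T \<U> n) \<le> card ({} :: 'a set set)" for n
      using F(5) by (intro cover_number_le) auto
    then have "cover_number X (iterated_join X T \<U> n) = 0" for n by simp
    then show False using freq b(1) by simp
  qed
  then have K: "K > 0" using F(1) by (simp add: K_def card_gt_0_iff)
  obtain \<delta>\<^sub>1 :: real where \<delta>\<^sub>1: "\<delta>\<^sub>1 > 0" "\<And>N :: nat set. finite N \<Longrightarrow>
       real (card {c \<in> N \<rightarrow>\<^sub>E {..K}. real (card {j\<in>N. c j \<noteq> 0}) \<le> \<delta>\<^sub>1 * card N}) \<le> exp (b / 2 * card N)"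
    by (rule card_sparse_functions[OF half_gt_zero[OF b(1)], of K]) (rule that; assumption)
  \<comment> \<open>Clashes are counted in \<open>{..<n} \<times> F\<close>, so
    \<open>\<delta>\<^sub>1 * n\<close> of them are a proportion \<open>\<delta>\<^sub>1 / K\<close>
    of the coordinates. The cap 1 keeps \<open>ln (4 / \<delta>)\<close> positive.\<close>
  define \<delta> where "\<delta> = min 1 (\<delta>\<^sub>1 / K)"
  have \<delta>: "0 < \<delta>" "\<delta> \<le> 1" "\<delta> * K \<le> \<delta>\<^sub>1"
  proof -
    have "\<delta> \<le> \<delta>\<^sub>1 / K" by (simp add: \<delta>_def)
    then show "\<delta> * K \<le> \<delta>\<^sub>1" using K by (simp add: pos_le_divide_eq)
  qed (use \<delta>\<^sub>1 K in \<open>auto simp: \<delta>_def\<close>)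
  \<comment> \<open>The solution of \<open>2 * (\<delta> / 4) powr \<alpha> = 1\<close>, the extreme
    case of what \<open>card_shattered_ge\<close> allows.\<close>
  define \<alpha> where "\<alpha> = ln 2 / ln (4 / \<delta>)"
  have ln\<delta>: "ln (4 / \<delta>) > 0" using \<delta> by simp
  have \<alpha>: "\<alpha> > 0" using ln\<delta> by (simp add: \<alpha>_def)
  have "(\<delta> / 4) powr \<alpha> = exp (- (\<alpha> * ln (4 / \<delta>)))" using \<delta> by (simp add: powr_def ln_div algebra_simps)
  also have "\<alpha> * ln (4 / \<delta>) = ln 2" using ln\<delta> by (simp add: \<alpha>_def)
  finally have \<alpha>2: "1 \<le> 2 * (\<delta> / 4) powr \<alpha>" by (simp add: exp_minus)
  \<comment> \<open>Then \<open>\<eta> * card I\<close> is \<open>\<alpha> * b / 4 * n\<close>, half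
    of the exponent that the number of shattered sets reaches.\<close>
  define \<eta> where "\<eta> = \<alpha> * b / (4 * K)"
  have "\<eta> > 0" using \<alpha> b K by (simp add: \<eta>_def)
  \<comment> \<open>Functions with values 0 and 1 stand for subsets, so the case
    \<open>Q = 1\<close> bounds the number of small subsets.\<close>
  obtain c :: real where c: "c > 0" "\<And>N :: (nat \<times> 'a) set. finite N \<Longrightarrow>
       real (card {f \<in> N \<rightarrow>\<^sub>E {..1::nat}. real (card {j\<in>N. f j \<noteq> 0}) \<le> c * card N}) \<le> exp (\<eta> * card N)"
    by (rule card_sparse_functions[OF \<open>\<eta> > 0\<close>, of 1]) (rule that; assumption)
  have "\<exists>\<^sub>F n in sequentially. \<exists>l\<in>F. \<exists>J\<subseteq>{..<n}. c * n \<le> card J \<and> independent_times (A l) (topspace X - U l) J"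
    using frequently_eventually_frequently[OF freq eventually_gt_at_top[of 0]]
  proof (rule frequently_elim1)
    fix n assume "b < ln (real (cover_number X (iterated_join X T \<U> n))) / real n \<and> 0 < n"
    then have n: "n > 0" and lnN: "b * n < ln (real (cover_number X (iterated_join X T \<U> n)))"
      by (auto simp: pos_less_divide_eq)
    define N where "N = cover_number X (iterated_join X T \<U> n)"
    have "b * n > 0" using b(1) n by simp
    then have "N \<noteq> 0" using lnN unfolding N_def by (intro notI) simp
    moreover have "exp (b * n) < exp (ln (real N))" using lnN unfolding N_def by (rule exp_less_mono)
    ultimately have N: "exp (b * n) < N" by simp
    define I where "I = {..<n} \<times> F"
    have I: "finite I" "card I = n * K" "I \<noteq> {}" using F(1) \<open>F \<noteq> {}\<close> n by (auto simp: I_def K_def)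
    have sparse: "real (card {c \<in> {..<n} \<rightarrow>\<^sub>E {..card F}. real (card {j\<in>{..<n}. c j \<noteq> 0}) \<le> \<delta>\<^sub>1 * n})
        \<le> exp (b / 2 * n)"
      using \<delta>\<^sub>1(2)[of "{..<n}"] by (simp add: K_def)
    obtain S where S_raw: "finite S"
      "\<And>w v. w \<in> S \<Longrightarrow> v \<in> S \<Longrightarrow> w \<noteq> v \<Longrightarrow> \<delta>\<^sub>1 * n \<le> card (({..<n} \<times> F) \<inter> clash w v)"
      "\<And>w. w \<in> S \<Longrightarrow> \<exists>x\<in>topspace X. \<forall>i<n. \<forall>l\<in>F. (w (i, l) = Some False \<longrightarrow> (T ^^ i) x \<in> A l) \<and>
         (w (i, l) = Some True \<longrightarrow> (T ^^ i) x \<notin> U l)"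
      "real (cover_number X (iterated_join X T \<U> n)) \<le> card S * exp (b / 2 * n)"
      by (rule positive_entropy_shatters[OF F(1,4,5,3) n \<delta>\<^sub>1(1) sparse])
        (assumption+, (rule that; assumption))
    note S = S_raw[folded N_def I_def]
    have "exp (b / 2 * n) * exp (b / 2 * n) < card S * exp (b / 2 * n)"
      using N S(4) by (simp add: exp_add[symmetric])
    then have cardS: "exp (b / 2 * n) < card S" by simp
    have "S \<noteq> {}" using cardS by (auto simp: not_less[symmetric])
    have "exp (\<alpha> * (b / 2 * n)) = exp (b / 2 * n) powr \<alpha>" by (simp add: powr_def)
    also have "\<dots> \<le> card S powr \<alpha>" using cardS \<alpha> by (intro powr_mono2) auto
    also have "\<dots> \<le> card {J. J \<subseteq> I \<and> shatters S J}"
    proof (rule card_shattered_ge[OF I(1,3) \<delta>(1) _ \<alpha>2 S(1) \<open>S \<noteq> {}\<close>])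
      fix w v assume wv: "w \<in> S" "v \<in> S" "w \<noteq> v"
      have "\<delta> * card I = \<delta> * K * n" by (simp add: I(2))
      also have "\<dots> \<le> \<delta>\<^sub>1 * n" by (intro mult_right_mono \<delta>) simp
      also have "\<dots> \<le> card (I \<inter> clash w v)" by (rule S(2)[OF wv])
      finally show "\<delta> * card I \<le> card (I \<inter> clash w v)" .
    qed (use \<alpha> in simp)
    finally have shat: "exp (\<alpha> * (b / 2 * n)) \<le> card {J. J \<subseteq> I \<and> shatters S J}" .
    have "\<exists>J\<subseteq>I. shatters S J \<and> c * card I < card J"
    proof (rule ccontr)
      assume "\<not> ?thesis"
      then have small: "card J \<le> c * card I" if "J \<subseteq> I" "shatters S J" for J
        using that not_less by blast
      define ind where "ind J = restrict (\<lambda>j. if j \<in> J then 1 else 0 :: nat) I" for J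
      define C where "C = {f \<in> I \<rightarrow>\<^sub>E {..1::nat}. real (card {j\<in>I. f j \<noteq> 0}) \<le> c * card I}"
      have "inj_on ind {J. J \<subseteq> I \<and> shatters S J}"
      proof (rule inj_onI)
        fix J J' assume "J \<in> {J. J \<subseteq> I \<and> shatters S J}" "J' \<in> {J. J \<subseteq> I \<and> shatters S J}" "ind J = ind J'"
        moreover have "j \<in> J \<longleftrightarrow> j \<in> J'" if "j \<in> I" for j
        proof -
          have "ind J j = ind J' j" using \<open>ind J = ind J'\<close> by simp
          then show ?thesis using that by (simp add: ind_def split: if_splits)
        qed
        ultimately show "J = J'" by blast
      qed
      moreover have "ind ` {J. J \<subseteq> I \<and> shatters S J} \<subseteq> C"
      proof -
        have "{j\<in>I. ind J j \<noteq> 0} = J" if "J \<subseteq> I" for J using that by (auto simp: ind_def)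
        then show ?thesis using small by (auto simp: C_def) (auto simp: ind_def)
      qed
      moreover have "finite C" unfolding C_def using I(1) finite_PiE[of I "\<lambda>_. {..1::nat}"] by simp
      ultimately have "card {J. J \<subseteq> I \<and> shatters S J} \<le> card C" by (rule card_inj_on_le)
      also have "real (card C) \<le> exp (\<eta> * card I)" unfolding C_def by (rule c(2)[OF I(1)])
      also have "\<eta> * card I = \<alpha> * (b / 4 * n)" using K by (simp add: \<eta>_def I(2))
      finally have "exp (\<alpha> * (b / 2 * n)) \<le> exp (\<alpha> * (b / 4 * n))" using shat by linarith
      then have "b / 2 * n \<le> b / 4 * n" using \<alpha> by simp
      then show False using b n by simp
    qed
    then obtain J where J: "J \<subseteq> I" "shatters S J" "c * (n * K) < card J" by (auto simp: I(2))
    have finJ: "finite J" using J(1) I(1) by (rule finite_subset)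
    define Jl where "Jl l = {i. (i, l) \<in> J}" for l
    have "\<exists>l\<in>F. c * n \<le> card (Jl l)"
    proof (rule ccontr)
      assume "\<not> ?thesis"
      then have "(\<Sum>l\<in>F. real (card (Jl l))) \<le> (\<Sum>l\<in>F. c * n)" by (intro sum_mono) auto
      moreover have "card J = (\<Sum>l\<in>F. card (Jl l))"
      proof -
        have "J = (\<Union>l\<in>F. (\<lambda>i. (i, l)) ` Jl l)" using J(1) by (auto simp: Jl_def I_def)
        moreover have "card (\<Union>l\<in>F. (\<lambda>i. (i, l)) ` Jl l) = (\<Sum>l\<in>F. card ((\<lambda>i. (i, l)) ` Jl l))"
        proof (rule card_UN_disjoint[OF F(1)])
          have "finite (Jl l)" for l
            using finite_imageI[OF finJ, of fst] by (rule finite_subset[rotated]) (force simp: Jl_def)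
          then show "\<forall>l\<in>F. finite ((\<lambda>i. (i, l)) ` Jl l)" by blast
        qed auto
        moreover have "card ((\<lambda>i. (i, l)) ` Jl l) = card (Jl l)" for l by (intro card_image inj_onI) auto
        ultimately show ?thesis by simp
      qed
      ultimately have "real (card J) \<le> K * (c * n)" by (simp add: K_def)
      then show False using J(3) by (simp add: algebra_simps)
    qed
    then obtain l where l: "l \<in> F" "c * n \<le> card (Jl l)" by blast
    have "independent_times (A l) (topspace X - U l) (Jl l)"
      unfolding independent_times_def
    proof
      fix \<sigma> :: "nat \<Rightarrow> bool"
      obtain w where w: "w \<in> S" "\<forall>j\<in>J. w j = Some ((\<sigma> \<circ> fst) j)" using J(2) unfolding shatters_def by blast
      obtain x where x: "x \<in> topspace X" "\<forall>i<n. \<forall>l\<in>F. (w (i, l) = Some False \<longrightarrow> (T ^^ i) x \<in> A l) \<and>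
         (w (i, l) = Some True \<longrightarrow> (T ^^ i) x \<notin> U l)" using S(3)[OF w(1)] by blast
      have "(T ^^ i) x \<in> (if \<sigma> i then topspace X - U l else A l)" if "i \<in> Jl l" for i
      proof -
        have "w (i, l) = Some (\<sigma> i)" "i < n" using that w(2) J(1) by (force simp: Jl_def I_def)+
        then show ?thesis using x l(1) funpow_in[OF x(1), of i] by (cases "\<sigma> i") auto
      qed
      then show "\<exists>x\<in>topspace X. \<forall>j\<in>Jl l. (T ^^ j) x \<in> (if \<sigma> j then topspace X - U l else A l)"
        using x(1) by blast
    qed
    moreover have "Jl l \<subseteq> {..<n}" using J(1) by (auto simp: Jl_def I_def)
    ultimately show "\<exists>l\<in>F. \<exists>J\<subseteq>{..<n}. c * n \<le> card J \<and> independent_times (A l) (topspace X - U l) J"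
      using l by blast
  qed
  \<comment> \<open>The index \<open>l\<close> depends on \<open>n\<close>, but as \<open>F\<close>
    is finite, one of them serves infinitely many \<open>n\<close>.\<close>
  then obtain l where l: "l \<in> F"
    "\<exists>\<^sub>F n in sequentially. \<exists>J\<subseteq>{..<n}. c * n \<le> card J \<and> independent_times (A l) (topspace X - U l) J"
    using F(1) by (auto simp: frequently_bex_finite_distrib)
  have "U l \<in> \<U>" using F(3) l by blast
  then have "closedin X (topspace X - U l)" using \<U>(1) by (auto simp: open_cover_def)
  then show thesis using l F(2,4)[OF l(1)] c(1) by (intro that[of "A l" "topspace X - U l" c]) auto
qed

end


section \<open>Cubes of measures\<close>

definition cube_pmf :: "'b set \<Rightarrow> 'i set \<Rightarrow> ('i \<Rightarrow> real) \<Rightarrow> ('b \<times> ('i \<Rightarrow> bool)) pmf" where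
  "cube_pmf A I t = pair_pmf (pmf_of_set A) (Pi_pmf I False (\<lambda>i. bernoulli_pmf (t i)))"

text \<open>Label and coin are independent. Only the coins that belong to the drawn label will be
  read, so each coordinate of \<open>t\<close> has an event of its own, whose probability is linear
  in that coordinate.\<close>

lemma expectation_cube_pmf_coordinate:
  assumes "finite A" "a \<in> A" "finite I" "i \<in> I" "t i \<in> {0..1}"
  shows "measure_pmf.expectation (cube_pmf A I t) (\<lambda>p. of_bool (fst p = a \<and> snd p i)) = t i / card A"
proof -
  define proj where "proj = (\<lambda>(x :: 'a, \<beta> :: 'b \<Rightarrow> bool). (x, \<beta> i))"
  have "map_pmf proj (cube_pmf A I t) = pair_pmf (pmf_of_set A) (bernoulli_pmf (t i))"
    using map_pair[of "\<lambda>x. x" "\<lambda>\<beta>. \<beta> i" "pmf_of_set A" "Pi_pmf I False (\<lambda>i. bernoulli_pmf (t i))"] assms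
    by (simp add: cube_pmf_def proj_def Pi_pmf_component map_pmf_ident)
  moreover have "pmf (pmf_of_set A) a = 1 / card A" using assms by (subst pmf_of_set) auto
  ultimately have "pmf (map_pmf proj (cube_pmf A I t)) (a, True) = t i / card A"
    using assms by (simp add: pmf_pair)
  then have "measure_pmf.prob (cube_pmf A I t) (proj -` {(a, True)}) = t i / card A"
    by (simp add: pmf_map)
  moreover have "measure_pmf.expectation (cube_pmf A I t) (\<lambda>p. of_bool (fst p = a \<and> snd p i))
      = measure_pmf.expectation (cube_pmf A I t) (indicat_real (proj -` {(a, True)}))"
    by (intro Bochner_Integration.integral_cong) (auto simp: proj_def indicator_def)
  moreover have "measure_pmf.expectation (cube_pmf A I t) (indicat_real (proj -` {(a, True)}))
      = measure_pmf.prob (cube_pmf A I t) (proj -` {(a, True)})"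
    by (subst Bochner_Integration.integral_indicator) auto
  ultimately show ?thesis by (simp only:)
qed

text \<open>The expectation is a finite sum in which \<open>t\<close> enters through products of
  factors in \<open>[0, 1]\<close>, and such a product changes by at most the sum of the changes of
  its factors. The constant is exponential in \<open>card I\<close>, which does no harm: continuity
  in \<open>t\<close> is used for one \<open>n\<close> at a time, as input to
  Poincare-Miranda.\<close>

lemma expectation_cube_pmf_Lipschitz:
  fixes h :: "'b \<times> ('i \<Rightarrow> bool) \<Rightarrow> real" and B \<tau> :: real
  assumes A: "finite A" "A \<noteq> {}" and I: "finite I"
    and t: "\<forall>i\<in>I. t i \<in> {0..1}" and t': "\<forall>i\<in>I. t' i \<in> {0..1}"
    and close: "\<forall>i\<in>I. \<bar>t i - t' i\<bar> \<le> \<tau>" and h: "\<And>p. \<bar>h p\<bar> \<le> B"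
  shows "\<bar>measure_pmf.expectation (cube_pmf A I t) h - measure_pmf.expectation (cube_pmf A I t') h\<bar>
    \<le> B * (2 ^ card I * (card I * \<tau>))"
proof -
  define \<B> where "\<B> = PiE_dflt I False (\<lambda>_. UNIV :: bool set)"
  have \<B>: "finite \<B>" "card \<B> = 2 ^ card I"
    unfolding \<B>_def using I by (auto simp: card_PiE_dflt)
  define wt where "wt t \<beta> i = (if \<beta> i then t i else 1 - t i)" for t :: "'i \<Rightarrow> real" and \<beta> i
  have E: "measure_pmf.expectation (cube_pmf A I t) h
      = (\<Sum>p\<in>A\<times>\<B>. h p * (1 / card A * (\<Prod>i\<in>I. wt t (snd p) i)))"
    if t: "\<forall>i\<in>I. t i \<in> {0..1}" for t
  proof -
    have "measure_pmf.expectation (cube_pmf A I t) h = (\<Sum>p\<in>A\<times>\<B>. h p * pmf (cube_pmf A I t) p)"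
    proof (rule integral_measure_pmf_real)
      fix p assume "p \<in> set_pmf (cube_pmf A I t)"
      then show "p \<in> A \<times> \<B>" using A I set_Pi_pmf_subset'[OF I, of False "\<lambda>i. bernoulli_pmf (t i)"]
        by (auto simp: cube_pmf_def \<B>_def PiE_dflt_def)
    qed (use A \<B> in auto)
    also have "\<dots> = (\<Sum>p\<in>A\<times>\<B>. h p * (1 / card A * (\<Prod>i\<in>I. wt t (snd p) i)))"
    proof (intro sum.cong refl arg_cong[of _ _ "(*) _"])
      fix p assume "p \<in> A \<times> \<B>"
      then obtain a \<beta> where p: "p = (a, \<beta>)" "a \<in> A" "\<beta> \<in> \<B>" by auto
      have "pmf (Pi_pmf I False (\<lambda>i. bernoulli_pmf (t i))) \<beta> = (\<Prod>i\<in>I. pmf (bernoulli_pmf (t i)) (\<beta> i))"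
        using p(3) I by (subst pmf_Pi) (auto simp: \<B>_def PiE_dflt_def)
      also have "\<dots> = (\<Prod>i\<in>I. wt t \<beta> i)"
        using t by (intro prod.cong refl) (auto simp: wt_def)
      finally show "pmf (cube_pmf A I t) p = 1 / card A * (\<Prod>i\<in>I. wt t (snd p) i)"
        using A p by (simp add: cube_pmf_def pmf_pair pmf_of_set)
    qed
    finally show ?thesis .
  qed
  have B: "B \<ge> 0" using h[of undefined] by linarith
  have "\<bar>measure_pmf.expectation (cube_pmf A I t) h - measure_pmf.expectation (cube_pmf A I t') h\<bar>
      = \<bar>\<Sum>p\<in>A\<times>\<B>. h p * (1 / card A * ((\<Prod>i\<in>I. wt t (snd p) i) - (\<Prod>i\<in>I. wt t' (snd p) i)))\<bar>"
    unfolding E[OF t] E[OF t'] by (simp add: sum_subtractf[symmetric] right_diff_distrib)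
  also have "\<dots> \<le> (\<Sum>p\<in>A\<times>\<B>. B * (1 / card A * (card I * \<tau>)))"
  proof (intro order.trans[OF sum_abs] sum_mono)
    fix p :: "'b \<times> ('i \<Rightarrow> bool)"
    have "\<bar>(\<Prod>i\<in>I. wt t (snd p) i) - (\<Prod>i\<in>I. wt t' (snd p) i)\<bar> \<le> (\<Sum>i\<in>I. \<bar>wt t (snd p) i - wt t' (snd p) i\<bar>)"
      using norm_prod_diff[of I "wt t (snd p)" "wt t' (snd p)"] t t' by (auto simp: wt_def)
    also have "\<dots> \<le> (\<Sum>i\<in>I. \<tau>)" using close by (intro sum_mono) (auto simp: wt_def abs_minus_commute)
    finally have "\<bar>(\<Prod>i\<in>I. wt t (snd p) i) - (\<Prod>i\<in>I. wt t' (snd p) i)\<bar> \<le> card I * \<tau>" by simp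
    then show "\<bar>h p * (1 / card A * ((\<Prod>i\<in>I. wt t (snd p) i) - (\<Prod>i\<in>I. wt t' (snd p) i)))\<bar>
        \<le> B * (1 / card A * (card I * \<tau>))"
      unfolding abs_mult using h B by (intro mult_mono) auto
  qed
  also have "\<dots> = B * (2 ^ card I * (card I * \<tau>))"
    using A by (simp add: card_cartesian_product \<B>(2))
  finally show ?thesis .
qed

context induced_system
begin

definition cube_measure :: "'b set \<Rightarrow> 'i set \<Rightarrow> ('b \<times> ('i \<Rightarrow> bool) \<Rightarrow> 'a) \<Rightarrow> ('i \<Rightarrow> real) \<Rightarrow> 'a measure" where
  "cube_measure A I y t = distr (measure_pmf (cube_pmf A I t)) (borel_of X) y"

lemma cube_measure_prob_measures:
  "(\<And>p. y p \<in> topspace X) \<Longrightarrow> cube_measure A I y t \<in> prob_measures X"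
  unfolding cube_measure_def by (intro distr_prob_measures) (auto intro: measure_pmf.prob_space_axioms)

lemma integral_cube_measure:
  assumes "\<And>p. y p \<in> topspace X" "continuous_map X euclideanreal f"
  shows "(\<integral>x. f x \<partial>(push_forward X T ^^ i) (cube_measure A I y t))
    = measure_pmf.expectation (cube_pmf A I t) (\<lambda>p. f ((T ^^ i) (y p)))"
proof -
  have "(\<lambda>x. f ((T ^^ i) x)) \<in> borel_measurable (borel_of X)"
    by (intro borel_measurable_continuous_map compose_funpow_continuous assms)
  then have "(\<integral>x. f ((T ^^ i) x) \<partial>cube_measure A I y t)
      = measure_pmf.expectation (cube_pmf A I t) (\<lambda>p. f ((T ^^ i) (y p)))"
    unfolding cube_measure_def using assms(1) by (subst integral_distr) auto
  then show ?thesis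
    using integral_funpow_push_forward[OF cube_measure_prob_measures[of y, OF assms(1)] assms(2)] by simp
qed

text \<open>One \<open>\<tau>\<close> serves all times, because \<open>f\<close> composed with any
  iterate has the same bound \<open>B\<close>.\<close>

lemma cube_measure_uniformly_continuous:
  assumes A: "finite A" "A \<noteq> {}" and I: "finite I" and y: "\<And>p. y p \<in> topspace X" and "e > 0"
  obtains \<tau> where "\<tau> > 0"
    "\<And>t t' i. \<forall>j\<in>I. t j \<in> {0..1} \<Longrightarrow> \<forall>j\<in>I. t' j \<in> {0..1} \<Longrightarrow> \<forall>j\<in>I. \<bar>t j - t' j\<bar> \<le> \<tau> \<Longrightarrow>
       D ((push_forward X T ^^ i) (cube_measure A I y t)) ((push_forward X T ^^ i) (cube_measure A I y t')) < e"
proof -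
  obtain \<Phi> \<gamma> where \<Phi>: "finite \<Phi>" "\<gamma> > 0" "\<And>f. f \<in> \<Phi> \<Longrightarrow> continuous_map X euclideanreal f"
    "\<And>\<mu> \<nu>. \<mu> \<in> prob_measures X \<Longrightarrow> \<nu> \<in> prob_measures X \<Longrightarrow>
       (\<forall>f\<in>\<Phi>. \<bar>(\<integral>x. f x \<partial>\<mu>) - (\<integral>x. f x \<partial>\<nu>)\<bar> < \<gamma>) \<Longrightarrow> D \<mu> \<nu> < e"
    using dist_small_if_integrals_close[OF \<open>e > 0\<close>] by metis
  obtain B where B: "B > 0" "\<And>f x. f \<in> \<Phi> \<Longrightarrow> x \<in> topspace X \<Longrightarrow> \<bar>f x\<bar> \<le> B"
    using uniform_bound[of \<Phi>] \<Phi> by metis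
  \<comment> \<open>The summand 1 makes the bound strict and keeps \<open>\<kappa>\<close> positive
    when \<open>I\<close> is empty.\<close>
  define \<kappa> where "\<kappa> = B * (2 ^ card I * (real (card I) + 1))"
  define \<tau> where "\<tau> = \<gamma> / \<kappa>"
  have \<kappa>: "\<kappa> > 0" unfolding \<kappa>_def by (intro mult_pos_pos B(1)) auto
  then have \<tau>: "\<tau> > 0" "\<kappa> * \<tau> = \<gamma>" using \<Phi>(2) by (simp_all add: \<tau>_def)
  have "B * (2 ^ card I * (card I * \<tau>)) < B * (2 ^ card I * ((real (card I) + 1) * \<tau>))"
    using B(1) \<tau>(1) by simp
  also have "\<dots> = \<kappa> * \<tau>" by (simp only: \<kappa>_def mult.assoc)
  finally have small: "B * (2 ^ card I * (card I * \<tau>)) < \<gamma>" using \<tau>(2) by simp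
  show thesis
  proof (rule that[OF \<tau>(1)])
    fix t t' :: "'c \<Rightarrow> real" and i
    assume t: "\<forall>j\<in>I. t j \<in> {0..1}" "\<forall>j\<in>I. t' j \<in> {0..1}" "\<forall>j\<in>I. \<bar>t j - t' j\<bar> \<le> \<tau>"
    show "D ((push_forward X T ^^ i) (cube_measure A I y t)) ((push_forward X T ^^ i) (cube_measure A I y t')) < e"
    proof (intro \<Phi>(4) funpow_push_forward_prob_measures cube_measure_prob_measures y ballI)
      fix f assume f: "f \<in> \<Phi>"
      have "\<bar>f ((T ^^ i) (y p))\<bar> \<le> B" for p by (intro B f funpow_in y)
      from expectation_cube_pmf_Lipschitz[where h = "\<lambda>p. f ((T ^^ i) (y p))", OF A I t this]
      show "\<bar>(\<integral>x. f x \<partial>(push_forward X T ^^ i) (cube_measure A I y t))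
          - (\<integral>x. f x \<partial>(push_forward X T ^^ i) (cube_measure A I y t'))\<bar> < \<gamma>"
        unfolding integral_cube_measure[OF y \<Phi>(3)[OF f]] using small by linarith
    qed
  qed
qed

section \<open>Separated sets obtained from a cube of measures\<close>

definition dist_to :: "'a measure set \<Rightarrow> 'a measure \<Rightarrow> real" where
  "dist_to Z \<mu> = (INF \<nu>\<in>Z. D \<mu> \<nu>)"

lemma dist_to_bdd_below: "bdd_below ((\<lambda>\<nu>. D \<mu> \<nu>) ` Z)"
  by (rule bdd_belowI2[of _ 0]) simp

lemma dist_to_le: "\<nu> \<in> Z \<Longrightarrow> dist_to Z \<mu> \<le> D \<mu> \<nu>"
  unfolding dist_to_def by (rule cINF_lower[OF dist_to_bdd_below])

lemma dist_to_Lipschitz: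
  assumes "Z \<noteq> {}" "Z \<subseteq> prob_measures X" "\<mu> \<in> prob_measures X" "\<nu> \<in> prob_measures X"
  shows "\<bar>dist_to Z \<mu> - dist_to Z \<nu>\<bar> \<le> D \<mu> \<nu>"
proof -
  have *: "dist_to Z \<mu> - D \<mu> \<nu> \<le> dist_to Z \<nu>"
    if "\<mu> \<in> prob_measures X" "\<nu> \<in> prob_measures X" for \<mu> \<nu>
    unfolding dist_to_def[of Z \<nu>]
  proof (rule cINF_greatest[OF assms(1)])
    fix \<rho> assume "\<rho> \<in> Z"
    then show "dist_to Z \<mu> - D \<mu> \<nu> \<le> D \<nu> \<rho>"
      using dist_to_le[of \<rho> Z \<mu>] triangle[of \<mu> \<nu> \<rho>] that assms(2) by auto
  qed
  show ?thesis using *[OF assms(3,4)] *[OF assms(4,3)] commute[of \<mu> \<nu>] by linarith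
qed

text \<open>The distances to the sets \<open>Z i\<close> are \<open>1\<close>-Lipschitz functions which, by Poincare--Miranda, carry
  the cube onto a cube of side \<open>\<delta>\<close>; a grid in the latter lifts to a separated set.\<close>

lemma sep_number_cube:
  fixes \<mu> :: "('i \<Rightarrow> real) \<Rightarrow> 'a measure"
  assumes I: "finite I" and n: "n > 0" and \<epsilon>: "\<epsilon> > 0" "2 * \<epsilon> \<le> \<delta>"
    and \<mu>: "\<And>t. \<mu> t \<in> prob_measures X"
    and time: "\<And>i. i \<in> I \<Longrightarrow> \<theta> i < n"
    and uc: "\<And>e. e > 0 \<Longrightarrow> \<exists>\<tau>>0. \<forall>t t'. (\<forall>j\<in>I. t j \<in> {0..1}) \<longrightarrow> (\<forall>j\<in>I. t' j \<in> {0..1}) \<longrightarrow>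
       (\<forall>j\<in>I. \<bar>t j - t' j\<bar> \<le> \<tau>) \<longrightarrow>
       (\<forall>i. D ((push_forward X T ^^ i) (\<mu> t)) ((push_forward X T ^^ i) (\<mu> t')) < e)"
    and Z: "\<And>i. i \<in> I \<Longrightarrow> Z i \<subseteq> prob_measures X"
    and lo: "\<And>i t. i \<in> I \<Longrightarrow> \<forall>j\<in>I. t j \<in> {0..1} \<Longrightarrow> t i = 0 \<Longrightarrow> (push_forward X T ^^ \<theta> i) (\<mu> t) \<in> Z i"
    and hi: "\<And>i t \<nu>. i \<in> I \<Longrightarrow> \<forall>j\<in>I. t j \<in> {0..1} \<Longrightarrow> t i = 1 \<Longrightarrow> \<nu> \<in> Z i \<Longrightarrow>
       \<delta> \<le> D ((push_forward X T ^^ \<theta> i) (\<mu> t)) \<nu>"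
  shows "(\<delta> / (2 * \<epsilon>)) ^ card I \<le> sep_number (prob_measures X) D (push_forward X T) n \<epsilon>"
proof -
  define g where "g i t = dist_to (Z i) ((push_forward X T ^^ \<theta> i) (\<mu> t))" for i t
  have P: "(push_forward X T ^^ i) (\<mu> t) \<in> prob_measures X" for i t
    by (intro funpow_push_forward_prob_measures \<mu>)
  have Zne: "Z i \<noteq> {}" if "i \<in> I" for i using lo[OF that, of "\<lambda>_. 0"] by auto
  have g_lip: "\<bar>g i t - g i t'\<bar> \<le> D ((push_forward X T ^^ \<theta> i) (\<mu> t)) ((push_forward X T ^^ \<theta> i) (\<mu> t'))"
    if "i \<in> I" for i t t'
    unfolding g_def by (intro dist_to_Lipschitz Zne Z P that)
  \<comment> \<open>This is the number of multiples of \<open>2 * \<epsilon>\<close> in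
    \<open>[0, \<delta>)\<close>; the largest, \<open>2 * \<epsilon> * (r - 1)\<close>, stays
    strictly below \<open>\<delta>\<close>, as Poincare-Miranda demands of a target.\<close>
  define r where "r = nat \<lceil>\<delta> / (2 * \<epsilon>)\<rceil>"
  have "\<delta> / (2 * \<epsilon>) > 0" using \<epsilon> by auto
  then have r: "\<delta> / (2 * \<epsilon>) \<le> r" "r - 1 < \<delta> / (2 * \<epsilon>)" unfolding r_def by linarith+
  have grid: "\<exists>t. (\<forall>j\<in>I. t j \<in> {0..1}) \<and> (\<forall>i\<in>I. \<bar>g i t - 2 * \<epsilon> * s i\<bar> < \<epsilon> / 2)"
    if s: "s \<in> I \<rightarrow>\<^sub>E {..<r}" for s :: "'i \<Rightarrow> nat"
  proof (rule poincare_miranda_approx[OF I, of g \<delta> "\<lambda>i. 2 * \<epsilon> * s i" "\<epsilon> / 2"])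
    fix t i assume t: "\<forall>j\<in>I. t j \<in> {0..1::real}" "i \<in> I" "t i = 0"
    then show "g i t \<le> 0" unfolding g_def
      using dist_to_le[OF lo[of i t, OF t(2,1,3)], of "(push_forward X T ^^ \<theta> i) (\<mu> t)"] P by simp
  next
    fix t i assume t: "\<forall>j\<in>I. t j \<in> {0..1::real}" "i \<in> I" "t i = 1"
    then show "\<delta> \<le> g i t" unfolding g_def dist_to_def using hi[of i t, OF t(2,1,3)] Zne t(2) by (intro cINF_greatest) auto
  next
    fix e :: real assume "e > 0"
    from uc[OF this] obtain \<tau> where \<tau>: "\<tau> > 0" "\<forall>t t'. (\<forall>j\<in>I. t j \<in> {0..1}) \<longrightarrow> (\<forall>j\<in>I. t' j \<in> {0..1}) \<longrightarrow>
       (\<forall>j\<in>I. \<bar>t j - t' j\<bar> \<le> \<tau>) \<longrightarrow>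
       (\<forall>i. D ((push_forward X T ^^ i) (\<mu> t)) ((push_forward X T ^^ i) (\<mu> t')) < e)" by blast
    show "\<exists>\<tau>>0. \<forall>t t'. (\<forall>j\<in>I. t j \<in> {0..1}) \<longrightarrow> (\<forall>j\<in>I. t' j \<in> {0..1}) \<longrightarrow>
               (\<forall>j\<in>I. \<bar>t j - t' j\<bar> \<le> \<tau>) \<longrightarrow> (\<forall>i\<in>I. \<bar>g i t - g i t'\<bar> < e)"
    proof (intro exI[of _ \<tau>] conjI \<tau>(1) allI impI ballI)
      fix t t' :: "'i \<Rightarrow> real" and i
      assume "\<forall>j\<in>I. t j \<in> {0..1}" "\<forall>j\<in>I. t' j \<in> {0..1}" "\<forall>j\<in>I. \<bar>t j - t' j\<bar> \<le> \<tau>" and i: "i \<in> I"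
      then have "D ((push_forward X T ^^ \<theta> i) (\<mu> t)) ((push_forward X T ^^ \<theta> i) (\<mu> t')) < e"
        using \<tau>(2) by blast
      with g_lip[OF i] show "\<bar>g i t - g i t'\<bar> < e" by (rule le_less_trans)
    qed
  next
    fix i assume "i \<in> I"
    then have "s i < r" using s by auto
    then have "real (s i) \<le> real (r - 1)" by simp
    then have "s i < \<delta> / (2 * \<epsilon>)" using r(2) \<open>s i < r\<close> by linarith
    then show "0 \<le> 2 * \<epsilon> * s i \<and> 2 * \<epsilon> * s i < \<delta>" using \<epsilon>(1) by (simp add: pos_less_divide_eq mult.commute)
  qed (use \<epsilon> in auto)
  define pt where "pt s = (SOME t. (\<forall>j\<in>I. t j \<in> {0..1}) \<and> (\<forall>i\<in>I. \<bar>g i t - 2 * \<epsilon> * s i\<bar> < \<epsilon> / 2))"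
    for s :: "'i \<Rightarrow> nat"
  have pt: "\<bar>g i (pt s) - 2 * \<epsilon> * s i\<bar> < \<epsilon> / 2" if "s \<in> I \<rightarrow>\<^sub>E {..<r}" "i \<in> I" for s i
    using someI_ex[OF grid[OF that(1)]] that(2) unfolding pt_def by blast
  have sep: "bowen_dist D (push_forward X T) n (\<mu> (pt s)) (\<mu> (pt s')) > \<epsilon>"
    if s: "s \<in> I \<rightarrow>\<^sub>E {..<r}" "s' \<in> I \<rightarrow>\<^sub>E {..<r}" "s \<noteq> s'" for s s'
  proof -
    \<comment> \<open>Distinct grid points differ by at least \<open>2 * \<epsilon>\<close> in some
      coordinate, and the two approximations together cost less than \<epsilon>, so more than
      \<epsilon> remains.\<close>
    obtain i where i: "i \<in> I" "s i \<noteq> s' i" using s by (meson PiE_ext)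
    then have "1 \<le> \<bar>real (s i) - real (s' i)\<bar>" by linarith
    then have "2 * \<epsilon> * 1 \<le> 2 * \<epsilon> * \<bar>real (s i) - real (s' i)\<bar>" using \<epsilon>(1) by (intro mult_left_mono) auto
    also have "\<dots> = \<bar>2 * \<epsilon> * s i - 2 * \<epsilon> * s' i\<bar>" using \<epsilon>(1) by (simp add: abs_mult right_diff_distrib[symmetric])
    finally have "\<epsilon> < \<bar>g i (pt s) - g i (pt s')\<bar>"
      using pt[OF s(1) i(1)] pt[OF s(2) i(1)] by linarith
    also note g_lip[OF i(1)]
    finally show ?thesis unfolding bowen_dist_gr_iff[OF n] using time[OF i(1)] by blast
  qed
  define E where "E = (\<lambda>s. \<mu> (pt s)) ` (I \<rightarrow>\<^sub>E {..<r})"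
  have "inj_on (\<lambda>s. \<mu> (pt s)) (I \<rightarrow>\<^sub>E {..<r})"
  proof (rule inj_onI, rule ccontr)
    fix s s' assume "s \<in> I \<rightarrow>\<^sub>E {..<r}" "s' \<in> I \<rightarrow>\<^sub>E {..<r}" "\<mu> (pt s) = \<mu> (pt s')" "s \<noteq> s'"
    then have "\<exists>i<n. \<epsilon> < D ((push_forward X T ^^ i) (\<mu> (pt s))) ((push_forward X T ^^ i) (\<mu> (pt s)))"
      using sep[of s s'] bowen_dist_gr_iff[OF n] by metis
    then show False using \<epsilon>(1) P by auto
  qed
  then have "card E = r ^ card I" unfolding E_def using I by (simp add: card_image card_PiE)
  moreover have "separated (prob_measures X) D (push_forward X T) n \<epsilon> E"
    unfolding separated_def E_def using \<mu> sep I
    by (auto intro!: finite_PiE finite_imageI)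
  moreover obtain N where "\<And>E. separated (prob_measures X) D (push_forward X T) n \<epsilon> E \<Longrightarrow> card E \<le> N"
    using separated_card_bounded[OF n \<epsilon>(1)] by metis
  ultimately have "r ^ card I \<le> sep_number (prob_measures X) D (push_forward X T) n \<epsilon>"
    using sep_number_bounds(2) by metis
  then have "real r ^ card I \<le> sep_number (prob_measures X) D (push_forward X T) n \<epsilon>"
    by (metis of_nat_le_iff of_nat_power)
  moreover have "(\<delta> / (2 * \<epsilon>)) ^ card I \<le> real r ^ card I" using r(1) \<epsilon> by (intro power_mono) auto
  ultimately show ?thesis by linarith
qed

end


section \<open>Positive entropy\<close>

text \<open>A rich window contributes at most \<open>l\<close> elements, a poor one at most
  \<open>m\<close>; the last, possibly incomplete, window accounts for the
  \<open>+ 1\<close>.\<close>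

lemma card_le_rich_windows:
  fixes J :: "nat set"
  assumes J: "J \<subseteq> {..<n}" and l: "l > 0"
  shows "card J \<le> card {k\<in>{..n div l}. m \<le> card {p\<in>{..<l}. k * l + p \<in> J}} * l + (n div l + 1) * m"
proof -
  define W where "W k = {p\<in>{..<l}. k * l + p \<in> J}" for k
  define G where "G = {k\<in>{..n div l}. m \<le> card (W k)}"
  have "J \<subseteq> (\<Union>k\<le>n div l. (\<lambda>p. k * l + p) ` W k)"
  proof
    fix j assume j: "j \<in> J"
    then have "j < n" using J by auto
    then have "j div l \<le> n div l" by (simp add: div_le_mono)
    moreover have "j mod l \<in> W (j div l)" using j l by (simp add: W_def)
    moreover have "j = j div l * l + j mod l" by simp
    ultimately show "j \<in> (\<Union>k\<le>n div l. (\<lambda>p. k * l + p) ` W k)" by blast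
  qed
  then have "card J \<le> card (\<Union>k\<le>n div l. (\<lambda>p. k * l + p) ` W k)"
    by (intro card_mono) (auto simp: W_def)
  also have "\<dots> \<le> (\<Sum>k\<le>n div l. card ((\<lambda>p. k * l + p) ` W k))" by (rule card_UN_le) simp
  also have "\<dots> \<le> (\<Sum>k\<le>n div l. (if k \<in> G then l else 0) + m)"
  proof (rule sum_mono)
    fix k assume k: "k \<in> {..n div l}"
    have "card ((\<lambda>p. k * l + p) ` W k) \<le> card (W k)" by (rule card_image_le) (simp add: W_def)
    moreover have "card (W k) \<le> card {..<l}" by (rule card_mono) (auto simp: W_def)
    ultimately show "card ((\<lambda>p. k * l + p) ` W k) \<le> (if k \<in> G then l else 0) + m"
      using k by (auto simp: G_def)
  qed
  also have "\<dots> = card G * l + (n div l + 1) * m"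
    by (simp add: sum.distrib sum.If_cases G_def Int_def conj_commute)
  finally show ?thesis by (simp add: G_def W_def)
qed

text \<open>Any growth faster than linear would serve: \<open>2 ^ m - 1\<close> has to beat a
  multiple of the window length, which is linear in \<open>m\<close>.\<close>

lemma square_le_four_power_minus_one: "real m * real m \<le> 4 * (2 ^ m - 1)"
proof (induction m)
  case (Suc m)
  define a where "a = (2::real) ^ m"
  have "real m < a" "1 \<le> a" unfolding a_def by (rule of_nat_less_two_power, simp)
  moreover have "real m * real m \<le> 4 * (a - 1)" using Suc by (simp add: a_def)
  moreover have "s + 2 * x + 1 \<le> 4 * (2 * a - 1)" if "x < a" "1 \<le> a" "s \<le> 4 * (a - 1)" for s x :: real
    using that by argo
  ultimately have "real m * real m + 2 * real m + 1 \<le> 4 * (2 * a - 1)" by blast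
  then show ?case by (simp add: a_def algebra_simps)
qed simp

context induced_system
begin

text \<open>For \<open>f\<close> equal to 0 on one set and to 1 on another, a continuous substitute
  for the indicator that the orbit is in the second set exactly at the times of \<open>w\<close>
  among those in \<open>P\<close>. It is that indicator on orbits that are in one of the two sets at
  all times in \<open>P\<close>.\<close>

definition pattern_function :: "('a \<Rightarrow> real) \<Rightarrow> nat set \<Rightarrow> nat set \<Rightarrow> 'a \<Rightarrow> real" where
  "pattern_function f P w x = (\<Prod>p\<in>P. if p \<in> w then f ((T ^^ p) x) else 1 - f ((T ^^ p) x))"

lemma continuous_pattern_function:
  assumes "continuous_map X euclideanreal f" "finite P"
  shows "continuous_map X euclideanreal (pattern_function f P w)"
  unfolding pattern_function_def[abs_def]
  using compose_funpow_continuous[OF assms(1)] assms(2)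
  by (intro continuous_map_prod) (auto intro!: continuous_intros)

text \<open>The parameter \<open>t (k, a)\<close> is, up to the factor \<open>1 / M\<close>, the probability of seeing the \<open>a\<close>-th
  nonempty word in the \<open>k\<close>-th rich window: \<open>a\<close> is drawn uniformly, once for all windows, and then
  each window shows its \<open>a\<close>-th word with probability \<open>t (k, a)\<close> and the empty word otherwise. As a
  window has \<open>2 ^ m - 1\<close> nonempty words but a length linear in \<open>m\<close>, the dimension of the cube per
  unit of time is unbounded.\<close>

lemma independent_times_cube:
  fixes f :: "'a \<Rightarrow> real" and m :: nat
  defines "M \<equiv> 2 ^ m - 1 :: nat"
  assumes J: "J \<subseteq> {..<n}" "independent_times A\<^sub>0 A\<^sub>1 J"
    and f: "continuous_map X euclideanreal f" "f ` A\<^sub>0 \<subseteq> {0}" "f ` A\<^sub>1 \<subseteq> {1}"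
    and m: "m > 0" and l: "l > 0"
    and \<delta>: "\<And>P w \<mu> \<nu>. P \<subseteq> {..<l} \<Longrightarrow> w \<subseteq> {..<l} \<Longrightarrow> \<mu> \<in> prob_measures X \<Longrightarrow> \<nu> \<in> prob_measures X \<Longrightarrow>
       D \<mu> \<nu> < \<delta> \<Longrightarrow> \<bar>(\<integral>x. pattern_function f P w x \<partial>\<mu>) - (\<integral>x. pattern_function f P w x \<partial>\<nu>)\<bar> < 1 / M"
    and n: "n > 0" and \<epsilon>: "\<epsilon> > 0" "2 * \<epsilon> \<le> \<delta>"
  shows "(\<delta> / (2 * \<epsilon>)) ^ (card {k\<in>{..n div l}. m \<le> card {p\<in>{..<l}. k * l + p \<in> J}} * M)
    \<le> sep_number (prob_measures X) D (push_forward X T) n \<epsilon>"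
proof -
  define G where "G = {k\<in>{..n div l}. m \<le> card {p\<in>{..<l}. k * l + p \<in> J}}"
  have finG: "finite G" by (simp add: G_def)
  have "(2::nat) ^ m \<ge> 2 ^ 1" using m by (intro power_increasing) auto
  then have M: "M > 0" by (simp add: M_def)
  \<comment> \<open>Exactly \<open>m\<close> positions are kept, so that all rich windows have the
    same number \<open>M\<close> of nonempty words.\<close>
  have "\<exists>Q. Q \<subseteq> {p\<in>{..<l}. k * l + p \<in> J} \<and> card Q = m" if "k \<in> G" for k
    using that by (auto simp: G_def dest: obtain_subset_with_card_n)
  then obtain Q where Q: "\<And>k. k \<in> G \<Longrightarrow> Q k \<subseteq> {p\<in>{..<l}. k * l + p \<in> J}" "\<And>k. k \<in> G \<Longrightarrow> card (Q k) = m"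
    by metis
  have Ql: "Q k \<subseteq> {..<l}" if "k \<in> G" for k using Q(1)[OF that] by blast
  have finQ: "finite (Q k)" if "k \<in> G" for k using Ql[OF that] finite_subset by blast
  have "\<exists>e. bij_betw e {0..<M} (Pow (Q k) - {{}})" if "k \<in> G" for k
  proof -
    have "card (Pow (Q k) - {{}}) = M" using finQ Q(2) that by (simp add: card_Pow M_def)
    then show ?thesis using ex_bij_betw_nat_finite[of "Pow (Q k) - {{}}"] finQ[OF that] by auto
  qed
  then obtain e where e: "\<And>k. k \<in> G \<Longrightarrow> bij_betw (e k) {0..<M} (Pow (Q k) - {{}})" by metis
  have e_word: "e k a \<subseteq> Q k" "e k a \<noteq> {}" if "k \<in> G" "a < M" for k a
    using bij_betwE[OF e[OF that(1)]] that(2) by auto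
  have e_inj: "e k a = e k b \<longleftrightarrow> a = b" if "k \<in> G" "a < M" "b < M" for k a b
    using inj_on_eq_iff[of "e k" "{0..<M}" a b] e[OF that(1)] that(2,3) by (simp add: bij_betw_def)
  \<comment> \<open>Time \<open>j\<close> is position \<open>j mod l\<close> of window
    \<open>j div l\<close>. The set \<open>A\<^sub>1\<close> is prescribed where the coin of the
    drawn label shows heads and the word of that label contains the position.\<close>
  define \<sigma> where "\<sigma> q j \<longleftrightarrow> snd q (j div l, fst q) \<and> j mod l \<in> e (j div l) (fst q)"
    for q :: "nat \<times> (nat \<times> nat \<Rightarrow> bool)" and j
  define y where "y q = (SOME x. x \<in> topspace X \<and> (\<forall>j\<in>J. (T ^^ j) x \<in> (if \<sigma> q j then A\<^sub>1 else A\<^sub>0)))" for q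
  have y: "y q \<in> topspace X" "\<And>j. j \<in> J \<Longrightarrow> (T ^^ j) (y q) \<in> (if \<sigma> q j then A\<^sub>1 else A\<^sub>0)" for q
  proof -
    have "\<exists>x. x \<in> topspace X \<and> (\<forall>j\<in>J. (T ^^ j) x \<in> (if \<sigma> q j then A\<^sub>1 else A\<^sub>0))"
      using J(2) unfolding independent_times_def by blast
    from someI_ex[OF this] show "y q \<in> topspace X"
      "\<And>j. j \<in> J \<Longrightarrow> (T ^^ j) (y q) \<in> (if \<sigma> q j then A\<^sub>1 else A\<^sub>0)"
      unfolding y_def by blast+
  qed
  have pattern: "pattern_function f (Q k) (e k a) ((T ^^ (k * l)) (y q)) = of_bool (fst q = a \<and> snd q (k, a))"
    if k: "k \<in> G" and a: "a < M" and q: "fst q < M" for k a q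
  proof -
    have f_val: "f ((T ^^ p) ((T ^^ (k * l)) (y q))) = of_bool (snd q (k, fst q) \<and> p \<in> e k (fst q))"
      if p: "p \<in> Q k" for p
    proof -
      have pl: "p < l" "k * l + p \<in> J" using Q(1)[OF k] p by auto
      have "(T ^^ p) ((T ^^ (k * l)) (y q)) = (T ^^ (k * l + p)) (y q)"
        by (simp add: funpow_add add.commute[of "k * l"])
      moreover have "(k * l + p) div l = k" "(k * l + p) mod l = p" using pl(1) by auto
      ultimately show ?thesis using y(2)[OF pl(2), of q] f(2,3) by (auto simp: \<sigma>_def split: if_splits)
    qed
    have "pattern_function f (Q k) (e k a) ((T ^^ (k * l)) (y q))
        = (\<Prod>p\<in>Q k. of_bool (p \<in> e k a \<longleftrightarrow> snd q (k, fst q) \<and> p \<in> e k (fst q)))"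
      unfolding pattern_function_def by (intro prod.cong refl) (simp add: f_val)
    also have "\<dots> = of_bool (\<forall>p\<in>Q k. p \<in> e k a \<longleftrightarrow> snd q (k, fst q) \<and> p \<in> e k (fst q))"
      using finQ[OF k] by (induction "Q k" rule: infinite_finite_induct) (auto simp: prod_eq_1_iff intro!: prod.neutral)
    also have "(\<forall>p\<in>Q k. p \<in> e k a \<longleftrightarrow> snd q (k, fst q) \<and> p \<in> e k (fst q))
        \<longleftrightarrow> e k a = (if snd q (k, fst q) then e k (fst q) else {})"
      using e_word[OF k a] e_word[OF k q] by auto
    \<comment> \<open>Tails show the empty word, which is none of the \<open>e k a\<close>, and
      distinct labels have distinct words.\<close>
    also have "\<dots> \<longleftrightarrow> fst q = a \<and> snd q (k, a)"
      using e_word[OF k a] e_inj[OF k a q] by auto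
    finally show ?thesis .
  qed
  define I where "I = G \<times> {..<M}"
  have I: "finite I" "card I = card G * M" using finG by (auto simp: I_def card_cartesian_product)
  define \<mu> where "\<mu> = cube_measure {..<M} I y"
  have \<mu>P: "\<mu> t \<in> prob_measures X" for t unfolding \<mu>_def by (intro cube_measure_prob_measures y)
  define F where "F i = pattern_function f (Q (fst i)) (e (fst i) (snd i))" for i
  have F_cont: "continuous_map X euclideanreal (F i)" if "i \<in> I" for i
    unfolding F_def using that finQ by (intro continuous_pattern_function f) (auto simp: I_def)
  have coord: "(\<integral>x. F i x \<partial>(push_forward X T ^^ (fst i * l)) (\<mu> t)) = t i / M"
    if i: "i \<in> I" and t: "\<forall>j\<in>I. t j \<in> {0..1}" for i t
  proof -
    obtain k a where ka: "i = (k, a)" "k \<in> G" "a < M" using i by (auto simp: I_def)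
    have "(\<integral>x. F i x \<partial>(push_forward X T ^^ (fst i * l)) (\<mu> t))
        = measure_pmf.expectation (cube_pmf {..<M} I t) (\<lambda>q. F i ((T ^^ (fst i * l)) (y q)))"
      unfolding \<mu>_def by (rule integral_cube_measure[OF y(1) F_cont[OF i]])
    \<comment> \<open>The identity \<open>pattern\<close> requires a label below \<open>M\<close>,
      which holds almost surely only.\<close>
    also have "\<dots> = measure_pmf.expectation (cube_pmf {..<M} I t) (\<lambda>q. of_bool (fst q = a \<and> snd q i))"
    proof (rule integral_cong_AE)
      have "{..<M} \<noteq> {}" using M by auto
      then show "AE q in measure_pmf (cube_pmf {..<M} I t).
          F i ((T ^^ (fst i * l)) (y q)) = of_bool (fst q = a \<and> snd q i)"
        using pattern[OF ka(2,3)] ka(1)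
        by (auto simp: AE_measure_pmf_iff cube_pmf_def F_def)
    qed auto
    also have "\<dots> = t i / card {..<M}"
      using ka t i I(1) by (intro expectation_cube_pmf_coordinate) auto
    finally show ?thesis by simp
  qed
  \<comment> \<open>On the face \<open>t i = 0\<close> the integral of \<open>F i\<close> is 0,
    which is membership in \<open>Z i\<close>; on the face \<open>t i = 1\<close> it is
    \<open>1 / M\<close>, and the choice of \<open>\<delta>\<close> turns this gap into
    distance.\<close>
  have "(\<delta> / (2 * \<epsilon>)) ^ card I \<le> sep_number (prob_measures X) D (push_forward X T) n \<epsilon>"
  proof (rule sep_number_cube[OF I(1) n \<epsilon> \<mu>P, where \<theta> = "\<lambda>i. fst i * l"
        and Z = "\<lambda>i. {\<nu> \<in> prob_measures X. (\<integral>x. F i x \<partial>\<nu>) = 0}"])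
    fix i assume i: "i \<in> I"
    then have k: "fst i \<in> G" by (auto simp: I_def)
    then have "Q (fst i) \<noteq> {}" using Q(2) m by fastforce
    then obtain p where "fst i * l + p \<in> J" using Q(1)[OF k] by blast
    then show "fst i * l < n" using J(1) by auto
  next
    fix d :: real assume "d > 0"
    have "{..<M} \<noteq> {}" using M by auto
    obtain \<tau> where "\<tau> > 0" and
      "\<And>t t' i. \<forall>j\<in>I. t j \<in> {0..1} \<Longrightarrow> \<forall>j\<in>I. t' j \<in> {0..1} \<Longrightarrow> \<forall>j\<in>I. \<bar>t j - t' j\<bar> \<le> \<tau> \<Longrightarrow>
         D ((push_forward X T ^^ i) (cube_measure {..<M} I y t))
           ((push_forward X T ^^ i) (cube_measure {..<M} I y t')) < d"
      by (rule cube_measure_uniformly_continuous[OF finite_lessThan \<open>{..<M} \<noteq> {}\<close> I(1) y(1) \<open>d > 0\<close>])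
        (rule that; assumption)
    from this[folded \<mu>_def] show "\<exists>\<tau>>0. \<forall>t t'. (\<forall>j\<in>I. t j \<in> {0..1}) \<longrightarrow> (\<forall>j\<in>I. t' j \<in> {0..1}) \<longrightarrow>
       (\<forall>j\<in>I. \<bar>t j - t' j\<bar> \<le> \<tau>) \<longrightarrow>
       (\<forall>i. D ((push_forward X T ^^ i) (\<mu> t)) ((push_forward X T ^^ i) (\<mu> t')) < d)" by blast
  next
    fix i t assume "i \<in> I" "\<forall>j\<in>I. t j \<in> {0..1::real}" "t i = 0"
    then show "(push_forward X T ^^ (fst i * l)) (\<mu> t) \<in> {\<nu> \<in> prob_measures X. (\<integral>x. F i x \<partial>\<nu>) = 0}"
      using coord funpow_push_forward_prob_measures[OF \<mu>P] by simp
  next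
    fix i t \<nu> assume i: "i \<in> I" "\<forall>j\<in>I. t j \<in> {0..1::real}" "t i = 1"
      and \<nu>: "\<nu> \<in> {\<nu> \<in> prob_measures X. (\<integral>x. F i x \<partial>\<nu>) = 0}"
    show "\<delta> \<le> D ((push_forward X T ^^ (fst i * l)) (\<mu> t)) \<nu>"
    proof (rule ccontr)
      assume "\<not> ?thesis"
      moreover have "Q (fst i) \<subseteq> {..<l}" "e (fst i) (snd i) \<subseteq> {..<l}"
        using i(1) Ql e_word(1) by (fastforce simp: I_def)+
      ultimately have "\<bar>(\<integral>x. F i x \<partial>(push_forward X T ^^ (fst i * l)) (\<mu> t)) - (\<integral>x. F i x \<partial>\<nu>)\<bar> < 1 / M"
        using \<nu> unfolding F_def by (intro \<delta> funpow_push_forward_prob_measures \<mu>P) auto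
      then show False using \<nu> coord[OF i(1,2)] i(3) by simp
    qed
  qed auto
  then show ?thesis by (simp add: I(2) G_def)
qed

text \<open>The gap \<open>\<delta>\<close> comes from the finitely many patterns on a window of
  length \<open>l\<close>, and \<open>l\<close> depends on \<open>K\<close> and the density
  \<open>c\<close> alone. As \<open>\<delta>\<close> is independent of \<open>n\<close> and
  \<epsilon>, the base \<open>\<delta> / (2 * \<epsilon>)\<close> grows when \<epsilon> tends to 0
  while the exponent \<open>K * n\<close> stays.\<close>

lemma sep_number_positive_entropy:
  fixes K :: real
  assumes "topological_entropy X T > 0" "K > 0"
  obtains \<delta> where "\<delta> > 0" "\<And>\<epsilon>. \<epsilon> > 0 \<Longrightarrow> 2 * \<epsilon> \<le> \<delta> \<Longrightarrow> \<exists>\<^sub>F n in sequentially. n > 0 \<and>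
    (\<delta> / (2 * \<epsilon>)) powr (K * n) \<le> sep_number (prob_measures X) D (push_forward X T) n \<epsilon>"
proof -
  obtain A\<^sub>0 A\<^sub>1 and c :: real where A: "closedin X A\<^sub>0" "closedin X A\<^sub>1" "A\<^sub>0 \<inter> A\<^sub>1 = {}" and c: "c > 0"
    and freq: "\<exists>\<^sub>F n in sequentially. \<exists>J\<subseteq>{..<n}. c * n \<le> card J \<and> independent_times A\<^sub>0 A\<^sub>1 J"
    by (rule positive_entropy_independence[OF assms(1)]) (rule that; assumption)
  have "normal_space X" by (rule metrizable_imp_normal_space[OF metrizable])
  then obtain f where f: "continuous_map X euclideanreal f" "f ` A\<^sub>0 \<subseteq> {0}" "f ` A\<^sub>1 \<subseteq> {1}"
    using A(1,2) A(3)[folded disjnt_def] by (rule Urysohn_lemma_alt) (rule that; assumption)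
  \<comment> \<open>Chosen for \<open>rate\<close> below: there will be at least
    \<open>c * n / (2 * l)\<close> rich windows with \<open>M\<close> dimensions each, and the total
    has to reach \<open>K * n\<close>.\<close>
  define m where "m = Suc (nat \<lceil>8 * K / c * (4 / c + 1)\<rceil>)"
  have m: "m > 0" "8 * K / c * (4 / c + 1) \<le> m" unfolding m_def by linarith+
  define M :: nat where "M = 2 ^ m - 1"
  have M: "real M = 2 ^ m - 1" by (simp add: M_def of_nat_diff)
  have "(2::real) ^ m \<ge> 2 ^ 1" using m by (intro power_increasing) auto
  then have "real M \<ge> 1" using M by simp
  then have M0: "M > 0" by simp
  \<comment> \<open>At density \<open>c\<close> a window of this length contains at least
    \<open>4 * m\<close> elements of \<open>J\<close> on average, so complete windows with fewer
    than \<open>m\<close> hold at most a quarter of \<open>c * n\<close>.\<close>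
  define l where "l = nat \<lceil>4 * m / c\<rceil>"
  have "4 * m / c > 0" using c m by simp
  then have l: "4 * m / c \<le> l" "l < 4 * m / c + 1" "l > 0" unfolding l_def by linarith+
  have rate: "2 * K * l \<le> c * M"
  proof -
    have "2 * K * l \<le> 2 * K * (4 * m / c + m)" using l(2) m(1) assms(2) by (intro mult_left_mono) auto
    also have "\<dots> = 8 * K / c * (4 / c + 1) * m * c / 4" using c by (simp add: field_simps)
    also have "\<dots> \<le> m * m * c / 4"
    proof -
      have "8 * K / c * (4 / c + 1) * m \<le> real m * m" by (intro mult_right_mono m) simp
      then have "8 * K / c * (4 / c + 1) * m * c \<le> real m * m * c" by (rule mult_right_mono) (use c in simp)
      then show ?thesis by (intro divide_right_mono) simp_all
    qed
    also have "\<dots> \<le> c * M"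
      using mult_right_mono[OF square_le_four_power_minus_one[of m], of c] c M by simp
    finally show ?thesis .
  qed
  define \<Phi> where "\<Phi> = (\<lambda>(P, w). pattern_function f P w) ` (Pow {..<l} \<times> Pow {..<l})"
  have \<Phi>: "finite \<Phi>" "\<And>g. g \<in> \<Phi> \<Longrightarrow> continuous_map X euclideanreal g"
    by (auto simp: \<Phi>_def intro!: continuous_pattern_function f(1) intro: finite_subset)
  define ok where "ok g d \<longleftrightarrow> d > 0 \<and> (\<forall>\<mu>\<in>prob_measures X. \<forall>\<nu>\<in>prob_measures X. D \<mu> \<nu> < d \<longrightarrow>
      \<bar>(\<integral>x. g x \<partial>\<mu>) - (\<integral>x. g x \<partial>\<nu>)\<bar> < 1 / M)" for g d
  have "\<exists>d. ok g d" if "g \<in> \<Phi>" for g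
  proof -
    have "1 / M > 0" using M0 by simp
    from integral_uniformly_continuous[OF \<Phi>(2)[OF that] this] show ?thesis unfolding ok_def by metis
  qed
  then obtain d where d: "\<And>g. g \<in> \<Phi> \<Longrightarrow> ok g (d g)" by metis
  define \<delta> where "\<delta> = Min (insert 1 (d ` \<Phi>))"
  have "\<delta> > 0" using \<Phi>(1) d by (auto simp: \<delta>_def ok_def)
  have \<delta>_le: "\<delta> \<le> d g" if "g \<in> \<Phi>" for g unfolding \<delta>_def using \<Phi>(1) that by (intro Min_le) auto
  have \<delta>: "\<bar>(\<integral>x. pattern_function f P w x \<partial>\<mu>) - (\<integral>x. pattern_function f P w x \<partial>\<nu>)\<bar> < 1 / (2 ^ m - 1 :: nat)"
    if "P \<subseteq> {..<l}" "w \<subseteq> {..<l}" "\<mu> \<in> prob_measures X" "\<nu> \<in> prob_measures X" "D \<mu> \<nu> < \<delta>" for P w \<mu> \<nu>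
  proof -
    have g: "pattern_function f P w \<in> \<Phi>" using that by (auto simp: \<Phi>_def)
    then show ?thesis using d[OF g] \<delta>_le[OF g] that unfolding ok_def M_def by force
  qed
  show thesis
  proof (rule that[OF \<open>\<delta> > 0\<close>])
    fix \<epsilon> :: real assume \<epsilon>: "\<epsilon> > 0" "2 * \<epsilon> \<le> \<delta>"
    show "\<exists>\<^sub>F n in sequentially. n > 0 \<and>
      (\<delta> / (2 * \<epsilon>)) powr (K * n) \<le> sep_number (prob_measures X) D (push_forward X T) n \<epsilon>"
      using frequently_eventually_frequently[OF freq eventually_ge_at_top[of "Suc (nat \<lceil>4 * m / c\<rceil>)"]]
    proof (rule frequently_elim1)
      fix n assume *: "(\<exists>J\<subseteq>{..<n}. c * n \<le> card J \<and> independent_times A\<^sub>0 A\<^sub>1 J) \<and> Suc (nat \<lceil>4 * m / c\<rceil>) \<le> n"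
      then obtain J where J: "J \<subseteq> {..<n}" "c * n \<le> card J" "independent_times A\<^sub>0 A\<^sub>1 J" by blast
      have n: "n > 0" "4 * m / c \<le> n" using * by linarith+
      define G where "G = {k\<in>{..n div l}. m \<le> card {p\<in>{..<l}. k * l + p \<in> J}}"
      have "(\<delta> / (2 * \<epsilon>)) ^ (card G * M) \<le> sep_number (prob_measures X) D (push_forward X T) n \<epsilon>"
        unfolding G_def M_def by (rule independent_times_cube[OF J(1,3) f m(1) l(3) \<delta> n(1) \<epsilon>])
      moreover have "K * n \<le> card G * M"
      proof -
        have "card J \<le> card G * l + (n div l + 1) * m"
          unfolding G_def by (rule card_le_rich_windows[OF J(1) l(3)])
        then have "real (card J) \<le> real (card G * l + (n div l + 1) * m)" by (simp only: of_nat_le_iff)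
        also have "\<dots> = card G * l + real (n div l) * m + m" by (simp add: algebra_simps)
        finally have "c * n \<le> card G * l + real (n div l) * m + m" using J(2) by linarith
        moreover have "real (n div l) * m \<le> c * n / 4"
        proof -
          have "m \<le> l * c / 4" using l(1) c by (simp add: pos_divide_le_eq)
          then have "real (n div l) * m \<le> real (n div l) * (l * c / 4)" by (rule mult_left_mono) simp
          also have "\<dots> = real (n div l * l) * (c / 4)" by simp
          also have "\<dots> \<le> real n * (c / 4)"
            using c by (intro mult_right_mono of_nat_mono div_times_less_eq_dividend) simp
          finally show ?thesis by (simp add: mult.commute)
        qed
        \<comment> \<open>The incomplete last window is absorbed because \<open>n\<close> is at
          least \<open>4 * m / c\<close>.\<close>
        moreover have "m \<le> c * n / 4" using n(2) c by (simp add: field_simps)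
        ultimately have "c * n / 2 \<le> real (card G) * real l" by simp
        then have "c * n / 2 * M \<le> real (card G) * real l * real M" by (rule mult_right_mono) simp
        moreover have "2 * K * l * (n / 2) \<le> c * M * (n / 2)" by (intro mult_right_mono rate) auto
        ultimately have "real l * (K * n) \<le> real l * (real (card G) * real M)" by (simp add: algebra_simps)
        then show ?thesis using l(3) by simp
      qed
      ultimately have "(\<delta> / (2 * \<epsilon>)) powr (K * n) \<le> sep_number (prob_measures X) D (push_forward X T) n \<epsilon>"
      proof -
        assume 1: "(\<delta> / (2 * \<epsilon>)) ^ (card G * M) \<le> sep_number (prob_measures X) D (push_forward X T) n \<epsilon>"
          and 2: "K * n \<le> card G * M"
        have "1 \<le> \<delta> / (2 * \<epsilon>)" using \<epsilon> by (simp add: pos_le_divide_eq)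
        then have "(\<delta> / (2 * \<epsilon>)) powr (K * n) \<le> (\<delta> / (2 * \<epsilon>)) powr (card G * M)" using 2 by (intro powr_mono) auto
        also have "\<dots> = (\<delta> / (2 * \<epsilon>)) ^ (card G * M)" using \<epsilon> \<open>\<delta> > 0\<close> by (subst powr_realpow[symmetric]) auto
        finally show ?thesis using 1 by linarith
      qed
      then show "n > 0 \<and> (\<delta> / (2 * \<epsilon>)) powr (K * n) \<le> sep_number (prob_measures X) D (push_forward X T) n \<epsilon>"
        using n by simp
    qed
  qed
qed

text \<open>The entropy at a fixed scale is a limit superior in \<open>n\<close>, so the bound for
  infinitely many \<open>n\<close> suffices; no such freedom is left in \<epsilon>, for which the
  bound holds throughout.\<close>

lemma lower_mdim_positive_entropy:
  assumes "topological_entropy X T > 0"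
  shows "lower_mdim (prob_measures X) D (push_forward X T) = \<infinity>"
proof (rule ereal_top)
  fix B :: real
  define K where "K = 2 * max 1 B"
  have K: "K > 0" "B \<le> K / 2" by (auto simp: K_def)
  obtain \<delta> where \<delta>: "\<delta> > 0" "\<And>\<epsilon>. \<epsilon> > 0 \<Longrightarrow> 2 * \<epsilon> \<le> \<delta> \<Longrightarrow> \<exists>\<^sub>F n in sequentially. n > 0 \<and>
    (\<delta> / (2 * \<epsilon>)) powr (K * n) \<le> sep_number (prob_measures X) D (push_forward X T) n \<epsilon>"
    by (rule sep_number_positive_entropy[OF assms K(1)]) (rule that; assumption)
  have scale: "ereal (K * ln (\<delta> / (2 * \<epsilon>))) \<le> entropy_at_scale (prob_measures X) D (push_forward X T) \<epsilon>"
    if \<epsilon>: "\<epsilon> > 0" "2 * \<epsilon> \<le> \<delta>" for \<epsilon>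
  proof (rule ccontr)
    define q where "q n = real (sep_number (prob_measures X) D (push_forward X T) n \<epsilon>)" for n
    assume "\<not> ?thesis"
    then have "\<forall>\<^sub>F n in sequentially. ereal (ln (q n) / real n) < ereal (K * ln (\<delta> / (2 * \<epsilon>)))"
      unfolding entropy_at_scale_def q_def not_le by (rule Limsup_lessD)
    with \<delta>(2)[OF \<epsilon>] have "\<exists>\<^sub>F n in sequentially. (n > 0 \<and> (\<delta> / (2 * \<epsilon>)) powr (K * n) \<le> q n) \<and>
        ereal (ln (q n) / real n) < ereal (K * ln (\<delta> / (2 * \<epsilon>)))"
      unfolding q_def by (rule frequently_eventually_frequently)
    then obtain n where n: "n > 0" "(\<delta> / (2 * \<epsilon>)) powr (K * n) \<le> q n" "ln (q n) / real n < K * ln (\<delta> / (2 * \<epsilon>))"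
      by (auto dest: frequently_ex)
    have "K * n * ln (\<delta> / (2 * \<epsilon>)) = ln ((\<delta> / (2 * \<epsilon>)) powr (K * n))" using \<delta>(1) \<epsilon>(1) by (simp add: ln_powr)
    also have "\<dots> \<le> ln (q n)"
    proof -
      have "(\<delta> / (2 * \<epsilon>)) powr (K * n) > 0" using \<delta>(1) \<epsilon>(1) by simp
      moreover from this n(2) have "q n > 0" by (rule less_le_trans)
      ultimately show ?thesis using n(2) by (rule ln_le_cancel_iff[THEN iffD2])
    qed
    also have "\<dots> < K * ln (\<delta> / (2 * \<epsilon>)) * n" using n(1,3) by (simp add: pos_divide_less_eq)
    finally show False by (simp add: algebra_simps)
  qed
  have "ereal (K / 2) \<le> lower_mdim (prob_measures X) D (push_forward X T)"
    unfolding lower_mdim_def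
  proof (rule Liminf_bounded)
    \<comment> \<open>The square gives \<open>ln (\<delta> / (2 * \<epsilon>)) \<ge> ln (1 /
      \<epsilon>) / 2\<close>, which is why \<open>K\<close> is twice the target; the cap 1 makes
      \<open>ln (1 / \<epsilon>)\<close> positive.\<close>
    define r where "r = min 1 (min (\<delta> / 2) ((\<delta> / 2)\<^sup>2))"
    have "r > 0" using \<delta>(1) by (simp add: r_def)
    then have "\<forall>\<^sub>F \<epsilon> in at_right (0::real). 0 < \<epsilon> \<and> \<epsilon> < r"
      using eventually_at_right[of 0 r] by (auto intro: exI[of _ r])
    then show "\<forall>\<^sub>F \<epsilon> in at_right 0. ereal (K / 2)
        \<le> entropy_at_scale (prob_measures X) D (push_forward X T) \<epsilon> / ereal (ln (1 / \<epsilon>))"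
    proof eventually_elim
      case (elim \<epsilon>)
      then have \<epsilon>: "0 < \<epsilon>" "\<epsilon> < 1" "2 * \<epsilon> \<le> \<delta>" "\<epsilon> < (\<delta> / 2)\<^sup>2" by (auto simp: r_def)
      have "ln \<epsilon> < ln ((\<delta> / 2)\<^sup>2)" using \<epsilon> \<delta>(1) by (subst ln_less_cancel_iff) auto
      then have "ln \<epsilon> < 2 * ln (\<delta> / 2)" using \<delta>(1) by (simp add: ln_realpow)
      moreover have "ln (\<delta> / (2 * \<epsilon>)) = ln (\<delta> / 2) - ln \<epsilon>" using \<epsilon>(1) \<delta>(1) by (simp add: ln_div ln_mult)
      moreover have "ln (1 / \<epsilon>) = - ln \<epsilon>" using \<epsilon>(1) by (simp add: ln_div)
      ultimately have "ln (1 / \<epsilon>) / 2 \<le> ln (\<delta> / (2 * \<epsilon>))" by linarith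
      then have "K * (ln (1 / \<epsilon>) / 2) \<le> K * ln (\<delta> / (2 * \<epsilon>))" using K(1) by (intro mult_left_mono) auto
      then have "ereal (ln (1 / \<epsilon>)) * ereal (K / 2) \<le> ereal (K * ln (\<delta> / (2 * \<epsilon>)))" by (simp add: mult.commute)
      also have "\<dots> \<le> entropy_at_scale (prob_measures X) D (push_forward X T) \<epsilon>" by (rule scale[OF \<epsilon>(1,3)])
      finally show ?case using \<epsilon>(1,2) by (subst ereal_le_divide_pos) auto
    qed
  qed
  then show "ereal B \<le> lower_mdim (prob_measures X) D (push_forward X T)"
    using K(2) by (meson ereal_less_eq(3) order_trans)
qed

end

theorem mainTheorem2:
  fixes X :: "'a topology" and T :: "'a \<Rightarrow> 'a"
    and D :: "'a measure \<Rightarrow> 'a measure \<Rightarrow> real"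
  assumes "compact_space X" and "metrizable_space X"
    and "continuous_map X X T"
    and "Metric_space (prob_measures X) D"
    and "Metric_space.mtopology (prob_measures X) D = weak_star_topology X"
  shows "(topological_entropy X T > 0 \<longleftrightarrow>
            (\<exists>v>0. has_mdim (prob_measures X) D (push_forward X T) v)) \<and>
         ((\<exists>v>0. has_mdim (prob_measures X) D (push_forward X T) v) \<longleftrightarrow>
            has_mdim (prob_measures X) D (push_forward X T) \<infinity>)"
proof -
  interpret induced_system X D T
    using assms by (intro induced_system.intro induced_system_axioms.intro)
  have pos: "has_mdim (prob_measures X) D (push_forward X T) \<infinity>" if "topological_entropy X T > 0"
  proof -
    have "lower_mdim (prob_measures X) D (push_forward X T) = \<infinity>"
      by (rule lower_mdim_positive_entropy[OF that])
    moreover have "lower_mdim (prob_measures X) D (push_forward X T)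
        \<le> upper_mdim (prob_measures X) D (push_forward X T)"
      unfolding lower_mdim_def upper_mdim_def by (rule Liminf_le_Limsup) simp
    ultimately show ?thesis by (simp add: has_mdim_def)
  qed
  have zero: "topological_entropy X T > 0"
    if "v > 0" "has_mdim (prob_measures X) D (push_forward X T) v" for v
  proof (rule ccontr)
    assume "\<not> ?thesis"
    then have "upper_mdim (prob_measures X) D (push_forward X T) \<le> 0" by (rule upper_mdim_zero_entropy)
    then show False using that by (simp add: has_mdim_def)
  qed
  have "(0::ereal) < \<infinity>" by simp
  then show ?thesis using pos zero by metis
qed


end
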